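(* As $n\to\infty$, one has the distributional convergence in the Skorokhod space $D([0,\infty[)$, $$\Big(\sqrt n\Big(\frac{D_{\lfloor nt\rfloor}}{\lfloor nt\rfloor}-\frac12\Big),\ t\ge 0\Big)\Longrightarrow\big(W_t,\ t\ge 0\big),$$ where $(W_t)$ is a real-valued centered Gaussian process starting at the origin with covariance given, for all $0<s\le t$, by $$\mathbb{E}[W_sW_t]=\frac{s}{12t^2}.$$ In particular, one recovers the asymptotic normality: $\sqrt n\big(\frac{D_n}{n}-\frac12\big)$ converges in distribution to the Gaussian law $\mathcal{N}(0,1/12)$.
   Context: The sequence $(D_n)_{n\ge1}$ is constructed on a single probability space as follows. Let $(V_n)$ be a sequence of independent random variables, $V_n$ being uniformly distributed on $\{1,\dots,n\}$. Set $\pi_1=(1)$ and, for $n\ge1$, define the permutation $\pi_{n+1}$ of $\{1,\dots,n+1\}$ by $\pi_{n+1}(k)=\pi_n(k)$ if $k<V_{n+1}$, $\pi_{n+1}(k)=n+1$ if $k=V_{n+1}$, and $\pi_{n+1}(k)=\pi_n(k-1)$ if $k>V_{n+1}$. Then $\pi_n$ is uniformly distributed on the symmetric group on $\{1,\dots,n\}$. $D_n$ is the number of descents of $\pi_n$: $D_n=\#\{k\in\{1,\dots,n-1\}:\pi_n(k)>\pi_n(k+1)\}$, with $D_1=0$. With $\mathcal{F}_n=\sigma(D_1,\dots,D_n)$, one has $\mathbb{P}(D_{n+1}=D_n+1\mid\mathcal{F}_n)=\frac{n-D_n}{n+1}$ and $\mathbb{P}(D_{n+1}=D_n\mid\mathcal{F}_n)=\frac{D_n+1}{n+1}$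 for all $n\ge1$. $D([0,\infty[)$ denotes the Skorokhod space of right-continuous functions on $[0,\infty[$ with left-hand limits, and $\lfloor\cdot\rfloor$ is the integer part.
   Formalization: Since Var W_t = 1/(12t) explodes as t→0, W has no version right-continuous at 0 (and D_0/0 is undefined), so convergence in D([0,∞[) is replaced by Skorokhod convergence of the paths on [e,∞[ for every e>0, with one single process W. *)

theory Defs
  imports "HOL-Probability.Probability"
begin

(* In ins_perm v n, the permutation obtained from the insertion positions v 2, ..., v n, only the
   values at 1, ..., n are meaningful. The clause for 0 is a dummy. *)
fun ins_perm :: "(nat \<Rightarrow> nat) \<Rightarrow> nat \<Rightarrow> nat \<Rightarrow> nat" where
  "ins_perm v 0 = id"
| "ins_perm v (Suc 0) = id"
| "ins_perm v (Suc (Suc n)) = (\<lambda>k.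
     if k < v (Suc (Suc n)) then ins_perm v (Suc n) k
     else if k = v (Suc (Suc n)) then Suc (Suc n)
     else ins_perm v (Suc n) (k - 1))"

definition descents :: "(nat \<Rightarrow> nat) \<Rightarrow> nat \<Rightarrow> nat" where
  "descents v n = card {k \<in> {1..n - 1}. ins_perm v n k > ins_perm v n (k + 1)}"

(* For n * t < 1 the quotient is 0 / 0, which HOL evaluates to 0. *)
definition descent_process :: "(nat \<Rightarrow> nat) \<Rightarrow> nat \<Rightarrow> real \<Rightarrow> real" where
  "descent_process v n t =
     (let m = nat \<lfloor>real n * t\<rfloor> in sqrt (real n) * (real (descents v m) / real m - 1 / 2))"

(* Functions on the half-line are represented by total functions that are undefined at negative
   times, so that equality in skorokhod_space is equality of functions on the half-line. *)
definition skorokhod_space :: "(real \<Rightarrow> real) set" where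
  "skorokhod_space = {x \<in> extensional {0..}.
     (\<forall>t\<ge>0. (x \<longlongrightarrow> x t) (at_right t)) \<and> (\<forall>t>0. \<exists>l. (x \<longlongrightarrow> l) (at_left t))}"

(* Continuity of a time change is automatic: it is a monotone surjection of the half-line. *)
definition time_changes :: "(real \<Rightarrow> real) set" where
  "time_changes = {\<tau>. strict_mono_on {0..} \<tau> \<and> \<tau> ` {0..} = {0..}}"

(* Convergence of sequences in the J1 topology (Jacod and Shiryaev, Limit Theorems for Stochastic
   Processes, Theorem VI.1.14). *)
definition J1_converges :: "(nat \<Rightarrow> real \<Rightarrow> real) \<Rightarrow> (real \<Rightarrow> real) \<Rightarrow> bool" where
  "J1_converges X x \<longleftrightarrow> (\<exists>L. (\<forall>n. L n \<in> time_changes) \<and>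
     uniform_limit {0..} L (\<lambda>t. t) sequentially \<and>
     (\<forall>b. uniform_limit {0..b} (\<lambda>n t. X n (L n t)) x sequentially))"

(* The J1 topology is metrizable, hence sequential: its open sets are the sequentially open ones. *)
definition skorokhod_open :: "(real \<Rightarrow> real) set \<Rightarrow> bool" where
  "skorokhod_open U \<longleftrightarrow> U \<subseteq> skorokhod_space \<and>
     (\<forall>x\<in>U. \<forall>X. (\<forall>n. X n \<in> skorokhod_space) \<and> J1_converges X x
        \<longrightarrow> (\<forall>\<^sub>F n in sequentially. X n \<in> U))"

definition skorokhod :: "(real \<Rightarrow> real) topology" where
  "skorokhod = topology skorokhod_open"

lemma istopology_skorokhod_open: "istopology skorokhod_open"
  unfolding istopology_def
proof (intro conjI allI impI)
  fix S T assume "skorokhod_open S" "skorokhod_open T"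
  then show "skorokhod_open (S \<inter> T)"
    unfolding skorokhod_open_def by (auto intro: eventually_conj)
next
  fix \<K> assume *: "\<forall>K\<in>\<K>. skorokhod_open K"
  show "skorokhod_open (\<Union>\<K>)"
    unfolding skorokhod_open_def
  proof (intro conjI ballI allI impI)
    show "\<Union>\<K> \<subseteq> skorokhod_space"
      using * by (auto simp: skorokhod_open_def)
  next
    fix x X assume "x \<in> \<Union>\<K>" and X: "(\<forall>n. X n \<in> skorokhod_space) \<and> J1_converges X x"
    then obtain K where K: "K \<in> \<K>" "x \<in> K" by auto
    then have "\<forall>\<^sub>F n in sequentially. X n \<in> K"
      using * X by (auto simp: skorokhod_open_def)
    then show "\<forall>\<^sub>F n in sequentially. X n \<in> \<Union>\<K>"
      by eventually_elim (use K in auto)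
  qed
qed

lemma openin_skorokhod: "openin skorokhod = skorokhod_open"
  unfolding skorokhod_def by (rule topology_inverse'[OF istopology_skorokhod_open])

lemma topspace_skorokhod: "topspace skorokhod = skorokhod_space"
proof -
  have "skorokhod_open skorokhod_space"
    by (simp add: skorokhod_open_def)
  moreover have "U \<subseteq> skorokhod_space" if "skorokhod_open U" for U
    using that by (simp add: skorokhod_open_def)
  ultimately show ?thesis
    unfolding topspace_def openin_skorokhod by blast
qed

definition borel_of_topology :: "'s topology \<Rightarrow> 's measure" where
  "borel_of_topology T = sigma (topspace T) {U. openin T U}"

definition converges_in_distribution ::
  "'s topology \<Rightarrow> 'a measure \<Rightarrow> (nat \<Rightarrow> 'a \<Rightarrow> 's) \<Rightarrow> 'b measure \<Rightarrow> ('b \<Rightarrow> 's) \<Rightarrow> bool" where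
  "converges_in_distribution T M X N Y \<longleftrightarrow>
     (\<forall>n. X n \<in> measurable M (borel_of_topology T)) \<and>
     Y \<in> measurable N (borel_of_topology T) \<and>
     (\<forall>f. continuous_map T euclideanreal f \<and> bounded (f ` topspace T) \<longrightarrow>
        (\<lambda>n. \<integral>\<omega>. f (X n \<omega>) \<partial>M) \<longlonglongrightarrow> (\<integral>\<omega>. f (Y \<omega>) \<partial>N))"

(* Possibly degenerate: Dirac measures count as Gaussian. *)
definition gaussian_variable :: "'b measure \<Rightarrow> ('b \<Rightarrow> real) \<Rightarrow> bool" where
  "gaussian_variable N Y \<longleftrightarrow> Y \<in> borel_measurable N \<and>
     (\<exists>\<mu> \<sigma>. (\<sigma> > 0 \<and> distributed N lborel Y (normal_density \<mu> \<sigma>)) \<or> (AE \<omega> in N. Y \<omega> = \<mu>))"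

definition gaussian_process :: "'b measure \<Rightarrow> 'i set \<Rightarrow> ('i \<Rightarrow> 'b \<Rightarrow> real) \<Rightarrow> bool" where
  "gaussian_process N I W \<longleftrightarrow>
     (\<forall>J a. finite J \<and> J \<subseteq> I \<longrightarrow> gaussian_variable N (\<lambda>\<omega>. \<Sum>t\<in>J. a t * W t \<omega>))"

definition centered_process :: "'b measure \<Rightarrow> 'i set \<Rightarrow> ('i \<Rightarrow> 'b \<Rightarrow> real) \<Rightarrow> bool" where
  "centered_process N I W \<longleftrightarrow>
     (\<forall>t\<in>I. integrable N (W t) \<and> (\<integral>\<omega>. W t \<omega> \<partial>N) = 0)"

(* The limit W has variance 1 / (12 * t) at t > 0, which explodes as t tends to 0, so W has no version
   that is right-continuous at 0. Convergence is therefore that of the processes indexed by [e, \<infinity>),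
   for every e > 0; the Skorokhod space over [e, \<infinity>) is identified with that over [0, \<infinity>) by
   translation of time. *)
definition path_from :: "real \<Rightarrow> (real \<Rightarrow> real) \<Rightarrow> real \<Rightarrow> real" where
  "path_from e x = (\<lambda>t\<in>{0..}. x (e + t))"

end

theory Submission
  imports Defs
begin

text \<open>
Let \<open>M\<^sub>n = n (D\<^sub>n - (n - 1) / 2)\<close>. Given the past, the increment \<open>M\<^sub>n\<^sub>+\<^sub>1 - M\<^sub>n\<close> is \<open>D\<^sub>n + 1\<close> or
\<open>D\<^sub>n - n\<close>, so \<open>M\<close> is a martingale with increments bounded by \<open>n\<close> and conditional variances
\<open>(n - D\<^sub>n) (D\<^sub>n + 1) = ((n + 1) / 2)\<^sup>2 - (M\<^sub>n / n)\<^sup>2\<close>, which are deterministic up to a term of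
smaller order. A second-order expansion of the characteristic function, one increment at a time, gives
the Gaussian limit of the finite-dimensional distributions, and a fourth-moment maximal inequality
controls the oscillation between the points of a grid.

The limit is \<open>W\<^sub>t = (1 + t\<^sup>3) / (\<surd>12 t\<^sup>2) b(t\<^sup>3 / (1 + t\<^sup>3))\<close> for a Brownian bridge \<open>b\<close>, built as a
Schauder series. Its paths are continuous on \<open>(0, \<infinity>)\<close>, so it suffices to work with a distance \<open>d\<close> of
locally uniform convergence, which is stronger than J1 convergence. A bounded J1-continuous functional
\<open>f\<close> is the increasing limit of the \<open>L\<close>-Lipschitz functionals \<open>inf\<^sub>y (f y + L d(x, y))\<close>; these may be
evaluated on step functions over a grid, where finite-dimensional convergence applies.
\<close>

section \<open>Descents under insertion of the maximum\<close>

text \<open>The factor \<open>n\<close> in the martingale undoes the drift: one insertion contracts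
  the mean of \<open>D_n - (n - 1) / 2\<close> by \<open>n / (n + 1)\<close>. The variances
  \<open>((l + 1) / 2)^2\<close> add up to about \<open>m^3 / 12\<close> over \<open>l < m\<close>,
  so the martingale at index \<open>n t\<close> is about \<open>n^(3/2) / \<surd>12\<close> times a
  Brownian motion at time \<open>t^3\<close>; the process divides it by
  \<open>(n t)^2 / \<surd>n\<close>. Hence the clock \<open>t^3\<close> and the constant 12. A
  bridge is built because a single series on \<open>[0, 1]\<close> then covers the whole half-line.

  Fourth moments are forced by the oscillation: a grid of mesh \<open>1 / k\<close> has of order
  \<open>k\<close> blocks, and second moments would cost \<open>1 / k\<close> per block, which does
  not decay after summation; fourth moments cost \<open>1 / k^2\<close>.

  Lipschitz functionals replace compactness in the space of paths: passing to a step function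
  changes the value by at most \<open>L\<close> times the distance, so the oscillation bound enters
  directly and no limit point of laws is extracted. Approximation from below yields only a lower
  bound for expectations; the functional \<open>- f\<close> supplies the other one.\<close>

lemma ins_perm_le: "ins_perm v n k \<le> max n k"
proof (induction v n arbitrary: k rule: ins_perm.induct)
  case (3 v n)
  have "ins_perm v (Suc n) k \<le> max (Suc n) k" if "k < v (Suc (Suc n))"
    using 3(1) that by blast
  moreover have "ins_perm v (Suc n) (k - 1) \<le> max (Suc n) (k - 1)"
    if "\<not> k < v (Suc (Suc n))" "k \<noteq> v (Suc (Suc n))"
    using 3(2) that by blast
  ultimately show ?case by force
qed auto

lemma descents_eq_sum:
  "descents v n = (\<Sum>k = 1..n - 1. of_bool (ins_perm v n (k + 1) < ins_perm v n k))"
  unfolding descents_def by (simp add: Int_def)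

lemma descents_le: "descents v n \<le> n - 1"
proof -
  have "descents v n \<le> card {1..n - 1}"
    unfolding descents_def by (rule card_mono) auto
  then show ?thesis by simp
qed

lemma ins_perm_cong:
  assumes "\<And>i. i \<in> {1..n} \<Longrightarrow> v i = w i"
  shows "ins_perm v n = ins_perm w n"
  using assms
proof (induction n)
  case (Suc n)
  then have "ins_perm v n = ins_perm w n" "v (Suc n) = w (Suc n)"
    by simp_all
  then show ?case by (cases n) auto
qed auto

lemma descents_cong:
  assumes "\<And>i. i \<in> {1..n} \<Longrightarrow> v i = w i"
  shows "descents v n = descents w n"
  unfolding descents_def using ins_perm_cong[OF assms] by simp

text \<open>The places at which inserting the new maximum leaves the number of descents unchanged:
  the far end, and the gap inside an existing descent. Place \<open>k + 1\<close> is the gap between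
  the entries at \<open>k\<close> and \<open>k + 1\<close>, whence \<open>Suc\<close>. Their number
  \<open>D_n + 1\<close> is the source of the transition probability.\<close>

definition keeps_descents :: "(nat \<Rightarrow> nat) \<Rightarrow> nat \<Rightarrow> nat set" where
  "keeps_descents v n = insert (Suc n)
      (Suc ` {k \<in> {1..n - 1}. ins_perm v n (k + 1) < ins_perm v n k})"

lemma keeps_descents_subset: "keeps_descents v n \<subseteq> {1..Suc n}"
  by (auto simp: keeps_descents_def)

lemma card_keeps_descents: "card (keeps_descents v n) = Suc (descents v n)"
  unfolding keeps_descents_def descents_def
  by (subst card_insert_disjoint) (auto simp: card_image)

text \<open>The new maximum at \<open>p \<le> n\<close> creates a descent from \<open>p\<close> to
  \<open>p + 1\<close> and separates the old neighbours at \<open>p - 1\<close> and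
  \<open>p\<close>; pairs to the left stay, pairs to the right move by one. The count therefore
  rises by one unless the separated pair was a descent. At \<open>p = 1\<close> no pair is
  separated, and at the far end no descent is created.\<close>

lemma descents_Suc:
  assumes n: "n \<ge> 1" and p: "v (Suc n) = p" "p \<in> {1..Suc n}"
  shows "descents v (Suc n) = (if p \<in> keeps_descents v n then descents v n else Suc (descents v n))"
proof -
  define f where "f = ins_perm v n"
  define g where "g = ins_perm v (Suc n)"
  define df where "df k = (of_bool (f (k + 1) < f k) :: nat)" for k
  define dg where "dg k = (of_bool (g (k + 1) < g k) :: nat)" for k
  obtain n' where n': "n = Suc n'" using n by (cases n) auto
  have g: "g k = (if k < p then f k else if k = p then Suc n else f (k - 1))" for k
    unfolding g_def f_def using p by (simp add: n')
  have f_less: "k \<le> n \<Longrightarrow> f k < Suc n" for k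
    using ins_perm_le[of v n k] by (simp add: f_def)
  have D: "descents v n = (\<Sum>k = 1..<n. df k)"
    unfolding descents_eq_sum df_def f_def using n by (intro sum.cong) auto
  have D': "descents v (Suc n) = (\<Sum>k = 1..<Suc n. dg k)"
    unfolding descents_eq_sum dg_def g_def using n by (intro sum.cong) auto
  have low: "(\<Sum>k = 1..<p - 1. dg k) = (\<Sum>k = 1..<p - 1. df k)"
    by (intro sum.cong) (auto simp: dg_def df_def g)
  have keep: "p \<in> keeps_descents v n \<longleftrightarrow> p = Suc n \<or> (p \<ge> 2 \<and> p \<le> n \<and> f p < f (p - 1))"
  proof -
    have "p \<in> Suc ` A \<longleftrightarrow> p \<ge> 1 \<and> p - 1 \<in> A" for A
      using p(2) by (cases p) auto
    then have "p \<in> keeps_descents v n \<longleftrightarrow>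
        p = Suc n \<or> p - 1 \<in> {k \<in> {1..n - 1}. f (k + 1) < f k}"
      using p(2) unfolding keeps_descents_def f_def by simp
    also have "\<dots> \<longleftrightarrow> p = Suc n \<or> (p \<ge> 2 \<and> p \<le> n \<and> f p < f (p - 1))"
      using p(2) by (cases p) auto
    finally show ?thesis .
  qed
  show ?thesis
  proof (cases "p = Suc n")
    case True
    have "(\<Sum>k = 1..<Suc n. dg k) = (\<Sum>k = 1..<n. dg k) + dg n"
      using n by (simp add: sum.atLeastLessThan_Suc)
    moreover have "dg n = 0" using f_less[of n] True by (simp add: dg_def g)
    ultimately show ?thesis using low True keep D D' by simp
  next
    case False
    then have pn: "p \<le> n" "1 \<le> p" using p by auto
    have dgp: "dg p = 1" using f_less[of p] pn by (simp add: dg_def g)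
    have high: "(\<Sum>k = Suc p..<Suc n. dg k) = (\<Sum>k = p..<n. df k)"
      unfolding sum.shift_bounds_Suc_ivl by (intro sum.cong) (auto simp: dg_def df_def g)
    have split': "(\<Sum>k = 1..<Suc n. dg k) = (\<Sum>k = 1..<p. dg k) + 1 + (\<Sum>k = p..<n. df k)"
    proof -
      have "(\<Sum>k = 1..<Suc n. dg k) = (\<Sum>k = 1..<p. dg k) + (\<Sum>k = p..<Suc n. dg k)"
        using pn by (simp add: sum.atLeastLessThan_concat)
      moreover have "(\<Sum>k = p..<Suc n. dg k) = dg p + (\<Sum>k = Suc p..<Suc n. dg k)"
        using pn by (intro sum.atLeast_Suc_lessThan) auto
      ultimately show ?thesis using dgp high by simp
    qed
    have split: "(\<Sum>k = 1..<n. df k) = (\<Sum>k = 1..<p. df k) + (\<Sum>k = p..<n. df k)"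
      using pn by (simp add: sum.atLeastLessThan_concat)
    show ?thesis
    proof (cases "p = 1")
      case True
      then show ?thesis using split split' keep False D D' by simp
    next
      case p1: False
      then have p2: "p = Suc (p - 1)" "1 \<le> p - 1" using pn by auto
      have "dg (p - 1) = 0" using f_less[of "p - 1"] pn p1 p2 by (simp add: dg_def g del: Suc_pred)
      moreover have "(\<Sum>k = 1..<p. h k) = (\<Sum>k = 1..<p - 1. h k) + h (p - 1)" for h :: "nat \<Rightarrow> nat"
        using p2 by (metis sum.atLeastLessThan_Suc)
      moreover have "df (p - 1) = of_bool (p \<in> keeps_descents v n)"
        unfolding keep df_def using False pn p1 by auto
      ultimately show ?thesis using split split' low D D' by auto
    qed
  qed
qed

section \<open>One-step transitions of the descent process\<close>

text \<open>Plays the role of measurability with respect to the first \<open>n\<close> values. As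
  each \<open>D \<omega> i\<close> ranges over a finite set, such an \<open>F\<close> is
  automatically measurable and bounded along the random path, and conditional statements become
  identities tested against all these \<open>F\<close>.\<close>

definition determined_upto :: "nat \<Rightarrow> ((nat \<Rightarrow> nat) \<Rightarrow> 'b) \<Rightarrow> bool" where
  "determined_upto n F \<longleftrightarrow> (\<forall>x y. (\<forall>i\<le>n. x i = y i) \<longrightarrow> F x = F y)"

lemma determined_uptoD: "determined_upto n F \<Longrightarrow> (\<And>i. i \<le> n \<Longrightarrow> x i = y i) \<Longrightarrow> F x = F y"
  by (auto simp: determined_upto_def)

locale random_insertions = prob_space M for M :: "'a measure" +
  fixes V :: "nat \<Rightarrow> 'a \<Rightarrow> nat"
  assumes indep: "indep_vars (\<lambda>_. count_space UNIV) V {1..}"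
    and distr_V: "\<And>n. n \<ge> 1 \<Longrightarrow> distr M (count_space UNIV) (V n) = measure_pmf (pmf_of_set {1..n})"
begin

definition D :: "'a \<Rightarrow> nat \<Rightarrow> nat" where
  "D \<omega> n = descents (\<lambda>m. V m \<omega>) n"

lemma D_le: "D \<omega> n \<le> n - 1"
  unfolding D_def by (rule descents_le)

lemma measurable_V: "n \<ge> 1 \<Longrightarrow> V n \<in> measurable M (count_space UNIV)"
  using indep unfolding indep_vars_def by auto

lemma D_restrict: "i \<le> n \<Longrightarrow> D \<omega> i = descents (\<lambda>m\<in>{1..n}. V m \<omega>) i"
  unfolding D_def by (rule descents_cong) auto

text \<open>The vectors of finitely many insertion positions form a countable discrete space, so
  every function of them is measurable.\<close>

lemma measurable_restrict_V:
  "(\<lambda>\<omega>. G (\<lambda>m\<in>{1..n}. V m \<omega>)) \<in> measurable M N" if "\<And>v. G v \<in> space N"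
proof -
  have "(\<lambda>\<omega>. \<lambda>m\<in>{1..n}. V m \<omega>) \<in> measurable M (PiM {1..n} (\<lambda>_. count_space UNIV))"
    by (rule measurable_restrict) (auto intro: measurable_V)
  also have "PiM {1..n} (\<lambda>_. count_space UNIV) = count_space (PiE {1..n} (\<lambda>_. UNIV :: nat set))"
    by (rule count_space_PiM_finite) auto
  finally show ?thesis
    by (rule measurable_compose) (use that in auto)
qed

lemma measurable_determined:
  assumes "determined_upto n F" "\<And>x. F x \<in> space N"
  shows "(\<lambda>\<omega>. F (D \<omega>)) \<in> measurable M N"
proof -
  have "F (D \<omega>) = F (descents (\<lambda>m\<in>{1..n}. V m \<omega>))" for \<omega>
    by (rule determined_uptoD[OF assms(1)]) (rule D_restrict)
  then show ?thesis
    using measurable_restrict_V[of "\<lambda>v. F (descents v)" N n] assms(2) by simp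
qed

text \<open>Cut off after index \<open>n\<close>, the paths with \<open>x i \<le> i\<close> form a
  finite set, and \<open>F\<close> sees nothing else of them.\<close>

lemma determined_bounded:
  fixes F :: "(nat \<Rightarrow> nat) \<Rightarrow> 'b::real_normed_vector"
  assumes "determined_upto n F"
  obtains B where "\<And>x. (\<And>i. x i \<le> i) \<Longrightarrow> norm (F x) \<le> B"
proof -
  define S where "S = {f. \<forall>i. (i \<in> {..n} \<longrightarrow> f i \<in> {..n}) \<and> (i \<notin> {..n} \<longrightarrow> f i = (0::nat))}"
  have S: "finite S" unfolding S_def by (rule finite_set_of_finite_funs) auto
  have "norm (F x) \<le> Max ((norm \<circ> F) ` S)" if x: "\<And>i. x i \<le> i" for x
  proof -
    define y where "y i = (if i \<le> n then x i else 0)" for i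
    have "y \<in> S" using x unfolding S_def y_def by (auto intro: le_trans)
    moreover have "F x = F y" by (rule determined_uptoD[OF assms]) (simp add: y_def)
    ultimately show ?thesis using S by (auto intro!: Max_ge)
  qed
  then show ?thesis by (rule that)
qed

lemma integrable_determined:
  fixes F :: "(nat \<Rightarrow> nat) \<Rightarrow> 'b::{banach, second_countable_topology}"
  assumes "determined_upto n F"
  shows "integrable M (\<lambda>\<omega>. F (D \<omega>))"
proof -
  obtain B where B: "\<And>x. (\<And>i. x i \<le> i) \<Longrightarrow> norm (F x) \<le> B"
    using determined_bounded[OF assms] by blast
  have "norm (F (D \<omega>)) \<le> B" for \<omega>
    by (rule B) (use D_le le_trans diff_le_self in blast)
  then show ?thesis
    by (intro integrable_const_bound[of _ B]) (auto intro: measurable_determined[OF assms])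
qed

lemma AE_V: "n \<ge> 1 \<Longrightarrow> AE \<omega> in M. V n \<omega> \<in> {1..n}"
proof -
  assume n: "n \<ge> 1"
  have "AE p in distr M (count_space UNIV) (V n). p \<in> {1..n}"
    unfolding distr_V[OF n] using n by (auto simp: AE_measure_pmf_iff set_pmf_of_set)
  then show ?thesis using AE_distrD[OF measurable_V[OF n]] by blast
qed

lemma prob_V: "n \<ge> 1 \<Longrightarrow> p \<in> {1..n} \<Longrightarrow> expectation (\<lambda>\<omega>. of_bool (V n \<omega> = p)) = 1 / real n"
proof -
  assume n: "n \<ge> 1" "p \<in> {1..n}"
  note [measurable] = measurable_V[OF n(1)]
  have "expectation (\<lambda>\<omega>. of_bool (V n \<omega> = p) :: real)
      = (\<integral>x. of_bool (x = p) \<partial>distr M (count_space UNIV) (V n))"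
    using integral_distr[OF measurable_V[OF n(1)], of "\<lambda>x. of_bool (x = p) :: real"] by simp
  also have "\<dots> = (\<integral>x. indicator {p} x \<partial>measure_pmf (pmf_of_set {1..n}))"
    unfolding distr_V[OF n(1)]
        by (intro Bochner_Integration.integral_cong) (auto simp: indicator_def)
  also have "\<dots> = 1 / real n"
    using n by (simp add: measure_pmf_single pmf_of_set)
  finally show ?thesis .
qed

text \<open>The place of the next insertion is independent of the vector of the earlier ones and
  equals \<open>p\<close> with probability \<open>1 / (n + 1)\<close>. The values lie in a general
  field to serve real moments and complex characteristic functions alike.\<close>

lemma expectation_times_V:
  fixes G :: "(nat \<Rightarrow> nat) \<Rightarrow> 'b::{real_normed_field, banach, second_countable_topology}"
  assumes p: "p \<in> {1..Suc n}" and int: "integrable M (\<lambda>\<omega>. G (\<lambda>m\<in>{1..n}. V m \<omega>))"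
  shows "expectation (\<lambda>\<omega>. G (\<lambda>m\<in>{1..n}. V m \<omega>) * of_bool (V (Suc n) \<omega> = p))
       = expectation (\<lambda>\<omega>. G (\<lambda>m\<in>{1..n}. V m \<omega>)) / of_nat (Suc n)"
proof -
  let ?C = "\<lambda>_. count_space UNIV :: nat measure"
  note [measurable] = measurable_V[of "Suc n"]
  have "indep_var (PiM {1..n} ?C) (\<lambda>\<omega>. \<lambda>m\<in>{1..n}. V m \<omega>) (PiM {Suc n} ?C) (\<lambda>\<omega>. \<lambda>m\<in>{Suc n}. V m \<omega>)"
    by (rule indep_var_restrict[OF indep]) auto
  then have "indep_var (borel :: 'b measure) (G \<circ> (\<lambda>\<omega>. \<lambda>m\<in>{1..n}. V m \<omega>))
      borel ((\<lambda>x. of_bool (x (Suc n) = p)) \<circ> (\<lambda>\<omega>. \<lambda>m\<in>{Suc n}. V m \<omega>))"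
  proof (rule indep_var_compose)
    show "G \<in> borel_measurable (PiM {1..n} ?C)"
      by (subst count_space_PiM_finite) auto
  qed measurable
  then have iv: "indep_var (borel :: 'b measure) (\<lambda>\<omega>. G (\<lambda>m\<in>{1..n}. V m \<omega>)) borel
      (\<lambda>\<omega>. of_bool (V (Suc n) \<omega> = p))"
    by (simp add: comp_def)
  have intb: "integrable M (\<lambda>\<omega>. of_bool (V (Suc n) \<omega> = p) :: 'b)"
    by (rule integrable_const_bound[of _ 1]) (auto simp: of_bool_def)
  have "expectation (\<lambda>\<omega>. of_bool (V (Suc n) \<omega> = p) :: 'b)
      = expectation (\<lambda>\<omega>. of_real (of_bool (V (Suc n) \<omega> = p)) :: 'b)"
    by (intro Bochner_Integration.integral_cong) auto
  also have "\<dots> = of_real (expectation (\<lambda>\<omega>. of_bool (V (Suc n) \<omega> = p)))"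
    by (rule integral_of_real, rule integrable_const_bound[of _ 1]) auto
  also have "\<dots> = of_real (1 / real (Suc n))"
    using prob_V[of "Suc n" p] p by simp
  finally show ?thesis
    using indep_var_lebesgue_integral[OF iv int intb] by (simp add: divide_inverse)
qed

text \<open>The Markov transition in integrated form: conditionally on the first \<open>n\<close>
  positions all \<open>n + 1\<close> places are equally likely, and \<open>D \<omega> n + 1\<close>
  of them keep the number of descents. Since \<open>F\<close> may depend on the whole past, this
  carries the information of conditioning on it.\<close>

lemma expectation_step:
  fixes F :: "(nat \<Rightarrow> nat) \<Rightarrow> 'b::{real_normed_field, banach, second_countable_topology}"
  assumes n: "n \<ge> 1" and F: "determined_upto (Suc n) F"
  shows "expectation (\<lambda>\<omega>. F (D \<omega>)) = expectation (\<lambda>\<omega>.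
      ((of_nat n - of_nat (D \<omega> n)) * F ((D \<omega>)(Suc n := Suc (D \<omega> n)))
      + (of_nat (D \<omega> n) + 1) * F ((D \<omega>)(Suc n := D \<omega> n))) / of_nat (Suc n))"
proof -
  let ?r = "\<lambda>\<omega>. \<lambda>m\<in>{1..n}. V m \<omega>"
  \<comment> \<open>The value of \<open>F\<close> when the next insertion goes to place
    \<open>p\<close>, as a function of the earlier positions alone; this is the form to which
    independence applies.\<close>
  define G where "G p v
      = F ((descents v)(Suc n :=
      if p \<in> keeps_descents v n then descents v n else Suc (descents v n)))" for p v
  have Grestr: "G p v = F
      ((descents w)(Suc n := if p \<in> keeps_descents w n then descents w n else Suc (descents w n)))"
    if "\<And>i. i \<in> {1..n} \<Longrightarrow> v i = w i" for p v w
  proof -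
    have "ins_perm v n = ins_perm w n" by (rule ins_perm_cong) (use that in auto)
    then have "keeps_descents v n = keeps_descents w n" by (simp add: keeps_descents_def)
    moreover have "descents v i = descents w i" if "i \<le> n" for i
      by (rule descents_cong) (use that \<open>\<And>i. i \<in> {1..n} \<Longrightarrow> v i = w i\<close> in auto)
    ultimately show ?thesis unfolding G_def by (intro determined_uptoD[OF F]) auto
  qed
  have Gint: "integrable M (\<lambda>\<omega>. G p (?r \<omega>))" for p
  proof -
    obtain B where B: "\<And>x. (\<And>i. x i \<le> i) \<Longrightarrow> norm (F x) \<le> B"
      using determined_bounded[OF F] by blast
    have "norm (G p (?r \<omega>)) \<le> B" for \<omega>
      unfolding G_def
    proof (rule B)
      fix i show "((descents (?r \<omega>))(Suc n := if p \<in> keeps_descents (?r \<omega>) n then descents (?r \<omega>) n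
          else Suc (descents (?r \<omega>) n))) i \<le> i"
        using descents_le[of "?r \<omega>" i] descents_le[of "?r \<omega>" n] by auto
    qed
    then show ?thesis
      by (intro integrable_const_bound[of _ B] measurable_restrict_V) auto
  qed
  have Gint': "integrable M (\<lambda>\<omega>. G p (?r \<omega>) * of_bool (V (Suc n) \<omega> = p))" for p
  proof (rule Bochner_Integration.integrable_bound[OF Gint[of p]])
    note [measurable] = measurable_V[of "Suc n"]
    have "(\<lambda>\<omega>. G p (?r \<omega>)) \<in> borel_measurable M" by (rule measurable_restrict_V) auto
    moreover have "(\<lambda>\<omega>. of_bool (V (Suc n) \<omega> = p) :: 'b) \<in> borel_measurable M" by measurable
    ultimately show "(\<lambda>\<omega>. G p (?r \<omega>) * of_bool (V (Suc n) \<omega> = p)) \<in> borel_measurable M"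
      by (rule borel_measurable_times)
  qed (auto simp: norm_mult of_bool_def)
  have "expectation (\<lambda>\<omega>. F (D \<omega>))
      = expectation (\<lambda>\<omega>. \<Sum>p = 1..Suc n. G p (?r \<omega>) * of_bool (V (Suc n) \<omega> = p))"
  proof (rule integral_cong_AE)
    show "AE \<omega> in M. F (D \<omega>) = (\<Sum>p = 1..Suc n. G p (?r \<omega>) * of_bool (V (Suc n) \<omega> = p))"
      using AE_V[of "Suc n"]
    proof (rule AE_mp, simp, intro AE_I2 impI)
      fix \<omega> assume elim: "V (Suc n) \<omega> \<in> {1..Suc n}"
      let ?v = "\<lambda>m. V m \<omega>" and ?p = "V (Suc n) \<omega>"
      have "(\<Sum>p = 1..Suc n. G p (?r \<omega>) * of_bool (?p = p)) = G ?p (?r \<omega>)"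
        using elim by (subst sum.remove[of _ ?p]) (auto intro!: sum.neutral)
      also have "\<dots> = F ((descents ?v)(Suc n :=
          if ?p \<in> keeps_descents ?v n then descents ?v n else Suc (descents ?v n)))"
        by (rule Grestr) auto
      also have "\<dots> = F (D \<omega>)"
        by (rule determined_uptoD[OF F])
           (use descents_Suc[OF n refl, of ?v] elim in \<open>auto simp: D_def\<close>)
      finally show "F (D \<omega>) = (\<Sum>p = 1..Suc n. G p (?r \<omega>) * of_bool (?p = p))" ..
    qed
  next
    show "(\<lambda>\<omega>. F (D \<omega>)) \<in> borel_measurable M"
      by (rule borel_measurable_integrable[OF integrable_determined[OF F]])
    show "(\<lambda>\<omega>. \<Sum>p = 1..Suc n. G p (?r \<omega>) * of_bool (V (Suc n) \<omega> = p)) \<in> borel_measurable M"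
      by (intro borel_measurable_sum borel_measurable_integrable[OF Gint'])
  qed
  also have "\<dots> = (\<Sum>p = 1..Suc n. expectation (\<lambda>\<omega>. G p (?r \<omega>) * of_bool (V (Suc n) \<omega> = p)))"
    using Gint' by (intro Bochner_Integration.integral_sum) auto
  also have "\<dots> = (\<Sum>p = 1..Suc n. expectation (\<lambda>\<omega>. G p (?r \<omega>)) / of_nat (Suc n))"
    by (intro sum.cong refl expectation_times_V Gint)
  also have "\<dots> = expectation (\<lambda>\<omega>. (\<Sum>p = 1..Suc n. G p (?r \<omega>)) / of_nat (Suc n))"
    using Gint by (simp add: sum_divide_distrib Bochner_Integration.integral_sum del:
        sum.cl_ivl_Suc)
  also have "\<dots> = expectation (\<lambda>\<omega>.
      ((of_nat n - of_nat (D \<omega> n)) * F ((D \<omega>)(Suc n := Suc (D \<omega> n)))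
      + (of_nat (D \<omega> n) + 1) * F ((D \<omega>)(Suc n := D \<omega> n))) / of_nat (Suc n))"
  proof (intro Bochner_Integration.integral_cong refl arg_cong2[where f="(/)"])
    fix \<omega>
    let ?v = "\<lambda>m. V m \<omega>" and ?K = "keeps_descents (\<lambda>m. V m \<omega>) n"
    have "(\<Sum>p = 1..Suc n. G p (?r \<omega>))
        = (\<Sum>p = 1..Suc n. F ((D \<omega>)(Suc n := if p \<in> ?K then D \<omega> n else Suc (D \<omega> n))))"
    proof (rule sum.cong[OF refl])
      fix p
      have "G p (?r \<omega>) = F ((descents ?v)(Suc n :=
          if p \<in> ?K then descents ?v n else Suc (descents ?v n)))"
        by (rule Grestr) auto
      then show "G p (?r \<omega>) = F ((D \<omega>)(Suc n := if p \<in> ?K then D \<omega> n else Suc (D \<omega> n)))"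
        by (simp add: D_def[abs_def])
    qed
    also have "\<dots> = (\<Sum>p \<in> {1..Suc n} - ?K. F ((D \<omega>)(Suc n := Suc (D \<omega> n))))
        + (\<Sum>p \<in> ?K. F ((D \<omega>)(Suc n := D \<omega> n)))"
      by (subst sum.subset_diff[OF keeps_descents_subset[of ?v n]]) auto
    also have "\<dots> = of_nat (card ({1..Suc n} - ?K)) * F ((D \<omega>)(Suc n := Suc (D \<omega> n)))
        + of_nat (card ?K) * F ((D \<omega>)(Suc n := D \<omega> n))"
      by simp
    also have "card ?K = Suc (D \<omega> n)"
      by (simp add: card_keeps_descents D_def)
    also have "card ({1..Suc n} - ?K) = n - D \<omega> n"
      using keeps_descents_subset[of ?v n] finite_subset[OF keeps_descents_subset[of ?v n]]
      by (subst card_Diff_subset) (auto simp: card_keeps_descents D_def)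
    also have "(of_nat (n - D \<omega> n) :: 'b) = of_nat n - of_nat (D \<omega> n)"
      using D_le[of \<omega> n] by (intro of_nat_diff) simp
    finally show "(\<Sum>p = 1..Suc n. G p (?r \<omega>)) =
        (of_nat n - of_nat (D \<omega> n)) * F ((D \<omega>)(Suc n := Suc (D \<omega> n)))
      + (of_nat (D \<omega> n) + 1) * F ((D \<omega>)(Suc n := D \<omega> n))"
      by (simp only: of_nat_Suc add.commute)
  qed
  finally show ?thesis .
qed

end

section \<open>The martingale of centred descents and its moments\<close>

definition mart :: "(nat \<Rightarrow> nat) \<Rightarrow> nat \<Rightarrow> real" where
  "mart x n = real n * real (x n) - real n * (real n - 1) / 2"

definition incr :: "(nat \<Rightarrow> nat) \<Rightarrow> nat \<Rightarrow> real" where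
  "incr x n = mart x (Suc n) - mart x n"

lemma incr_up: "incr (x(Suc n := Suc (x n))) n = real (x n) + 1"
  by (simp add: incr_def mart_def diff_divide_distrib add_divide_distrib algebra_simps)

lemma incr_stay: "incr (x(Suc n := x n)) n = real (x n) - real n"
  by (simp add: incr_def mart_def diff_divide_distrib add_divide_distrib algebra_simps)

lemma determined_upto_mart: "n \<le> m \<Longrightarrow> determined_upto m (\<lambda>x. \<phi> (mart x n))"
  by (auto simp: determined_upto_def mart_def)

lemma determined_upto_mono: "determined_upto n F \<Longrightarrow> n \<le> m \<Longrightarrow> determined_upto m F"
  by (auto simp: determined_upto_def)

lemma determined_upto_compose2:
  "determined_upto n F \<Longrightarrow> determined_upto n G \<Longrightarrow> determined_upto n (\<lambda>x. h (F x) (G x))"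
  unfolding determined_upto_def by metis

lemma determined_upto_incr: "n < m \<Longrightarrow> determined_upto m (\<lambda>x. incr x n)"
  by (auto simp: determined_upto_def mart_def incr_def)

section \<open>Martingale property, moment bounds and the maximal inequality\<close>

context random_insertions
begin

lemma AE_D_Suc: "n \<ge> 1 \<Longrightarrow> AE \<omega> in M. D \<omega> (Suc n) = D \<omega> n \<or> D \<omega> (Suc n) = Suc (D \<omega> n)"
  using AE_V[of "Suc n"]
proof (rule AE_mp, simp, intro AE_I2 impI)
  fix \<omega> assume "n \<ge> 1" "V (Suc n) \<omega> \<in> {1..Suc n}"
  then show "D \<omega> (Suc n) = D \<omega> n \<or> D \<omega> (Suc n) = Suc (D \<omega> n)"
    using descents_Suc[of n "\<lambda>m. V m \<omega>" "V (Suc n) \<omega>"] by (auto simp: D_def)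
qed

lemma AE_incr_le:
  assumes "n \<ge> 1"
  shows "AE \<omega> in M. \<bar>incr (D \<omega>) n\<bar> \<le> real n"
  using AE_D_Suc[OF assms]
proof eventually_elim
  case (elim \<omega>)
  have d: "D \<omega> = (D \<omega>)(Suc n := D \<omega> (Suc n))" by simp
  have "real (D \<omega> n) + 1 \<le> real n"
    using D_le[of \<omega> n] assms by linarith
  moreover have "incr (D \<omega>) n = real (D \<omega> n) + 1 \<or> incr (D \<omega>) n = real (D \<omega> n) - real n"
    using elim d incr_up[of "D \<omega>" n] incr_stay[of "D \<omega>" n] by metis
  ultimately show ?case by auto
qed

text \<open>\<open>F\<close> does not see the value at \<open>Suc n\<close>, so it passes unchanged
  through both outcomes of the step, and only the increment remains to be averaged.\<close>

lemma expectation_incr_step: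
  fixes F :: "(nat \<Rightarrow> nat) \<Rightarrow> 'b::{real_normed_field, banach, second_countable_topology}"
  assumes n: "n \<ge> 1" and F: "determined_upto n F"
  shows "expectation (\<lambda>\<omega>. F (D \<omega>) * \<phi> (incr (D \<omega>) n)) = expectation (\<lambda>\<omega>. F (D \<omega>) *
     (((of_nat n - of_nat (D \<omega> n)) * \<phi> (real (D \<omega> n) + 1)
      + (of_nat (D \<omega> n) + 1) * \<phi> (real (D \<omega> n) - real n)) / of_nat (Suc n)))"
proof -
  have det: "determined_upto (Suc n) (\<lambda>x. F x * \<phi> (incr x n))"
    by (rule determined_upto_compose2[where h="\<lambda>a b. a * \<phi> b"])
       (auto intro: determined_upto_mono[OF F] determined_upto_incr)
  have upd: "F (x(Suc n := k)) = F x" for x k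
    by (rule determined_uptoD[OF F]) auto
  show ?thesis
    unfolding expectation_step[OF n det] incr_up incr_stay upd
    by (intro Bochner_Integration.integral_cong refl) (simp add: field_simps)
qed

text \<open>The martingale property, from
  \<open>(n - d) (d + 1) + (d + 1) (d - n) = 0\<close>.\<close>

lemma expectation_incr:
  fixes F :: "(nat \<Rightarrow> nat) \<Rightarrow> 'b::{real_normed_field, banach, second_countable_topology}"
  assumes n: "n \<ge> 1" and F: "determined_upto n F"
  shows "expectation (\<lambda>\<omega>. F (D \<omega>) * of_real (incr (D \<omega>) n)) = 0"
proof -
  have "(of_nat n - of_nat d) * of_real (real d + 1) + (of_nat d + 1) * of_real (real d - real n)
      = (0 :: 'b)" for d
    by (simp add: algebra_simps)
  then show ?thesis
    unfolding expectation_incr_step[OF n F] by simp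
qed

text \<open>The conditional variance, from \<open>(n - d) (d + 1)^2 + (d + 1) (d - n)^2 = (n + 1) (n
  - d) (d + 1)\<close>.\<close>

lemma expectation_incr_square:
  fixes F :: "(nat \<Rightarrow> nat) \<Rightarrow> 'b::{real_normed_field, banach, second_countable_topology}"
  assumes n: "n \<ge> 1" and F: "determined_upto n F"
  shows "expectation (\<lambda>\<omega>. F (D \<omega>) * of_real ((incr (D \<omega>) n)\<^sup>2))
       = expectation (\<lambda>\<omega>. F (D \<omega>) * of_real ((real n - real (D \<omega> n)) * (real (D \<omega> n) + 1)))"
proof -
  have "(of_nat n - of_nat d) * of_real ((real d + 1)\<^sup>2) + (of_nat d + 1)
      * of_real ((real d - real n)\<^sup>2)
     = (of_nat (Suc n) * of_real ((real n - real d) * (real d + 1)) :: 'b)" for d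
    by (simp add: algebra_simps power2_eq_square)
  moreover have nz: "of_nat (Suc n) \<noteq> (0 :: 'b)"
    by (rule of_nat_neq_0)
  ultimately have eq: "((of_nat n - of_nat d) * of_real ((real d + 1)\<^sup>2)
      + (of_nat d + 1) * of_real ((real d - real n)\<^sup>2)) / of_nat (Suc n)
      = (of_real ((real n - real d) * (real d + 1)) :: 'b)" for d
    by (simp only: nonzero_mult_div_cancel_left[OF nz])
  show ?thesis
    unfolding expectation_incr_step[OF n F, where \<phi>="\<lambda>x. of_real (x\<^sup>2)"] eq ..
qed

lemma integrable_mart_diff: "integrable M (\<lambda>\<omega>. \<phi> (mart (D \<omega>) n - mart (D \<omega>) a) :: real)"
proof (rule integrable_determined)
  show "determined_upto (max n a) (\<lambda>x. \<phi> (mart x n - mart x a))"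
    by (rule determined_upto_compose2) (rule determined_upto_mart; simp)+
qed

text \<open>The increments are orthogonal, and those before time \<open>b\<close> have square at
  most \<open>b^2\<close>.\<close>

lemma second_moment:
  assumes "1 \<le> a" "a \<le> n" "n \<le> b"
  shows "expectation (\<lambda>\<omega>. (mart (D \<omega>) n - mart (D \<omega>) a)\<^sup>2) \<le> (real n - real a) * (real b)\<^sup>2"
  using assms(2,3)
proof (induction n rule: dec_induct)
  case (step n)
  let ?S = "\<lambda>\<omega>. mart (D \<omega>) n - mart (D \<omega>) a" and ?X = "\<lambda>\<omega>. incr (D \<omega>) n"
  have n: "1 \<le> n" using step assms by auto
  have intX: "integrable M (\<lambda>\<omega>. \<phi> (?X \<omega>) :: real)" for \<phi>
    unfolding incr_def by (rule integrable_mart_diff)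
  have detS: "determined_upto n (\<lambda>x. 2 * (mart x n - mart x a))"
    by (rule determined_upto_compose2)
        (use step in \<open>auto intro: determined_upto_mart[where \<phi>="\<lambda>x. x"]\<close>)
  have SX: "integrable M (\<lambda>\<omega>. 2 * ?S \<omega> * ?X \<omega>)"
    unfolding incr_def
    by (rule integrable_determined[where n="Suc n"])
       (use step in \<open>auto simp: determined_upto_def mart_def\<close>)
  have "expectation (\<lambda>\<omega>. (mart (D \<omega>) (Suc n) - mart (D \<omega>) a)\<^sup>2)
      = expectation (\<lambda>\<omega>. (?S \<omega>)\<^sup>2 + 2 * ?S \<omega> * ?X \<omega> + (?X \<omega>)\<^sup>2)"
    by (intro Bochner_Integration.integral_cong)
        (auto simp: incr_def power2_eq_square algebra_simps)
  also have "\<dots> = expectation (\<lambda>\<omega>. (?S \<omega>)\<^sup>2) + expectation (\<lambda>\<omega>. 2 * ?S \<omega> * ?X \<omega>)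
      + expectation (\<lambda>\<omega>. (?X \<omega>)\<^sup>2)"
    using SX integrable_mart_diff[of "\<lambda>x. x\<^sup>2" n a] intX[of "\<lambda>x. x\<^sup>2"] by simp
  also have "expectation (\<lambda>\<omega>. 2 * ?S \<omega> * ?X \<omega>) = 0"
    using expectation_incr[OF n detS] by simp
  also have "expectation (\<lambda>\<omega>. (?X \<omega>)\<^sup>2) \<le> expectation (\<lambda>\<omega>. (real b)\<^sup>2)"
  proof (rule integral_mono_AE)
    show "AE \<omega> in M. (?X \<omega>)\<^sup>2 \<le> (real b)\<^sup>2"
      using AE_incr_le[OF n]
      by eventually_elim (use step in \<open>auto simp flip: abs_le_square_iff\<close>)
  qed (use intX[of "\<lambda>x. x\<^sup>2"] in auto)
  finally show ?case using step by (simp add: algebra_simps prob_space)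
qed simp

text \<open>In the expansion of \<open>(s + x)^4\<close> the term \<open>4 s^3 x\<close> has mean
  zero and \<open>4 s x^3 \<le> 2 x^2 (s^2 + x^2)\<close>, so a step adds at most
  \<open>8 b^2 s^2 + 3 b^4\<close>, whose mean the second moment controls. With
  \<open>d = n - a\<close> the constant 4 closes the induction, because
  \<open>4 d^2 + 8 d + 3 \<le> 4 (d + 1)^2\<close>.\<close>

lemma fourth_moment:
  assumes "1 \<le> a" "a \<le> n" "n \<le> b"
  shows "expectation (\<lambda>\<omega>. (mart (D \<omega>) n - mart (D \<omega>) a) ^ 4)
      \<le> 4 * (real n - real a)\<^sup>2 * (real b) ^ 4"
  using assms(2,3)
proof (induction n rule: dec_induct)
  case (step n)
  let ?S = "\<lambda>\<omega>. mart (D \<omega>) n - mart (D \<omega>) a" and ?X = "\<lambda>\<omega>. incr (D \<omega>) n"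
  have n: "1 \<le> n" using step assms by auto
  have detS: "determined_upto n (\<lambda>x. 4 * (mart x n - mart x a) ^ 3)"
    by (rule determined_upto_compose2)
        (use step in \<open>auto intro: determined_upto_mart[where \<phi>="\<lambda>x. x"]\<close>)
  have SX: "integrable M (\<lambda>\<omega>. 4 * (?S \<omega>) ^ 3 * ?X \<omega>)"
    unfolding incr_def
    by (rule integrable_determined[where n="Suc n"])
       (use step in \<open>auto simp: determined_upto_def mart_def\<close>)
  have "expectation (\<lambda>\<omega>. (mart (D \<omega>) (Suc n) - mart (D \<omega>) a) ^ 4)
      \<le> expectation (\<lambda>\<omega>. (?S \<omega>) ^ 4 + 4 * (?S \<omega>) ^ 3 * ?X \<omega>
          + (8 * (real b)\<^sup>2 * (?S \<omega>)\<^sup>2 + 3 * real b ^ 4))"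
  proof (rule integral_mono_AE)
    show "AE \<omega> in M. (mart (D \<omega>) (Suc n) - mart (D \<omega>) a) ^ 4
       \<le> (?S \<omega>) ^ 4 + 4 * (?S \<omega>) ^ 3 * ?X \<omega> + (8 * (real b)\<^sup>2 * (?S \<omega>)\<^sup>2 + 3 * real b ^ 4)"
      using AE_incr_le[OF n]
    proof eventually_elim
      case (elim \<omega>)
      define s where "s = ?S \<omega>"
      define x where "x = ?X \<omega>"
      define B where "B = real b"
      have x: "\<bar>x\<bar> \<le> B" using elim step by (auto simp: x_def B_def)
      have x2: "x\<^sup>2 \<le> B\<^sup>2" using x by (metis abs_ge_zero power2_abs power_mono)
      have x4: "x ^ 4 \<le> B ^ 4"
        using power_mono[OF x2, of 2] by (simp flip: power_mult)
      have B0: "0 \<le> B" by (simp add: B_def)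
      have "4 * s * x ^ 3 \<le> 2 * x\<^sup>2 * (s\<^sup>2 + x\<^sup>2)"
      proof -
        have "2 * x\<^sup>2 * (s\<^sup>2 + x\<^sup>2) - 4 * s * x ^ 3 = 2 * x\<^sup>2 * (s - x)\<^sup>2"
          by (simp add: power2_eq_square power3_eq_cube algebra_simps)
        then show ?thesis by (metis diff_ge_0_iff_ge mult_nonneg_nonneg zero_le_power2
            zero_le_numeral)
      qed
      moreover have "x\<^sup>2 * s\<^sup>2 \<le> B\<^sup>2 * s\<^sup>2" using x2 by (intro mult_right_mono) auto
      moreover have "(s + x) ^ 4
          = s ^ 4 + 4 * s ^ 3 * x + (6 * (x\<^sup>2 * s\<^sup>2) + 4 * s * x ^ 3 + x ^ 4)"
        by (simp add: power2_eq_square power3_eq_cube power4_eq_xxxx algebra_simps)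
      moreover have "2 * x\<^sup>2 * (s\<^sup>2 + x\<^sup>2) = 2 * (x\<^sup>2 * s\<^sup>2) + 2 * x ^ 4"
        by (simp add: power2_eq_square power4_eq_xxxx algebra_simps)
      ultimately have "(s + x) ^ 4 \<le> s ^ 4 + 4 * s ^ 3 * x + (8 * B\<^sup>2 * s\<^sup>2 + 3 * B ^ 4)"
        using x4 by linarith
      moreover have "mart (D \<omega>) (Suc n) - mart (D \<omega>) a = s + x"
        by (simp add: s_def x_def incr_def)
      ultimately show ?case by (simp only: s_def x_def B_def)
    qed
  qed (use SX integrable_mart_diff[of "\<lambda>x. x ^ 4"] integrable_mart_diff[of "\<lambda>x. x\<^sup>2"] in auto)
  also have "\<dots> = expectation (\<lambda>\<omega>. (?S \<omega>) ^ 4) + expectation (\<lambda>\<omega>. 4 * (?S \<omega>) ^ 3 * ?X \<omega>)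
       + (8 * (real b)\<^sup>2 * expectation (\<lambda>\<omega>. (?S \<omega>)\<^sup>2) + 3 * real b ^ 4)"
    using SX integrable_mart_diff[of "\<lambda>x. x ^ 4" n a] integrable_mart_diff[of "\<lambda>x. x\<^sup>2" n a]
    by (simp add: prob_space)
  also have "expectation (\<lambda>\<omega>. 4 * (?S \<omega>) ^ 3 * ?X \<omega>) = 0"
    using expectation_incr[OF n detS] by simp
  also have "8 * (real b)\<^sup>2 * expectation (\<lambda>\<omega>. (?S \<omega>)\<^sup>2)
      \<le> 8 * (real b)\<^sup>2 * ((real n - real a) * (real b)\<^sup>2)"
    using second_moment[of a n b] assms step by (intro mult_left_mono) auto
  also have "expectation (\<lambda>\<omega>. (?S \<omega>) ^ 4) \<le> 4 * (real n - real a)\<^sup>2 * (real b) ^ 4"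
    using step by simp
  also have "4 * (real n - real a)\<^sup>2 * real b ^ 4 + 0
      + (8 * (real b)\<^sup>2 * ((real n - real a) * (real b)\<^sup>2) + 3 * real b ^ 4)
     = (4 * (real n - real a)\<^sup>2 + 8 * (real n - real a) + 3) * real b ^ 4"
    by (simp add: power2_eq_square power4_eq_xxxx algebra_simps)
  also have "\<dots> \<le> (4 * (real (Suc n) - real a)\<^sup>2) * real b ^ 4"
    by (intro mult_right_mono) (auto simp: power2_eq_square algebra_simps)
  finally show ?case by simp
qed simp

text \<open>Convexity bounds \<open>(s + x)^4\<close> from below by the tangent
  \<open>s^4 + 4 s^3 x\<close>, and the linear part has mean zero against everything determined by
  the past.\<close>

lemma submartingale_fourth_power:
  assumes n: "1 \<le> n" "a \<le> n" and F: "determined_upto n F" and pos: "\<And>x. F x \<ge> (0 :: real)"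
  shows "expectation (\<lambda>\<omega>. F (D \<omega>) * (mart (D \<omega>) n - mart (D \<omega>) a) ^ 4)
       \<le> expectation (\<lambda>\<omega>. F (D \<omega>) * (mart (D \<omega>) (Suc n) - mart (D \<omega>) a) ^ 4)"
proof -
  have det: "determined_upto n (\<lambda>x. F x * \<phi> (mart x n - mart x a))" for \<phi> :: "real \<Rightarrow> real"
  proof -
    have "determined_upto n (\<lambda>x. \<phi> (mart x n - mart x a))" using n
        by (auto simp: determined_upto_def mart_def)
    from determined_upto_compose2[OF F this] show ?thesis .
  qed
  have int: "integrable M (\<lambda>\<omega>. F (D \<omega>) * \<phi> (mart (D \<omega>) (Suc n)) (mart (D \<omega>) n) (mart (D \<omega>) a))"
    for \<phi> :: "real \<Rightarrow> real \<Rightarrow> real \<Rightarrow> real"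
  proof (rule integrable_determined)
    have "determined_upto (Suc n) (\<lambda>x. \<phi> (mart x (Suc n)) (mart x n) (mart x a))"
      using n by (auto simp: determined_upto_def mart_def)
    from determined_upto_compose2[OF determined_upto_mono[OF F] this]
    show "determined_upto (Suc n) (\<lambda>x. F x * \<phi> (mart x (Suc n)) (mart x n) (mart x a))" by simp
  qed
  have "expectation (\<lambda>\<omega>. F (D \<omega>) * (4 * (mart (D \<omega>) n - mart (D \<omega>) a) ^ 3) * incr (D \<omega>) n) = 0"
    using expectation_incr[OF n(1) det[of "\<lambda>x. 4 * x ^ 3"]] by simp
  then have "expectation (\<lambda>\<omega>. F (D \<omega>) * (mart (D \<omega>) n - mart (D \<omega>) a) ^ 4)
     = expectation (\<lambda>\<omega>. F (D \<omega>) * (mart (D \<omega>) n - mart (D \<omega>) a) ^ 4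
         + F (D \<omega>) * (4 * (mart (D \<omega>) n - mart (D \<omega>) a) ^ 3) * incr (D \<omega>) n)"
    using int[of "\<lambda>u v w. (v - w) ^ 4"] int[of "\<lambda>u v w. 4 * (v - w) ^ 3 * (u - v)"]
    by (simp add: incr_def mult.assoc)
  also have "\<dots> \<le> expectation (\<lambda>\<omega>. F (D \<omega>) * (mart (D \<omega>) (Suc n) - mart (D \<omega>) a) ^ 4)"
  proof (rule integral_mono)
    fix \<omega>
    define s where "s = mart (D \<omega>) n - mart (D \<omega>) a"
    define x where "x = incr (D \<omega>) n"
    have eq: "mart (D \<omega>) (Suc n) - mart (D \<omega>) a = s + x"
      by (simp add: s_def x_def incr_def)
    have "(s + x) ^ 4 - (s ^ 4 + 4 * s ^ 3 * x) = x\<^sup>2 * (2 * s\<^sup>2 + (2 * s + x)\<^sup>2)"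
      by (simp add: power2_eq_square power3_eq_cube power4_eq_xxxx algebra_simps)
    moreover have "x\<^sup>2 * (2 * s\<^sup>2 + (2 * s + x)\<^sup>2) \<ge> 0" by simp
    ultimately have "s ^ 4 + 4 * s ^ 3 * x \<le> (s + x) ^ 4" by linarith
    from mult_left_mono[OF this pos[of "D \<omega>"]]
    show "F (D \<omega>) * (mart (D \<omega>) n - mart (D \<omega>) a) ^ 4
         + F (D \<omega>) * (4 * (mart (D \<omega>) n - mart (D \<omega>) a) ^ 3) * incr (D \<omega>) n
         \<le> F (D \<omega>) * (mart (D \<omega>) (Suc n) - mart (D \<omega>) a) ^ 4"
      unfolding eq by (simp add: s_def x_def algebra_simps)
  qed (use int[of "\<lambda>u v w. (v - w) ^ 4"] int[of "\<lambda>u v w. 4 * (v - w) ^ 3 * (u - v)"]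
      int[of "\<lambda>u v w. (u - w) ^ 4"] in \<open>auto simp: incr_def mult.assoc\<close>)
  finally show ?thesis .
qed

definition exceeds :: "nat \<Rightarrow> nat \<Rightarrow> real \<Rightarrow> (nat \<Rightarrow> nat) \<Rightarrow> bool" where
  "exceeds a n l x \<longleftrightarrow> (\<exists>j\<in>{a..n}. \<bar>mart x j - mart x a\<bar> \<ge> l)"

lemma determined_upto_exceeds: "a \<le> n \<Longrightarrow> determined_upto n (exceeds a n l)"
  by (auto simp: determined_upto_def mart_def exceeds_def)

lemma exceeds_measurable: "{\<omega> \<in> space M. exceeds a n l (D \<omega>)} \<in> events"
proof -
  have "(\<lambda>\<omega>. exceeds a n l (D \<omega>)) \<in> measurable M (count_space UNIV)"
    by (rule measurable_determined[of "max a n"])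
        (auto simp: determined_upto_def mart_def exceeds_def)
  then show ?thesis by measurable
qed

text \<open>Doob's inequality with exponent four. In \<open>key\<close> the event grows by the part
  on which the level is reached at \<open>n + 1\<close> for the first time. There the fourth power
  is at least \<open>l^4\<close>, while on the old part it can only grow in mean, the indicator
  being determined by the past.\<close>

lemma maximal_inequality:
  assumes a: "1 \<le> a" "a \<le> b" and l: "l > 0"
  shows "prob {\<omega> \<in> space M. exceeds a b l (D \<omega>)} \<le> 4 * (real b - real a)\<^sup>2 * real b ^ 4 / l ^ 4"
proof -
  have int: "integrable M (\<lambda>\<omega>. of_bool (P (exceeds a n l (D \<omega>)) (exceeds a (Suc n) l (D \<omega>)))
      * \<phi> (mart (D \<omega>) n - mart (D \<omega>) a) (mart (D \<omega>) (Suc n) - mart (D \<omega>) a) :: real)"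
    if "a \<le> n" for n \<phi> P
    by (rule integrable_determined[where n="Suc n"])
        (use that in \<open>auto simp: determined_upto_def mart_def exceeds_def\<close>)
  have key: "l ^ 4 * expectation (\<lambda>\<omega>. of_bool (exceeds a n l (D \<omega>)))
     \<le> expectation (\<lambda>\<omega>. of_bool (exceeds a n l (D \<omega>)) * (mart (D \<omega>) n - mart (D \<omega>) a) ^ 4)"
    if "a \<le> n" for n
    using that
  proof (induction n rule: dec_induct)
    case base
    have "exceeds a a l x \<longleftrightarrow> False" for x using l by (simp add: exceeds_def)
    then show ?case by simp
  next
    case (step n)
    let ?E = "\<lambda>n \<omega>. exceeds a n l (D \<omega>)"
    let ?S = "\<lambda>n \<omega>. mart (D \<omega>) n - mart (D \<omega>) a"
    have i1: "integrable M (\<lambda>\<omega>. of_bool (?E n \<omega>) * (?S (Suc n) \<omega>) ^ 4)"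
      using int[of n "\<lambda>a b. a" "\<lambda>u v. v ^ 4"] step by simp
    have i2: "integrable M (\<lambda>\<omega>. of_bool (?E (Suc n) \<omega> \<and> \<not> ?E n \<omega>) * (?S (Suc n) \<omega>) ^ 4)"
      using int[of n "\<lambda>a b. b \<and> \<not> a" "\<lambda>u v. v ^ 4"] step by simp
    have i3: "integrable M (\<lambda>\<omega>. of_bool (?E n \<omega>) :: real)"
      using int[of n "\<lambda>a b. a" "\<lambda>u v. 1"] step by simp
    have i4: "integrable M (\<lambda>\<omega>. of_bool (?E (Suc n) \<omega> \<and> \<not> ?E n \<omega>) :: real)"
      using int[of n "\<lambda>a b. b \<and> \<not> a" "\<lambda>u v. 1"] step by simp
    have mono: "?E n \<omega> \<Longrightarrow> ?E (Suc n) \<omega>" for \<omega>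
      unfolding exceeds_def using step by fastforce
    then have split: "of_bool (?E (Suc n) \<omega>)
        = of_bool (?E n \<omega>) + (of_bool (?E (Suc n) \<omega> \<and> \<not> ?E n \<omega>) :: real)" for \<omega>
      by auto
    have "l ^ 4 * expectation (\<lambda>\<omega>. of_bool (?E (Suc n) \<omega>))
      = l ^ 4 * expectation (\<lambda>\<omega>. of_bool (?E n \<omega>)) + l ^ 4
          * expectation (\<lambda>\<omega>. of_bool (?E (Suc n) \<omega> \<and> \<not> ?E n \<omega>))"
      unfolding split using i3 i4 by (simp add: algebra_simps)
    also have "l ^ 4 * expectation (\<lambda>\<omega>. of_bool (?E n \<omega>))
        \<le> expectation (\<lambda>\<omega>. of_bool (?E n \<omega>) * (?S n \<omega>) ^ 4)"
      by (rule step.IH)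
    also have "\<dots> \<le> expectation (\<lambda>\<omega>. of_bool (?E n \<omega>) * (?S (Suc n) \<omega>) ^ 4)"
      by (rule submartingale_fourth_power)
         (use step a in \<open>auto intro: determined_upto_exceeds simp: determined_upto_def mart_def
             exceeds_def\<close>)
    also have "l ^ 4 * expectation (\<lambda>\<omega>. of_bool (?E (Suc n) \<omega> \<and> \<not> ?E n \<omega>))
       \<le> expectation (\<lambda>\<omega>. of_bool (?E (Suc n) \<omega> \<and> \<not> ?E n \<omega>) * (?S (Suc n) \<omega>) ^ 4)"
    proof (subst integral_mult_right_zero[symmetric], rule integral_mono)
      fix \<omega>
      have "l ^ 4 \<le> (?S (Suc n) \<omega>) ^ 4" if "?E (Suc n) \<omega> \<and> \<not> ?E n \<omega>"
      proof -
        have "\<bar>?S (Suc n) \<omega>\<bar> \<ge> l"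
          using that unfolding exceeds_def by (metis atLeastAtMost_iff le_Suc_eq)
        then have "l ^ 4 \<le> \<bar>?S (Suc n) \<omega>\<bar> ^ 4" using l by (intro power_mono) auto
        then show ?thesis by simp
      qed
      then show "l ^ 4 * of_bool (?E (Suc n) \<omega> \<and> \<not> ?E n \<omega>)
          \<le> of_bool (?E (Suc n) \<omega> \<and> \<not> ?E n \<omega>) * (?S (Suc n) \<omega>) ^ 4"
        by auto
    qed (use i2 i4 in auto)
    also have "expectation (\<lambda>\<omega>. of_bool (?E n \<omega>) * (?S (Suc n) \<omega>) ^ 4)
         + expectation (\<lambda>\<omega>. of_bool (?E (Suc n) \<omega> \<and> \<not> ?E n \<omega>) * (?S (Suc n) \<omega>) ^ 4)
      = expectation (\<lambda>\<omega>. of_bool (?E (Suc n) \<omega>) * (?S (Suc n) \<omega>) ^ 4)"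
      unfolding split using i1 i2 by (simp add: algebra_simps)
    finally show ?case by simp
  qed
  have "l ^ 4 * prob {\<omega> \<in> space M. exceeds a b l (D \<omega>)}
      = l ^ 4 * expectation (indicator {\<omega> \<in> space M. exceeds a b l (D \<omega>)})"
    using exceeds_measurable by simp
  also have "\<dots> = l ^ 4 * expectation (\<lambda>\<omega>. of_bool (exceeds a b l (D \<omega>)))"
    by (intro arg_cong2[where f="(*)"] refl Bochner_Integration.integral_cong)
        (auto simp: indicator_def)
  also have "\<dots> \<le> expectation (\<lambda>\<omega>. of_bool (exceeds a b l (D \<omega>))
      * (mart (D \<omega>) b - mart (D \<omega>) a) ^ 4)"
    by (rule key[OF a(2)])
  also have "\<dots> \<le> expectation (\<lambda>\<omega>. (mart (D \<omega>) b - mart (D \<omega>) a) ^ 4)"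
    by (rule integral_mono)
        (use int[of b "\<lambda>u v. u" "\<lambda>u v. u ^ 4"] a integrable_mart_diff[of "\<lambda>x. x ^ 4"] in auto)
  also have "\<dots> \<le> 4 * (real b - real a)\<^sup>2 * real b ^ 4"
    by (rule fourth_moment) (use a in auto)
  finally show ?thesis using l by (simp add: field_simps)
qed

end

section \<open>Characteristic functions of linear combinations of the increments\<close>

context random_insertions
begin

lemma mart_D_1: "mart (D \<omega>) 1 = 0"
  using D_le[of \<omega> 1] by (simp add: mart_def)

lemma second_moment_mart: "1 \<le> n \<Longrightarrow> expectation (\<lambda>\<omega>. (mart (D \<omega>) n)\<^sup>2) \<le> real n ^ 3"
proof -
  assume n: "1 \<le> n"
  have "expectation (\<lambda>\<omega>. (mart (D \<omega>) n)\<^sup>2) \<le> (real n - real 1) * (real n)\<^sup>2"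
    using second_moment[of 1 n n] n unfolding mart_D_1 by simp
  also have "\<dots> \<le> real n * (real n)\<^sup>2" by (intro mult_right_mono) auto
  finally show ?thesis by (simp add: power2_eq_square power3_eq_cube)
qed

text \<open>Completing the square in \<open>(n - d) (d + 1)\<close>. The correction
  \<open>(M_n / n)^2\<close> is the only randomness in the conditional variance, and its mean is at
  most \<open>n\<close>, against the leading \<open>n^2 / 4\<close>.\<close>

lemma conditional_variance:
  assumes "n \<ge> 1"
  shows "\<bar>(real n - real (x n)) * (real (x n) + 1) - (real (Suc n))\<^sup>2 / 4\<bar> = (mart x n / real n)\<^sup>2"
proof -
  have "mart x n / real n = real (x n) - (real n - 1) / 2"
    using assms by (simp add: mart_def field_simps)
  moreover have "(real (Suc n))\<^sup>2 / 4 - (real n - real (x n)) * (real (x n) + 1)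
      = (real (x n) - (real n - 1) / 2)\<^sup>2"
    by (simp add: power2_eq_square field_simps)
  ultimately show ?thesis by (metis abs_minus_commute abs_power2)
qed

lemma expectation_cmod_mono:
  fixes f :: "'a \<Rightarrow> complex"
  assumes "integrable M f" "integrable M g" "AE \<omega> in M. cmod (f \<omega>) \<le> g \<omega>" "expectation g \<le> B"
  shows "cmod (expectation f) \<le> B"
proof -
  have "cmod (expectation f) \<le> expectation (\<lambda>\<omega>. cmod (f \<omega>))" by (rule integral_norm_bound)
  also have "\<dots> \<le> expectation g" using assms by (intro integral_mono_AE) auto
  finally show ?thesis using assms by simp
qed

lemma iexp_taylor2: "cmod (iexp x - (1 + \<i> * x - x\<^sup>2 / 2)) \<le> \<bar>x\<bar> ^ 3 / 6"
proof -
  have "(\<Sum>k\<le>2. (\<i> * x) ^ k / fact k) = 1 + \<i> * x - x\<^sup>2 / 2"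
    by (simp add: numeral_2_eq_2 field_simps)
  then show ?thesis using iexp_approx1[of x 2] by (simp add: numeral_3_eq_3 numeral_2_eq_2)
qed

lemma exp_minus_taylor1:
  fixes x :: real
  assumes "x \<ge> 0"
  shows "\<bar>1 - x - exp (- x)\<bar> \<le> x\<^sup>2 / 2"
proof -
  have 1: "1 - x \<le> exp (- x)" using exp_ge_add_one_self[of "-x"] by simp
  have "exp (- x) \<le> 1 - x + x\<^sup>2 / 2"
  proof -
    have "\<exists>t. \<bar>t\<bar> \<le> \<bar>- x\<bar> \<and> exp (- x) = (\<Sum>m<3. (- x) ^ m / fact m) + exp t / fact 3 * (- x) ^ 3"
      by (rule Maclaurin_exp_le)
    then obtain t where "exp (- x) = (\<Sum>m<3. (- x) ^ m / fact m) + exp t / fact 3 * (- x) ^ 3"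
        by blast
    moreover have "exp t / fact 3 * (- x) ^ 3 \<le> 0"
      using assms by (simp add: power3_eq_cube mult_nonneg_nonneg)
    ultimately show ?thesis by (simp add: numeral_3_eq_3 power2_eq_square)
  qed
  with 1 show ?thesis by simp
qed

text \<open>Arbitrary coefficients on the increments, so that several times can be treated jointly:
  a linear combination of martingale values is of this form.\<close>

definition phase :: "(nat \<Rightarrow> real) \<Rightarrow> nat \<Rightarrow> (nat \<Rightarrow> nat) \<Rightarrow> real" where
  "phase c n x = (\<Sum>i = 1..<n. c i * incr x i)"

lemma determined_upto_phase: "determined_upto n (\<lambda>x. \<phi> (phase c n x))"
  unfolding determined_upto_def phase_def
proof (intro allI impI)
  fix x y :: "nat \<Rightarrow> nat" assume "\<forall>i\<le>n. x i = y i"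
  then have "(\<Sum>i = 1..<n. c i * incr x i) = (\<Sum>i = 1..<n. c i * incr y i)"
    by (intro sum.cong) (auto simp: incr_def mart_def)
  then show "\<phi> (\<Sum>i = 1..<n. c i * incr x i) = \<phi> (\<Sum>i = 1..<n. c i * incr y i)" by simp
qed

text \<open>One step multiplies the characteristic function by nearly the Gaussian factor. The three
  errors are, in order, the Taylor remainder of third order, the random part of the conditional
  variance estimated by the second moment of the martingale, and the replacement of
  \<open>1 - x\<close> by \<open>exp (- x)\<close> with \<open>x \<le> A^2 m^2 / 8\<close>.\<close>

lemma char_step:
  fixes c :: "nat \<Rightarrow> real"
  assumes n: "n \<ge> 1" "n \<le> m" "Suc n \<le> m" and A: "\<bar>c n\<bar> \<le> A"
  shows "cmod (expectation (\<lambda>\<omega>. iexp (phase c (Suc n) (D \<omega>)))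
      - exp (- ((c n)\<^sup>2 * (real (Suc n))\<^sup>2 / 8)) * expectation (\<lambda>\<omega>. iexp (phase c n (D \<omega>))))
    \<le> A ^ 3 * real m ^ 3 / 6 + A\<^sup>2 * real m / 2 + A ^ 4 * real m ^ 4 / 128"
proof -
  define U where "U x = iexp (phase c n x)" for x
  define h where "h = c n"
  define s where "s = h\<^sup>2 * (real (Suc n))\<^sup>2 / 4"
  let ?X = "\<lambda>\<omega>. incr (D \<omega>) n" and ?V = "\<lambda>\<omega>. (real n - real (D \<omega> n)) * (real (D \<omega> n) + 1)"
  have A0: "A \<ge> 0" using A abs_ge_zero order_trans by blast
  have detU: "determined_upto n (\<lambda>x. U x * z)" for z
    unfolding U_def by (rule determined_upto_phase)
  have detU': "determined_upto n (\<lambda>x. z * U x)" for z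
    unfolding U_def by (rule determined_upto_phase)
  have U1: "cmod (U x) = 1" for x by (simp add: U_def)
  have intU: "integrable M (\<lambda>\<omega>. U (D \<omega>) * \<phi> (incr (D \<omega>) n) (D \<omega> n))" for \<phi> :: "real \<Rightarrow> nat \<Rightarrow> complex"
  proof (rule integrable_determined)
    have "determined_upto (Suc n) (\<lambda>x. \<phi> (incr x n) (x n))"
      by (auto simp: determined_upto_def incr_def mart_def)
    moreover have "determined_upto (Suc n) U"
      using determined_upto_mono[OF detU[of 1], of "Suc n"] by simp
    ultimately show "determined_upto (Suc n) (\<lambda>x. U x * \<phi> (incr x n) (x n))"
      by (rule determined_upto_compose2[rotated])
  qed
  have intR: "integrable M (\<lambda>\<omega>. \<phi> (incr (D \<omega>) n) (D \<omega> n))" for \<phi> :: "real \<Rightarrow> nat \<Rightarrow> real"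
    by (rule integrable_determined[where n="Suc n"])
        (auto simp: determined_upto_def incr_def mart_def)
  have E1: "expectation (\<lambda>\<omega>. U (D \<omega>) * (\<i> * (h * ?X \<omega>))) = 0"
  proof -
    have "expectation (\<lambda>\<omega>. (\<i> * h * U (D \<omega>)) * of_real (?X \<omega>)) = 0"
      by (rule expectation_incr[OF n(1) detU'])
    then show ?thesis by (simp add: mult_ac)
  qed
  have E2: "expectation (\<lambda>\<omega>. U (D \<omega>) * of_real ((h * ?X \<omega>)\<^sup>2 / 2))
      = expectation (\<lambda>\<omega>. U (D \<omega>) * of_real (h\<^sup>2 * ?V \<omega> / 2))"
  proof -
    have "expectation (\<lambda>\<omega>. (of_real (h\<^sup>2 / 2) * U (D \<omega>)) * of_real ((?X \<omega>)\<^sup>2))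
       = expectation (\<lambda>\<omega>. (of_real (h\<^sup>2 / 2) * U (D \<omega>)) * of_real (?V \<omega>))"
      by (rule expectation_incr_square[OF n(1) detU'])
    then show ?thesis by (simp add: mult_ac power_mult_distrib)
  qed
  have phase_Suc: "iexp (phase c (Suc n) x) = U x * iexp (h * incr x n)" for x
    using n by (simp add: phase_def U_def h_def exp_add[symmetric] algebra_simps)
  \<comment> \<open>Since the linear term vanishes (\<open>E1\<close>) and the square may be
    exchanged for its conditional mean (\<open>E2\<close>), the difference is exactly the Taylor
    remainder.\<close>
  have "expectation (\<lambda>\<omega>. iexp (phase c (Suc n) (D \<omega>)))
      - expectation (\<lambda>\<omega>. U (D \<omega>) * (1 - of_real (h\<^sup>2 * ?V \<omega> / 2)))
    = expectation (\<lambda>\<omega>. U (D \<omega>) * (iexp (h * ?X \<omega>) - (1 + \<i> * (h * ?X \<omega>) - (h * ?X \<omega>)\<^sup>2 / 2)))"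
  proof -
    have *: "U (D \<omega>) * (iexp (h * ?X \<omega>) - (1 + \<i> * (h * ?X \<omega>) - (h * ?X \<omega>)\<^sup>2 / 2))
       = U (D \<omega>) * iexp (h * ?X \<omega>) - U (D \<omega>) - U (D \<omega>) * (\<i> * (h * ?X \<omega>)) + U (D \<omega>)
           * of_real ((h * ?X \<omega>)\<^sup>2 / 2)" for \<omega>
      by (simp add: algebra_simps)
    have **: "U (D \<omega>) * (1 - of_real (h\<^sup>2 * ?V \<omega> / 2))
        = U (D \<omega>) - U (D \<omega>) * of_real (h\<^sup>2 * ?V \<omega> / 2)" for \<omega>
      by (simp add: algebra_simps)
    have i: "integrable M (\<lambda>\<omega>. U (D \<omega>) * iexp (h * ?X \<omega>))" "integrable M (\<lambda>\<omega>. U (D \<omega>))"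
      "integrable M (\<lambda>\<omega>. U (D \<omega>) * (\<i> * (h * ?X \<omega>)))"
          "integrable M (\<lambda>\<omega>. U (D \<omega>) * of_real ((h * ?X \<omega>)\<^sup>2 / 2))"
      "integrable M (\<lambda>\<omega>. U (D \<omega>) * of_real (h\<^sup>2 * ?V \<omega> / 2))"
      using intU[of "\<lambda>x d. iexp (h * x)"] intU[of "\<lambda>x d. 1"] intU[of "\<lambda>x d. \<i> * (h * x)"]
        intU[of "\<lambda>x d. of_real ((h * x)\<^sup>2 / 2)"]
            intU[of "\<lambda>x d. of_real (h\<^sup>2 * ((real n - real d) * (real d + 1)) / 2)"]
      by simp_all
    show ?thesis
      unfolding * ** phase_Suc
      using E1 E2 i by (simp only: Bochner_Integration.integral_diff
          Bochner_Integration.integral_add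
          Bochner_Integration.integrable_diff Bochner_Integration.integrable_add) simp
  qed
  also have "cmod \<dots> \<le> A ^ 3 * real m ^ 3 / 6"
  proof (rule expectation_cmod_mono)
    show "integrable M (\<lambda>\<omega>. U (D \<omega>) * (iexp (h * ?X \<omega>) - (1 + \<i> * (h * ?X \<omega>) - (h * ?X \<omega>)\<^sup>2 / 2)))"
      by (rule intU)
    show "AE \<omega> in M. cmod (U (D \<omega>) * (iexp (h * ?X \<omega>) - (1 + \<i> * (h * ?X \<omega>) - (h * ?X \<omega>)\<^sup>2 / 2)))
        \<le> A ^ 3 * real m ^ 3 / 6"
      using AE_incr_le[OF n(1)]
    proof eventually_elim
      case (elim \<omega>)
      have "\<bar>h * ?X \<omega>\<bar> \<le> A * real m"
        unfolding abs_mult h_def using A elim n by (intro mult_mono) auto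
      then have "\<bar>h * ?X \<omega>\<bar> ^ 3 \<le> (A * real m) ^ 3" by (intro power_mono) auto
      then show ?case
        using iexp_taylor2[of "h * ?X \<omega>"] by (simp add: norm_mult U1 power_mult_distrib)
    qed
  qed (auto simp: prob_space)
  finally have 1: "cmod (expectation (\<lambda>\<omega>. iexp (phase c (Suc n) (D \<omega>)))
      - expectation (\<lambda>\<omega>. U (D \<omega>) * (1 - of_real (h\<^sup>2 * ?V \<omega> / 2)))) \<le> A ^ 3 * real m ^ 3 / 6" .
  \<comment> \<open>It remains to replace the random conditional variance by
    \<open>(n + 1)^2 / 4\<close> and to exponentiate.\<close>
  have "expectation (\<lambda>\<omega>. U (D \<omega>) * (1 - of_real (h\<^sup>2 * ?V \<omega> / 2)))
      - exp (- (s / 2)) * expectation (\<lambda>\<omega>. U (D \<omega>))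
     = expectation (\<lambda>\<omega>. U (D \<omega>) * of_real (1 - h\<^sup>2 * ?V \<omega> / 2 - exp (- (s / 2))))"
  proof -
    have i: "integrable M (\<lambda>\<omega>. U (D \<omega>))"
        "integrable M (\<lambda>\<omega>. U (D \<omega>) * (1 - of_real (h\<^sup>2 * ?V \<omega> / 2)))"
      using intU[of "\<lambda>x d. 1"]
          intU[of "\<lambda>x d. 1 - of_real (h\<^sup>2 * ((real n - real d) * (real d + 1)) / 2)"] by simp_all
    have "exp (- (s / 2)) * expectation (\<lambda>\<omega>. U (D \<omega>))
        = expectation (\<lambda>\<omega>. of_real (exp (- (s / 2))) * U (D \<omega>))"
      by (simp add: i)
    moreover have "integrable M (\<lambda>\<omega>. of_real (exp (- (s / 2))) * U (D \<omega>))"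
      using i by simp
    ultimately show ?thesis
      using i(2) by (simp only: Bochner_Integration.integral_diff[symmetric])
        (intro Bochner_Integration.integral_cong, auto simp: algebra_simps)
  qed
  also have "cmod \<dots> \<le> A\<^sup>2 * real m / 2 + A ^ 4 * real m ^ 4 / 128"
  proof (rule expectation_cmod_mono)
    let ?g = "\<lambda>\<omega>. A\<^sup>2 / 2 * (mart (D \<omega>) n / real n)\<^sup>2 + A ^ 4 * real m ^ 4 / 128"
    show "integrable M (\<lambda>\<omega>. U (D \<omega>) * of_real (1 - h\<^sup>2 * ?V \<omega> / 2 - exp (- (s / 2))))"
      by (rule intU)
    have im: "integrable M (\<lambda>\<omega>. (mart (D \<omega>) n)\<^sup>2)"
      by (rule integrable_determined[OF determined_upto_mart[OF order_refl]])
    then show "integrable M ?g"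
      by (simp add: power_divide)
    have h2: "h\<^sup>2 \<le> A\<^sup>2" unfolding h_def using A A0 by (simp add: abs_le_square_iff[symmetric])
    have s2: "(s / 2)\<^sup>2 / 2 \<le> A ^ 4 * real m ^ 4 / 128"
    proof -
      have "h\<^sup>2 * (real (Suc n))\<^sup>2 \<le> A\<^sup>2 * (real m)\<^sup>2"
        using n by (intro mult_mono[OF h2] power_mono) auto
      from power_mono[OF this, of 2] show ?thesis
        by (simp add: s_def power_mult_distrib power_divide flip: power_mult)
    qed
    show "AE \<omega> in M. cmod (U (D \<omega>) * of_real (1 - h\<^sup>2 * ?V \<omega> / 2 - exp (- (s / 2)))) \<le> ?g \<omega>"
    proof (rule AE_I2)
      fix \<omega>
      have "1 - h\<^sup>2 * v / 2 - w = - (h\<^sup>2 / 2) * (v - q / 4) + (1 - h\<^sup>2 * q / 4 / 2 - w)"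
          for v q w :: real
        by (simp add: field_simps)
      from this[of "?V \<omega>" "exp (- (s / 2))" "(real (Suc n))\<^sup>2"]
      have "1 - h\<^sup>2 * ?V \<omega> / 2 - exp (- (s / 2)) = - (h\<^sup>2 / 2) * (?V \<omega> - (real (Suc n))\<^sup>2 / 4)
          + (1 - s / 2 - exp (- (s / 2)))"
        by (simp only: s_def)
      then have "\<bar>1 - h\<^sup>2 * ?V \<omega> / 2 - exp (- (s / 2))\<bar> \<le> h\<^sup>2 / 2 * \<bar>?V \<omega> - (real (Suc n))\<^sup>2 / 4\<bar>
          + \<bar>1 - s / 2 - exp (- (s / 2))\<bar>"
        using abs_triangle_ineq[of "- (h\<^sup>2 / 2) * (?V \<omega> - (real (Suc n))\<^sup>2 / 4)"
            "1 - s / 2 - exp (- (s / 2))"]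
        by (simp only: abs_mult abs_minus_cancel abs_divide abs_power2 abs_numeral)
      also have "h\<^sup>2 / 2 * \<bar>?V \<omega> - (real (Suc n))\<^sup>2 / 4\<bar> \<le> A\<^sup>2 / 2 * (mart (D \<omega>) n / real n)\<^sup>2"
        unfolding conditional_variance[OF n(1)] using h2 by (intro mult_right_mono) auto
      also have "\<bar>1 - s / 2 - exp (- (s / 2))\<bar> \<le> (s / 2)\<^sup>2 / 2"
        by (rule exp_minus_taylor1) (simp add: s_def)
      finally have "\<bar>1 - h\<^sup>2 * ?V \<omega> / 2 - exp (- (s / 2))\<bar>
          \<le> A\<^sup>2 / 2 * (mart (D \<omega>) n / real n)\<^sup>2 + (s / 2)\<^sup>2 / 2"
        by simp
      from order_trans[OF this add_left_mono[OF s2]]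
      show "cmod (U (D \<omega>) * of_real (1 - h\<^sup>2 * ?V \<omega> / 2 - exp (- (s / 2)))) \<le> ?g \<omega>"
        unfolding norm_mult U1 norm_of_real mult_1 .
    qed
    have "expectation ?g = A\<^sup>2 / 2 * (expectation (\<lambda>\<omega>. (mart (D \<omega>) n)\<^sup>2) / (real n)\<^sup>2) + A ^ 4
        * real m ^ 4 / 128"
      using im by (simp add: power_divide prob_space)
    also have "expectation (\<lambda>\<omega>. (mart (D \<omega>) n)\<^sup>2) / (real n)\<^sup>2 \<le> real n ^ 3 / (real n)\<^sup>2"
      using second_moment_mart[OF n(1)] by (intro divide_right_mono) auto
    also have "real n ^ 3 / (real n)\<^sup>2 = real n"
      using n by (simp add: power2_eq_square power3_eq_cube)
    also have "A\<^sup>2 / 2 * real n \<le> A\<^sup>2 / 2 * real m" using n by (intro mult_left_mono) auto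
    finally show "expectation ?g \<le> A\<^sup>2 * real m / 2 + A ^ 4 * real m ^ 4 / 128"
        by (simp add: mult_left_mono)
  qed
  finally have 2: "cmod (expectation (\<lambda>\<omega>. U (D \<omega>) * (1 - of_real (h\<^sup>2 * ?V \<omega> / 2)))
      - exp (- (s / 2)) * expectation (\<lambda>\<omega>. U (D \<omega>)))
          \<le> A\<^sup>2 * real m / 2 + A ^ 4 * real m ^ 4 / 128" .
  have eq: "(c n)\<^sup>2 * (real (Suc n))\<^sup>2 / 8 = s / 2" by (simp add: s_def h_def)
  show ?thesis
    using norm_triangle_le[OF add_mono[OF 1 2]] unfolding eq U_def[symmetric]
        by (simp add: add.assoc)
qed

text \<open>The factors \<open>exp (- ?s)\<close> are at most 1, so the one-step errors simply add
  up.\<close>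

lemma char_phase:
  fixes c :: "nat \<Rightarrow> real"
  assumes n: "n \<ge> 1" "n \<le> m" and A: "\<And>i. i < m \<Longrightarrow> \<bar>c i\<bar> \<le> A"
  shows "cmod (expectation (\<lambda>\<omega>. iexp (phase c n (D \<omega>)))
      - exp (- (\<Sum>i = 1..<n. (c i)\<^sup>2 * (real (Suc i))\<^sup>2 / 8)))
    \<le> real n * (A ^ 3 * real m ^ 3 / 6 + A\<^sup>2 * real m / 2 + A ^ 4 * real m ^ 4 / 128)"
  using n
proof (induction n rule: dec_induct)
  case base
  have "A \<ge> 0" if "m > 0" using A[OF that] abs_ge_zero order_trans by blast
  then show ?case using base by (simp add: phase_def prob_space)
next
  case (step n)
  let ?E = "\<lambda>n. expectation (\<lambda>\<omega>. iexp (phase c n (D \<omega>)))"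
  let ?s = "(c n)\<^sup>2 * (real (Suc n))\<^sup>2 / 8" and ?S = "\<Sum>i = 1..<n. (c i)\<^sup>2 * (real (Suc i))\<^sup>2 / 8"
  let ?d = "A ^ 3 * real m ^ 3 / 6 + A\<^sup>2 * real m / 2 + A ^ 4 * real m ^ 4 / 128"
  have "complex_of_real (exp (- (\<Sum>i = 1..<Suc n. (c i)\<^sup>2 * (real (Suc i))\<^sup>2 / 8)))
      = of_real (exp (- ?s)) * of_real (exp (- ?S))"
    using step by (simp add: sum.atLeastLessThan_Suc flip: exp_add of_real_mult)
  then have eq: "?E (Suc n)
      - complex_of_real (exp (- (\<Sum>i = 1..<Suc n. (c i)\<^sup>2 * (real (Suc i))\<^sup>2 / 8)))
    = (?E (Suc n) - of_real (exp (- ?s)) * ?E n) + of_real (exp (- ?s))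
        * (?E n - of_real (exp (- ?S)))"
    by (simp add: algebra_simps)
  have b1: "cmod (?E (Suc n) - of_real (exp (- ?s)) * ?E n) \<le> ?d"
    by (rule char_step) (use step A in auto)
  have b2: "cmod (of_real (exp (- ?s)) * (?E n - of_real (exp (- ?S)))) \<le> 1 * (real n * ?d)"
    unfolding norm_mult norm_of_real
    by (intro mult_mono) (use step.IH step.prems in auto)
  have "cmod (?E (Suc n)
      - complex_of_real (exp (- (\<Sum>i = 1..<Suc n. (c i)\<^sup>2 * (real (Suc i))\<^sup>2 / 8))))
     \<le> ?d + 1 * (real n * ?d)"
    unfolding eq by (rule norm_triangle_mono[OF b1 b2])
  also have "?d + 1 * (real n * ?d) = real (Suc n) * ?d"
    by (simp only: of_nat_Suc distrib_right mult_1)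
  finally show ?case .
qed

end

section \<open>Convergence of Lipschitz functionals from characteristic functions\<close>

text \<open>The real trigonometric polynomials in the first \<open>m\<close> coordinates. Their
  expectations are combinations of real and imaginary parts of characteristic functions, and the
  product-to-sum formulas make them an algebra.\<close>

inductive_set trig_polys :: "nat \<Rightarrow> ((nat \<Rightarrow> real) \<Rightarrow> real) set" for m where
  cos: "(\<lambda>x. a * cos (\<Sum>i<m. c i * x i)) \<in> trig_polys m"
| sin: "(\<lambda>x. a * sin (\<Sum>i<m. c i * x i)) \<in> trig_polys m"
| add: "p \<in> trig_polys m \<Longrightarrow> q \<in> trig_polys m \<Longrightarrow> (\<lambda>x. p x + q x) \<in> trig_polys m"

lemma trig_polys_const: "(\<lambda>x. a) \<in> trig_polys m"
  using trig_polys.cos[of a "\<lambda>_. 0" m] by simp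

lemma trig_polys_mult:
  assumes "p \<in> trig_polys m" "q \<in> trig_polys m"
  shows "(\<lambda>x. p x * q x) \<in> trig_polys m"
  using assms(2)
proof induction
  case (cos b d)
  show ?case using assms(1)
  proof induction
    case (cos a c)
    have "(\<lambda>x. a * b / 2 * cos (\<Sum>i<m. (c i - d i) * x i) + a * b / 2
        * cos (\<Sum>i<m. (c i + d i) * x i)) \<in> trig_polys m"
      by (intro trig_polys.intros)
    then show ?case
      by (simp add: algebra_simps sum.distrib sum_subtractf cos_add cos_diff)
  next
    case (sin a c)
    have "(\<lambda>x. a * b / 2 * sin (\<Sum>i<m. (c i - d i) * x i) + a * b / 2
        * sin (\<Sum>i<m. (c i + d i) * x i)) \<in> trig_polys m"
      by (intro trig_polys.intros)
    then show ?case
      by (simp add: algebra_simps sum.distrib sum_subtractf sin_add sin_diff)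
  next
    case (add p q)
    from trig_polys.add[OF add.IH] show ?case by (simp add: algebra_simps)
  qed
next
  case (sin b d)
  show ?case using assms(1)
  proof induction
    case (cos a c)
    have "(\<lambda>x. a * b / 2 * sin (\<Sum>i<m. (d i - c i) * x i) + a * b / 2
        * sin (\<Sum>i<m. (d i + c i) * x i)) \<in> trig_polys m"
      by (intro trig_polys.intros)
    then show ?case
      by (simp add: algebra_simps sum.distrib sum_subtractf sin_add sin_diff)
  next
    case (sin a c)
    have "(\<lambda>x. a * b / 2 * cos (\<Sum>i<m. (c i - d i) * x i) + (- a * b / 2)
        * cos (\<Sum>i<m. (c i + d i) * x i)) \<in> trig_polys m"
      by (intro trig_polys.intros)
    then show ?case
      by (simp add: algebra_simps sum.distrib sum_subtractf cos_add cos_diff)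
  next
    case (add p q)
    from trig_polys.add[OF add.IH] show ?case by (simp add: algebra_simps)
  qed
next
  case (add q r)
  from trig_polys.add[OF add.IH] show ?case by (simp add: algebra_simps)
qed

lemma trig_polys_bounded: "p \<in> trig_polys m \<Longrightarrow> \<exists>B. \<forall>x. \<bar>p x\<bar> \<le> B"
proof (induction rule: trig_polys.induct)
  case (cos a c)
  have "\<bar>a * cos (\<Sum>i<m. c i * x i)\<bar> \<le> \<bar>a\<bar>" for x
    using mult_left_mono[OF abs_cos_le_one, of "\<bar>a\<bar>"] by (simp add: abs_mult)
  then show ?case by blast
next
  case (sin a c)
  have "\<bar>a * sin (\<Sum>i<m. c i * x i)\<bar> \<le> \<bar>a\<bar>" for x
    using mult_left_mono[OF abs_sin_le_one, of "\<bar>a\<bar>"] by (simp add: abs_mult)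
  then show ?case by blast
next
  case (add p q)
  then obtain B C where "\<forall>x. \<bar>p x\<bar> \<le> B" "\<forall>x. \<bar>q x\<bar> \<le> C" by blast
  then have "\<bar>p x + q x\<bar> \<le> B + C" for x
    by (meson abs_triangle_ineq add_mono order_trans)
  then show ?case by blast
qed

lemma trig_polys_cong: "p \<in> trig_polys m \<Longrightarrow> (\<And>i. i < m \<Longrightarrow> x i = y i) \<Longrightarrow> p x = p y"
  by (induction rule: trig_polys.induct)
      (auto intro!: arg_cong[where f=cos] arg_cong[where f=sin] sum.cong)

lemma trig_polys_continuous: "p \<in> trig_polys m \<Longrightarrow> continuous_on S p"
proof (induction rule: trig_polys.induct)
  case (cos a c)
  have "continuous_on UNIV (\<lambda>x::nat \<Rightarrow> real. a * cos (\<Sum>i<m. c i * x i))"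
    by (intro continuous_intros continuous_on_product_coordinates)
  then show ?case by (rule continuous_on_subset) simp
next
  case (sin a c)
  have "continuous_on UNIV (\<lambda>x::nat \<Rightarrow> real. a * sin (\<Sum>i<m. c i * x i))"
    by (intro continuous_intros continuous_on_product_coordinates)
  then show ?case by (rule continuous_on_subset) simp
qed (auto intro: continuous_intros)

lemma trig_polys_compose_polynomial:
  assumes "real_polynomial_function (r :: real \<Rightarrow> real)" "p \<in> trig_polys m"
  shows "(\<lambda>x. r (p x)) \<in> trig_polys m"
  using assms(1)
proof induction
  case (linear f)
  have "f t = f 1 * t" for t
    using linear_scale[OF bounded_linear.linear[OF linear], of t 1] by simp
  then have "(\<lambda>x. f (p x)) = (\<lambda>x. f 1 * p x)" by (intro ext)
  then show ?case using trig_polys_mult[OF trig_polys_const assms(2)] by simp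
qed (auto intro: trig_polys_const trig_polys.add trig_polys_mult)

text \<open>Stone-Weierstrass on the box. Coordinates from \<open>m\<close> on are frozen at 0,
  since trigonometric polynomials in \<open>m\<close> coordinates cannot separate points that differ
  only there.\<close>

lemma trig_polys_dense:
  assumes f: "continuous_on UNIV f" and "e > 0"
  obtains p where "p \<in> trig_polys m"
    "\<And>x. (\<And>i. i < m \<Longrightarrow> \<bar>x i\<bar> \<le> R) \<Longrightarrow> (\<And>i. i \<ge> m \<Longrightarrow> x i = 0) \<Longrightarrow> \<bar>f x - p x\<bar> < e"
proof -
  define S where "S = PiE UNIV (\<lambda>i. if i < m then {-R..R} else {0::real})"
  have "compactin (product_topology (\<lambda>i. euclidean) UNIV) S"
    unfolding S_def compactin_PiE by auto
  then have S: "compact S" by (simp add: euclidean_product_topology)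
  interpret function_ring_on "trig_polys m" S
  proof
    show "compact S" by (rule S)
    fix x y assume xy: "x \<in> S" "y \<in> S" "x \<noteq> y"
    then obtain i where i: "x i \<noteq> y i" by auto
    have im: "i < m"
    proof (rule ccontr)
      assume "\<not> i < m"
      then have "x i = 0" "y i = 0" using xy(1,2) unfolding S_def PiE_iff by (auto split: if_splits)
      then show False using i by simp
    qed
    \<comment> \<open>Dividing by \<open>w\<close> brings both coordinates into
      \<open>[-1, 1]\<close>, where the sine is injective.\<close>
    define w where "w = \<bar>x i\<bar> + \<bar>y i\<bar> + 1"
    have sum: "(\<Sum>j<m. (if j = i then 1 / w else 0) * z j) = z i / w" for z :: "nat \<Rightarrow> real"
    proof -
      have "(\<Sum>j<m. (if j = i then 1 / w else 0) * z j) = (\<Sum>j<m. if j = i then z j / w else 0)"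
        by (intro sum.cong) auto
      then show ?thesis using im by simp
    qed
    have "sin (x i / w) \<noteq> sin (y i / w)"
    proof
      assume eq: "sin (x i / w) = sin (y i / w)"
      have b: "- (pi / 2) \<le> u / w \<and> u / w \<le> pi / 2" if "\<bar>u\<bar> \<le> w" for u
      proof -
        have "\<bar>u / w\<bar> \<le> 1" using that by (simp add: w_def)
        then have "- 1 \<le> u / w" "u / w \<le> 1" by linarith+
        then show ?thesis using pi_ge_two by linarith
      qed
      have "x i / w = y i / w"
        using eq b[of "x i"] b[of "y i"] sin_inj_pi[of "x i / w" "y i / w"] by (auto simp: w_def)
      then show False using i by (simp add: w_def split: if_splits)
    qed
    then show "\<exists>f\<in>trig_polys m. f x \<noteq> f y"
      using trig_polys.sin[of 1 "\<lambda>j. if j = i then 1 / w else 0" m]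
          by (intro bexI) (auto simp only: sum)
  qed (auto intro: trig_polys_continuous trig_polys.add trig_polys_mult trig_polys_const)
  obtain p where p: "p \<in> trig_polys m" "\<forall>x\<in>S. \<bar>f x - p x\<bar> < e"
    using Stone_Weierstrass_basic[of f e] continuous_on_subset[OF f] assms(2) by blast
  have "x \<in> S" if "\<And>i. i < m \<Longrightarrow> \<bar>x i\<bar> \<le> R" "\<And>i. i \<ge> m \<Longrightarrow> x i = 0" for x
  proof -
    have "x i \<in> (if i < m then {-R..R} else {0})" for i
      using that(1)[of i] that(2)[of i] by (cases "i < m") (auto simp: abs_le_iff)
    then show ?thesis unfolding S_def PiE_iff by auto
  qed
  with p show ?thesis by (intro that) auto
qed

section \<open>Lipschitz functionals of finitely many coordinates\<close>

lemma lipschitz_coordinates_continuous: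
  fixes F :: "(nat \<Rightarrow> real) \<Rightarrow> real"
  assumes F: "\<And>x y. \<bar>F x - F y\<bar> \<le> L * (\<Sum>i<m. \<bar>x i - y i\<bar>)"
  shows "continuous_on UNIV F"
  unfolding continuous_on_def
proof
  fix x :: "nat \<Rightarrow> real"
  have "((\<lambda>y. F y - F x) \<longlongrightarrow> 0) (at x)"
  proof (rule Lim_null_comparison)
    show "\<forall>\<^sub>F y in at x. norm (F y - F x) \<le> L * (\<Sum>i<m. \<bar>y i - x i\<bar>)"
      using F by auto
    have "continuous_on UNIV (\<lambda>y::nat \<Rightarrow> real. L * (\<Sum>i<m. \<bar>y i - x i\<bar>))"
      by (intro continuous_intros continuous_on_product_coordinates)
    then have "((\<lambda>y. L * (\<Sum>i<m. \<bar>y i - x i\<bar>)) \<longlongrightarrow> L * (\<Sum>i<m. \<bar>x i - x i\<bar>)) (at x)"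
      unfolding continuous_on_def by blast
    then show "((\<lambda>y. L * (\<Sum>i<m. \<bar>y i - x i\<bar>)) \<longlongrightarrow> 0) (at x)" by simp
  qed
  then show "(F \<longlongrightarrow> F x) (at x within UNIV)" using LIM_zero_cancel by auto
qed

text \<open>The Lipschitz bound shows that \<open>F\<close> ignores the coordinates from
  \<open>m\<close> on, so these may be set to 0 before continuity on the product space is
  used.\<close>

lemma lipschitz_coordinates_measurable:
  fixes F :: "(nat \<Rightarrow> real) \<Rightarrow> real"
  assumes F: "\<And>x y. \<bar>F x - F y\<bar> \<le> L * (\<Sum>i<m. \<bar>x i - y i\<bar>)"
    and X: "\<And>i. i < m \<Longrightarrow> (\<lambda>\<omega>. X \<omega> i) \<in> borel_measurable M"
  shows "(\<lambda>\<omega>. F (X \<omega>)) \<in> borel_measurable M"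
proof -
  have "(\<lambda>\<omega> i. if i < m then X \<omega> i else 0) \<in> borel_measurable M"
  proof (rule measurable_coordinatewise_then_product)
    fix i show "(\<lambda>\<omega>. if i < m then X \<omega> i else 0) \<in> borel_measurable M"
      using X by (cases "i < m") auto
  qed
  then have "(\<lambda>\<omega>. F (\<lambda>i. if i < m then X \<omega> i else 0)) \<in> borel_measurable M"
    by (rule measurable_compose)
       (rule borel_measurable_continuous_onI[OF lipschitz_coordinates_continuous[OF F]])
  moreover have "F (\<lambda>i. if i < m then X \<omega> i else 0) = F (X \<omega>)" for \<omega>
    using F[of "\<lambda>i. if i < m then X \<omega> i else 0" "X \<omega>"] by simp
  ultimately show ?thesis by simp
qed

lemma trig_polys_measurable:
  assumes "p \<in> trig_polys m" and X[measurable]: "\<And>i. i < m \<Longrightarrow> (\<lambda>\<omega>. X \<omega> i) \<in> borel_measurable M"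
  shows "(\<lambda>\<omega>. p (X \<omega>)) \<in> borel_measurable M"
  using assms(1)
proof induction
  case (cos a c)
  have "(\<lambda>\<omega>. \<Sum>i<m. c i * X \<omega> i) \<in> borel_measurable M"
    by (intro borel_measurable_sum borel_measurable_times) (auto intro: X)
  then show ?case by simp
next
  case (sin a c)
  have "(\<lambda>\<omega>. \<Sum>i<m. c i * X \<omega> i) \<in> borel_measurable M"
    by (intro borel_measurable_sum borel_measurable_times) (auto intro: X)
  then show ?case by simp
qed auto

lemma trig_polys_converge:
  assumes M: "prob_space M" and N: "prob_space N"
    and X: "\<And>n i. i < m \<Longrightarrow> (\<lambda>\<omega>. X n \<omega> i) \<in> borel_measurable M"
    and Y: "\<And>i. i < m \<Longrightarrow> (\<lambda>\<omega>. Y \<omega> i) \<in> borel_measurable N"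
    and char: "\<And>c. (\<lambda>n. \<integral>\<omega>. iexp (\<Sum>i<m. c i * X n \<omega> i) \<partial>M) \<longlonglongrightarrow> (\<integral>\<omega>. iexp (\<Sum>i<m. c i * Y \<omega> i) \<partial>N)"
    and p: "p \<in> trig_polys m"
  shows "(\<lambda>n. \<integral>\<omega>. p (X n \<omega>) \<partial>M) \<longlonglongrightarrow> (\<integral>\<omega>. p (Y \<omega>) \<partial>N)"
proof -
  interpret M: prob_space M by fact
  interpret N: prob_space N by fact
  have mX: "(\<lambda>\<omega>. \<Sum>i<m. c i * X n \<omega> i) \<in> borel_measurable M" for c n
    by (intro borel_measurable_sum borel_measurable_times) (auto intro: X)
  have mY: "(\<lambda>\<omega>. \<Sum>i<m. c i * Y \<omega> i) \<in> borel_measurable N" for c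
    by (intro borel_measurable_sum borel_measurable_times) (auto intro: Y)
  have iX: "integrable M (\<lambda>\<omega>. iexp (\<Sum>i<m. c i * X n \<omega> i))" for c n
    using mX[of c n] by (intro M.integrable_iexp) (simp_all del: of_real_sum)
  have iY: "integrable N (\<lambda>\<omega>. iexp (\<Sum>i<m. c i * Y \<omega> i))" for c
    using mY[of c] by (intro N.integrable_iexp) (simp_all del: of_real_sum)
  have ReX: "(\<integral>\<omega>. cos (\<Sum>i<m. c i * X n \<omega> i) \<partial>M) = Re (\<integral>\<omega>. iexp (\<Sum>i<m. c i * X n \<omega> i) \<partial>M)" for c n
    using integral_Re[OF iX] by (simp add: Re_exp del: of_real_sum)
  have ReY: "(\<integral>\<omega>. cos (\<Sum>i<m. c i * Y \<omega> i) \<partial>N) = Re (\<integral>\<omega>. iexp (\<Sum>i<m. c i * Y \<omega> i) \<partial>N)" for c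
    using integral_Re[OF iY] by (simp add: Re_exp del: of_real_sum)
  have ImX: "(\<integral>\<omega>. sin (\<Sum>i<m. c i * X n \<omega> i) \<partial>M) = Im (\<integral>\<omega>. iexp (\<Sum>i<m. c i * X n \<omega> i) \<partial>M)" for c n
    using integral_Im[OF iX] by (simp add: Im_exp del: of_real_sum)
  have ImY: "(\<integral>\<omega>. sin (\<Sum>i<m. c i * Y \<omega> i) \<partial>N) = Im (\<integral>\<omega>. iexp (\<Sum>i<m. c i * Y \<omega> i) \<partial>N)" for c
    using integral_Im[OF iY] by (simp add: Im_exp del: of_real_sum)
  from p show ?thesis
  proof induction
    case (cos a c)
    show ?case unfolding integral_mult_right_zero ReX ReY by (intro tendsto_intros char)
  next
    case (sin a c)
    show ?case unfolding integral_mult_right_zero ImX ImY by (intro tendsto_intros char)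
  next
    case (add p q)
    have "integrable M (\<lambda>\<omega>. r (X n \<omega>))" if "r \<in> trig_polys m" for r n
    proof -
      obtain B where "\<forall>x. \<bar>r x\<bar> \<le> B" using trig_polys_bounded[OF \<open>r \<in> _\<close>] by blast
      then show ?thesis
        by (intro M.integrable_const_bound[of _ B] trig_polys_measurable[OF that] X) auto
    qed
    moreover have "integrable N (\<lambda>\<omega>. r (Y \<omega>))" if "r \<in> trig_polys m" for r
    proof -
      obtain B where "\<forall>x. \<bar>r x\<bar> \<le> B" using trig_polys_bounded[OF \<open>r \<in> _\<close>] by blast
      then show ?thesis
        by (intro N.integrable_const_bound[of _ B] trig_polys_measurable[OF that] Y) auto
    qed
    ultimately show ?case using add by (simp add: tendsto_add)
  qed
qed

text \<open>On a large box \<open>F\<close> is close to a trigonometric polynomial, which need not be bounded by \<open>B\<close> outside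
the box. Composing it with a polynomial that approximates clipping to \<open>[-B, B]\<close> repairs this
    and gives
again a trigonometric polynomial.\<close>

lemma lipschitz_functional_converges:
  fixes F :: "(nat \<Rightarrow> real) \<Rightarrow> real"
  assumes M: "prob_space M" and N: "prob_space N"
    and X: "\<And>n i. i < m \<Longrightarrow> (\<lambda>\<omega>. X n \<omega> i) \<in> borel_measurable M"
    and Y: "\<And>i. i < m \<Longrightarrow> (\<lambda>\<omega>. Y \<omega> i) \<in> borel_measurable N"
    and char: "\<And>c. (\<lambda>n. \<integral>\<omega>. iexp (\<Sum>i<m. c i * X n \<omega> i) \<partial>M) \<longlonglongrightarrow> (\<integral>\<omega>. iexp (\<Sum>i<m. c i * Y \<omega> i) \<partial>N)"
    and X2: "\<And>n i. i < m \<Longrightarrow> integrable M (\<lambda>\<omega>. (X n \<omega> i)\<^sup>2)" "\<And>n i. i < m \<Longrightarrow> (\<integral>\<omega>. (X n \<omega> i)\<^sup>2 \<partial>M) \<le> C"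
    and Y2: "\<And>i. i < m \<Longrightarrow> integrable N (\<lambda>\<omega>. (Y \<omega> i)\<^sup>2)" "\<And>i. i < m \<Longrightarrow> (\<integral>\<omega>. (Y \<omega> i)\<^sup>2 \<partial>N) \<le> C"
    and F: "\<And>x y. \<bar>F x - F y\<bar> \<le> L * (\<Sum>i<m. \<bar>x i - y i\<bar>)" "\<And>x. \<bar>F x\<bar> \<le> B"
  shows "(\<lambda>n. \<integral>\<omega>. F (X n \<omega>) \<partial>M) \<longlonglongrightarrow> (\<integral>\<omega>. F (Y \<omega>) \<partial>N)"
proof (rule LIMSEQ_I)
  fix r :: real assume r: "r > 0"
  interpret M: prob_space M by fact
  interpret N: prob_space N by fact
  have B0: "B \<ge> 0" using F(2)[of undefined] by linarith
  define e where "e = r / 8"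
  define D where "D = 2 * B * (real m * \<bar>C\<bar>)"
  have D0: "D \<ge> 0" using B0 by (simp add: D_def)
  \<comment> \<open>Large enough that \<open>D / R^2\<close>, the Chebyshev bound on
    \<open>2 B\<close> times the mass outside the box, is at most \<open>e\<close>; the summand 1
    keeps \<open>R\<close> positive.\<close>
  define R where "R = sqrt (D / e + 1)"
  have e: "e > 0" using r by (simp add: e_def)
  have R2: "R\<^sup>2 = D / e + 1" using D0 e by (simp add: R_def)
  have R0: "R > 0" using D0 e by (simp add: R_def add_nonneg_pos)
  have DR: "D / R\<^sup>2 \<le> e" using e D0 by (simp add: R2 field_simps)
  obtain q where q: "q \<in> trig_polys m"
    "\<And>x. (\<And>i. i < m \<Longrightarrow> \<bar>x i\<bar> \<le> R) \<Longrightarrow> (\<And>i. i \<ge> m \<Longrightarrow> x i = 0) \<Longrightarrow> \<bar>F x - q x\<bar> < e"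
    using trig_polys_dense[OF lipschitz_coordinates_continuous[OF F(1)] e] by blast
  obtain K where K: "\<And>x. \<bar>q x\<bar> \<le> K" using trig_polys_bounded[OF q(1)] by blast
  define clip where "clip t = max (-B) (min B t)" for t
  have "continuous_on {-K..K} clip" unfolding clip_def by (intro continuous_intros)
  then obtain s where s: "real_polynomial_function s" "\<And>t. t \<in> {-K..K} \<Longrightarrow> \<bar>clip t - s t\<bar> < e"
    using Stone_Weierstrass_real_polynomial_function[of "{-K..K}" clip e] e by auto
  define p where "p x = s (q x)" for x
  have p: "p \<in> trig_polys m"
    using trig_polys_compose_polynomial[OF s(1) q(1)] by (simp add: p_def[abs_def])
  \<comment> \<open>Chebyshev in pointwise form: outside the box some \<open>(x i)^2\<close> exceeds
    \<open>R^2\<close>, so the quadratic term absorbs the trivial bound \<open>2 B\<close>.\<close>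
  have bound: "\<bar>F x - p x\<bar> \<le> 2 * e + 2 * B / R\<^sup>2 * (\<Sum>i<m. (x i)\<^sup>2)" for x
  proof -
    have cp: "\<bar>clip (q x) - p x\<bar> < e" using s(2)[of "q x"] K[of x] by (auto simp: p_def abs_le_iff)
    have sum0: "(\<Sum>i<m. (x i)\<^sup>2) \<ge> 0" by (intro sum_nonneg) auto
    show ?thesis
    proof (cases "\<forall>i<m. \<bar>x i\<bar> \<le> R")
      case True
      define y where "y i = (if i < m then x i else 0)" for i
      have "F x = F y" using F(1)[of x y] by (simp add: y_def)
      moreover have "q x = q y" by (rule trig_polys_cong[OF q(1)]) (simp add: y_def)
      moreover have "\<bar>F y - q y\<bar> < e" by (rule q(2)) (use True in \<open>auto simp: y_def\<close>)
      ultimately have "\<bar>F x - q x\<bar> < e" by simp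
      then have "\<bar>F x - clip (q x)\<bar> < e"
        using F(2)[of x] unfolding clip_def by (auto simp: max_def min_def abs_le_iff abs_less_iff)
      then have "\<bar>F x - p x\<bar> \<le> 2 * e" using cp by linarith
      also have "\<dots> \<le> 2 * e + 2 * B / R\<^sup>2 * (\<Sum>i<m. (x i)\<^sup>2)"
        using B0 sum0 by simp
      finally show ?thesis .
    next
      case False
      then obtain i where i: "i < m" "\<bar>x i\<bar> > R" by auto
      have "R\<^sup>2 \<le> (x i)\<^sup>2" using i R0 by (metis less_imp_le power2_abs power_mono)
      also have "\<dots> \<le> (\<Sum>i<m. (x i)\<^sup>2)" using i by (intro member_le_sum) auto
      finally have "2 * B \<le> 2 * B / R\<^sup>2 * (\<Sum>i<m. (x i)\<^sup>2)"
        using B0 R0 by (simp add: field_simps mult_left_mono)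
      moreover have "\<bar>clip (q x)\<bar> \<le> B" using B0 by (auto simp: clip_def)
      ultimately show ?thesis using cp F(2)[of x] e by linarith
    qed
  qed
  have close: "\<bar>(\<integral>\<omega>. F (Z \<omega>) \<partial>Q) - (\<integral>\<omega>. p (Z \<omega>) \<partial>Q)\<bar> \<le> 3 * e"
    if Q: "prob_space Q" and Zm: "\<And>i. i < m \<Longrightarrow> (\<lambda>\<omega>. Z \<omega> i) \<in> borel_measurable Q"
      and Z2: "\<And>i. i < m \<Longrightarrow> integrable Q (\<lambda>\<omega>. (Z \<omega> i)\<^sup>2)" "\<And>i. i < m \<Longrightarrow> (\<integral>\<omega>. (Z \<omega> i)\<^sup>2 \<partial>Q) \<le> C" for Q
          and Z :: "'c \<Rightarrow> nat \<Rightarrow> real"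
  proof -
    interpret Q: prob_space Q by fact
    obtain P where P: "\<And>x. \<bar>p x\<bar> \<le> P" using trig_polys_bounded[OF p] by blast
    have iF: "integrable Q (\<lambda>\<omega>. F (Z \<omega>))"
      by (rule Q.integrable_const_bound[of _ B])
          (use F(2) lipschitz_coordinates_measurable[OF F(1) Zm] in auto)
    have ip: "integrable Q (\<lambda>\<omega>. p (Z \<omega>))"
      by (rule Q.integrable_const_bound[of _ P]) (use P trig_polys_measurable[OF p Zm] in auto)
    have iS: "integrable Q (\<lambda>\<omega>. \<Sum>i<m. (Z \<omega> i)\<^sup>2)" using Z2 by auto
    have "\<bar>(\<integral>\<omega>. F (Z \<omega>) \<partial>Q) - (\<integral>\<omega>. p (Z \<omega>) \<partial>Q)\<bar> = \<bar>\<integral>\<omega>. F (Z \<omega>) - p (Z \<omega>) \<partial>Q\<bar>"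
      using iF ip by simp
    also have "\<dots> \<le> (\<integral>\<omega>. \<bar>F (Z \<omega>) - p (Z \<omega>)\<bar> \<partial>Q)" by (rule integral_abs_bound)
    also have "\<dots> \<le> (\<integral>\<omega>. 2 * e + 2 * B / R\<^sup>2 * (\<Sum>i<m. (Z \<omega> i)\<^sup>2) \<partial>Q)"
      using iF ip iS bound by (intro integral_mono) auto
    also have "\<dots> = 2 * e + 2 * B / R\<^sup>2 * (\<Sum>i<m. \<integral>\<omega>. (Z \<omega> i)\<^sup>2 \<partial>Q)"
      using iS Z2 by (simp add: Q.prob_space)
    also have "(\<Sum>i<m. \<integral>\<omega>. (Z \<omega> i)\<^sup>2 \<partial>Q) \<le> (\<Sum>i<m. \<bar>C\<bar>)"
      using Z2(2) by (intro sum_mono) (auto intro: order_trans[OF _ abs_ge_self])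
    also have "2 * B / R\<^sup>2 * (\<Sum>i<m. \<bar>C\<bar>) = D / R\<^sup>2" by (simp add: D_def)
    finally have "\<bar>(\<integral>\<omega>. F (Z \<omega>) \<partial>Q) - (\<integral>\<omega>. p (Z \<omega>) \<partial>Q)\<bar> \<le> 2 * e + D / R\<^sup>2"
      using B0 by (simp add: mult_left_mono divide_right_mono)
    then show ?thesis using DR by linarith
  qed
  have "(\<lambda>n. \<integral>\<omega>. p (X n \<omega>) \<partial>M) \<longlonglongrightarrow> (\<integral>\<omega>. p (Y \<omega>) \<partial>N)"
    by (rule trig_polys_converge[OF M N X Y char p])
  from LIMSEQ_D[OF this e] obtain n0 where n0: "\<And>n. n \<ge> n0 \<Longrightarrow> \<bar>(\<integral>\<omega>. p (X n \<omega>) \<partial>M) - (\<integral>\<omega>. p (Y \<omega>) \<partial>N)\<bar>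
      < e"
    by auto
  show "\<exists>n0. \<forall>n\<ge>n0. norm ((\<integral>\<omega>. F (X n \<omega>) \<partial>M) - (\<integral>\<omega>. F (Y \<omega>) \<partial>N)) < r"
  proof (intro exI allI impI)
    fix n assume "n \<ge> n0"
    have "\<bar>(\<integral>\<omega>. F (X n \<omega>) \<partial>M) - (\<integral>\<omega>. p (X n \<omega>) \<partial>M)\<bar> \<le> 3 * e"
      by (rule close[OF M X X2])
    moreover have "\<bar>(\<integral>\<omega>. F (Y \<omega>) \<partial>N) - (\<integral>\<omega>. p (Y \<omega>) \<partial>N)\<bar> \<le> 3 * e"
      by (rule close[OF N Y Y2])
    ultimately show "norm ((\<integral>\<omega>. F (X n \<omega>) \<partial>M) - (\<integral>\<omega>. F (Y \<omega>) \<partial>N)) < r"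
      using n0[OF \<open>n \<ge> n0\<close>] r unfolding e_def real_norm_def by linarith
  qed
qed

section \<open>Locally uniform distance on the Skorokhod space\<close>

text \<open>A single weighted supremum metrises uniform convergence on compact intervals: the
  truncation at 1 together with the decay of the weight makes the contribution of late times
  small.\<close>

definition path_dist :: "(real \<Rightarrow> real) \<Rightarrow> (real \<Rightarrow> real) \<Rightarrow> real" where
  "path_dist x y = (SUP t\<in>{0..}. min 1 \<bar>x t - y t\<bar> / (1 + t))"

lemma path_dist_term_le_1: "t \<ge> 0 \<Longrightarrow> min 1 \<bar>x t - y t\<bar> / (1 + t) \<le> (1 :: real)"
  by (auto simp: divide_le_eq min_le_iff_disj)

lemma path_dist_upper: "t \<ge> 0 \<Longrightarrow> min 1 \<bar>x t - y t\<bar> / (1 + t) \<le> path_dist x y"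
  unfolding path_dist_def
  by (rule cSUP_upper) (auto intro!: bdd_aboveI[of _ 1] path_dist_term_le_1)

lemma path_dist_least: "(\<And>t. t \<ge> 0 \<Longrightarrow> min 1 \<bar>x t - y t\<bar> / (1 + t) \<le> c) \<Longrightarrow> path_dist x y \<le> c"
  unfolding path_dist_def by (rule cSUP_least) auto

lemma path_dist_nonneg: "path_dist x y \<ge> 0"
proof -
  have "0 \<le> min 1 \<bar>x 0 - y 0\<bar> / (1 + 0)" by simp
  also have "\<dots> \<le> path_dist x y" by (rule path_dist_upper) simp
  finally show ?thesis .
qed

lemma path_dist_le_1: "path_dist x y \<le> 1"
  by (rule path_dist_least) (rule path_dist_term_le_1)

lemma path_dist_commute: "path_dist x y = path_dist y x"
  unfolding path_dist_def by (simp add: abs_minus_commute)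

lemma path_dist_refl: "path_dist x x = 0"
  unfolding path_dist_def by simp

lemma path_dist_triangle: "path_dist x z \<le> path_dist x y + path_dist y z"
proof (rule path_dist_least)
  fix t :: real assume t: "t \<ge> 0"
  have "min 1 \<bar>x t - z t\<bar> \<le> min 1 \<bar>x t - y t\<bar> + min 1 \<bar>y t - z t\<bar>"
    by (auto simp: min_def)
  then have "min 1 \<bar>x t - z t\<bar> / (1 + t) \<le> min 1 \<bar>x t - y t\<bar> / (1 + t) + min 1 \<bar>y t - z t\<bar>
      / (1 + t)"
    using t by (simp add: divide_right_mono flip: add_divide_distrib)
  also have "\<dots> \<le> path_dist x y + path_dist y z"
    using t by (intro add_mono path_dist_upper)
  finally show "min 1 \<bar>x t - z t\<bar> / (1 + t) \<le> path_dist x y + path_dist y z" .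
qed

text \<open>Beyond the horizon \<open>T\<close> the weight alone is at most
  \<open>1 / (1 + T)\<close>.\<close>

lemma path_dist_le:
  assumes "\<And>t. 0 \<le> t \<Longrightarrow> t < T \<Longrightarrow> \<bar>x t - y t\<bar> \<le> e" "e \<ge> 0" "T \<ge> 0"
  shows "path_dist x y \<le> e + 1 / (1 + T)"
proof (rule path_dist_least)
  fix t :: real assume t: "t \<ge> 0"
  show "min 1 \<bar>x t - y t\<bar> / (1 + t) \<le> e + 1 / (1 + T)"
  proof (cases "t < T")
    case True
    have "min 1 \<bar>x t - y t\<bar> / (1 + t) \<le> min 1 \<bar>x t - y t\<bar> / 1"
      using t by (intro divide_left_mono) auto
    also have "\<dots> \<le> e" using assms(1)[OF t True] by simp
    also have "\<dots> \<le> e + 1 / (1 + T)" using assms(3) by simp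
    finally show ?thesis .
  next
    case False
    have "min 1 \<bar>x t - y t\<bar> / (1 + t) \<le> 1 / (1 + T)"
      using t False assms(3) by (intro frac_le) auto
    then show ?thesis using assms(2) by simp
  qed
qed

lemma tendsto_inverse_Suc_null: "(\<lambda>n. 1 / (1 + real n)) \<longlonglongrightarrow> 0"
  using LIMSEQ_inverse_real_of_nat by (simp add: field_simps)

text \<open>The identity serves as every time change.\<close>

lemma path_dist_J1_converges:
  assumes "(\<lambda>n. path_dist x (X n)) \<longlonglongrightarrow> 0"
  shows "J1_converges X x"
  unfolding J1_converges_def
proof (intro exI[of _ "\<lambda>_ t. t"] conjI allI)
  show "(\<lambda>t. t) \<in> time_changes" by (simp add: time_changes_def strict_mono_on_def)
  show "uniform_limit {0..} (\<lambda>_ t. t) (\<lambda>t. t) sequentially" by (simp add: uniform_limit_iff)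
  fix b :: real
  show "uniform_limit {0..b} (\<lambda>n. X n) x sequentially"
    unfolding uniform_limit_iff
  proof (intro allI impI)
    fix e :: real assume e: "e > 0"
    \<comment> \<open>Undoes the weight on \<open>[0, b]\<close>; the \<open>min\<close> with 1
      keeps the bound below the truncation level, so that it speaks about the difference of the
      paths itself.\<close>
    define c where "c = min e 1 / (1 + \<bar>b\<bar>)"
    have "c > 0" using e by (simp add: c_def)
    with assms have "\<forall>\<^sub>F n in sequentially. path_dist x (X n) < c"
      by (rule order_tendstoD)
    then show "\<forall>\<^sub>F n in sequentially. \<forall>t\<in>{0..b}. dist (X n t) (x t) < e"
    proof eventually_elim
      case (elim n)
      show ?case
      proof
        fix t assume t: "t \<in> {0..b}"
        have "min 1 \<bar>x t - X n t\<bar> / (1 + t) < c"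
          using path_dist_upper[of t x "X n"] elim t by simp
        then have "min 1 \<bar>x t - X n t\<bar> < c * (1 + t)" using t by (simp add: divide_less_eq)
        also have "\<dots> \<le> c * (1 + \<bar>b\<bar>)" using t \<open>c > 0\<close> by (intro mult_left_mono) auto
        also have "\<dots> = min e 1" by (simp add: c_def)
        finally show "dist (X n t) (x t) < e" by (auto simp: dist_real_def min_def split: if_splits)
      qed
    qed
  qed
qed

text \<open>Openness in the Skorokhod topology is defined through sequences. If no ball of
  \<open>path_dist\<close> around \<open>x\<close> fitted into \<open>U\<close>, the radii
  \<open>1 / (n + 1)\<close> would give a sequence outside \<open>U\<close> that converges to
  \<open>x\<close>.\<close>

lemma skorokhod_open_ball:
  assumes "skorokhod_open U" "x \<in> U"
  obtains d where "d > 0" "\<And>y. y \<in> skorokhod_space \<Longrightarrow> path_dist x y < d \<Longrightarrow> y \<in> U"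
proof -
  have "\<exists>d>0. \<forall>y\<in>skorokhod_space. path_dist x y < d \<longrightarrow> y \<in> U"
  proof (rule ccontr)
    assume "\<not> ?thesis"
    then have "\<exists>y\<in>skorokhod_space. path_dist x y < 1 / (1 + real n) \<and> y \<notin> U" for n
      by (metis add_pos_nonneg of_nat_0_le_iff zero_less_divide_1_iff zero_less_one)
    then obtain X where X: "\<And>n. X n \<in> skorokhod_space" "\<And>n. path_dist x (X n) < 1 / (1 + real n)"
        "\<And>n. X n \<notin> U"
      by metis
    have "(\<lambda>n. path_dist x (X n)) \<longlonglongrightarrow> 0"
      using tendsto_const[of 0] tendsto_inverse_Suc_null
    proof (rule tendsto_sandwich[rotated 2])
      show "\<forall>\<^sub>F n in sequentially. path_dist x (X n) \<le> 1 / (1 + real n)"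
        by (intro always_eventually allI less_imp_le X(2))
    qed (simp add: path_dist_nonneg)
    then have "\<forall>\<^sub>F n in sequentially. X n \<in> U"
      using assms X(1) path_dist_J1_converges unfolding skorokhod_open_def by blast
    then show False using X(3) by simp
  qed
  then show ?thesis using that by blast
qed

lemma skorokhod_continuous_at:
  assumes f: "continuous_map skorokhod euclideanreal f" and x: "x \<in> skorokhod_space" and e: "e > 0"
  obtains d where "d > 0" "\<And>y. y \<in> skorokhod_space \<Longrightarrow> path_dist x y < d \<Longrightarrow> \<bar>f y - f x\<bar> < e"
proof -
  have "openin skorokhod {y \<in> topspace skorokhod. f y \<in> ball (f x) e}"
    using f by (rule openin_continuous_map_preimage) simp
  then have "skorokhod_open {y \<in> skorokhod_space. f y \<in> ball (f x) e}"
    by (simp add: openin_skorokhod topspace_skorokhod)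
  moreover have "x \<in> {y \<in> skorokhod_space. f y \<in> ball (f x) e}" using x e by simp
  ultimately obtain d where "d > 0"
    "\<And>y. y \<in> skorokhod_space \<Longrightarrow> path_dist x y < d \<Longrightarrow> y \<in> {y \<in> skorokhod_space. f y \<in> ball (f x) e}"
    by (rule skorokhod_open_ball) blast
  then show ?thesis
    by (intro that[of d]) (auto simp: dist_real_def abs_minus_commute)
qed

text \<open>Required for all functions, not only for Skorokhod paths, so that such functionals can
  be evaluated directly on step functions.\<close>

definition lipschitz_path :: "real \<Rightarrow> ((real \<Rightarrow> real) \<Rightarrow> real) \<Rightarrow> bool" where
  "lipschitz_path L g \<longleftrightarrow> (\<forall>x y. \<bar>g x - g y\<bar> \<le> L * path_dist x y)"

text \<open>An infimum of \<open>L\<close>-Lipschitz functions. It is used twice: for the distance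
  to a closed set, and for the approximation of a continuous functional from below.\<close>

lemma lipschitz_path_INF:
  assumes L: "L \<ge> 0" and A: "A \<noteq> {}" and f: "\<And>y. y \<in> A \<Longrightarrow> f y \<ge> B"
  shows "lipschitz_path L (\<lambda>x. INF y\<in>A. f y + L * path_dist x y)"
proof -
  have bdd: "bdd_below ((\<lambda>y. f y + L * path_dist x y) ` A)" for x
    by (rule bdd_belowI[of _ B]) (use f L path_dist_nonneg in \<open>auto intro!: add_increasing2\<close>)
  have le: "(INF y\<in>A. f y + L * path_dist x y)
      \<le> (INF y\<in>A. f y + L * path_dist z y) + L * path_dist x z" for x z
  proof -
    have "(INF y\<in>A. f y + L * path_dist x y) - L * path_dist x z
        \<le> (INF y\<in>A. f y + L * path_dist z y)"
    proof (rule cINF_greatest[OF A])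
      fix y assume y: "y \<in> A"
      have "(INF y\<in>A. f y + L * path_dist x y) \<le> f y + L * path_dist x y"
        using bdd y by (rule cINF_lower)
      also have "L * path_dist x y \<le> L * (path_dist x z + path_dist z y)"
        using L path_dist_triangle by (intro mult_left_mono)
      finally show "(INF y\<in>A. f y + L * path_dist x y) - L * path_dist x z
          \<le> f y + L * path_dist z y"
        by (simp add: algebra_simps)
    qed
    then show ?thesis by simp
  qed
  show ?thesis
    unfolding lipschitz_path_def
  proof (intro allI)
    fix x z
    show "\<bar>(INF y\<in>A. f y + L * path_dist x y) - (INF y\<in>A. f y + L * path_dist z y)\<bar>
        \<le> L * path_dist x z"
      using le[of x z] le[of z x] unfolding path_dist_commute[of z x] by linarith
  qed
qed

lemma lipschitz_path_tendsto:
  assumes g: "lipschitz_path L g" and "(\<lambda>n. path_dist (X n) x) \<longlonglongrightarrow> 0"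
  shows "(\<lambda>n. g (X n)) \<longlonglongrightarrow> g x"
proof -
  have "(\<lambda>n. g (X n) - g x) \<longlonglongrightarrow> 0"
  proof (rule Lim_null_comparison)
    show "\<forall>\<^sub>F n in sequentially. norm (g (X n) - g x) \<le> L * path_dist (X n) x"
      using g by (simp add: lipschitz_path_def)
    show "(\<lambda>n. L * path_dist (X n) x) \<longlonglongrightarrow> 0"
      using tendsto_mult_right_zero[OF assms(2)] .
  qed
  then show ?thesis by (rule LIM_zero_cancel)
qed

text \<open>An open set consists of the paths at positive distance from its complement, and that
  distance is 1-Lipschitz. Each open set is thus treated in one piece, without a countable union of
  balls.\<close>

lemma measurable_skorokhod:
  assumes X: "\<And>\<omega>. \<omega> \<in> space M \<Longrightarrow> X \<omega> \<in> skorokhod_space"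
    and g: "\<And>g. lipschitz_path 1 g \<Longrightarrow> (\<lambda>\<omega>. g (X \<omega>)) \<in> borel_measurable M"
  shows "X \<in> measurable M (borel_of_topology skorokhod)"
  unfolding borel_of_topology_def
proof (rule measurable_measure_of)
  show "{U. openin skorokhod U} \<subseteq> Pow (topspace skorokhod)"
    by (auto dest: openin_subset)
  show "X \<in> space M \<rightarrow> topspace skorokhod" using X by (simp add: topspace_skorokhod)
  fix U assume "U \<in> {U. openin skorokhod U}"
  then have U: "skorokhod_open U" by (simp add: openin_skorokhod)
  define A where "A = skorokhod_space - U"
  show "X -` U \<inter> space M \<in> sets M"
  proof (cases "A = {}")
    case True
    then have "X -` U \<inter> space M = space M" using X by (auto simp: A_def)
    then show ?thesis by simp
  next
    case False
    define g where "g x = (INF y\<in>A. 0 + 1 * path_dist x y)" for x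
    have "lipschitz_path 1 g"
      unfolding g_def[abs_def] by (rule lipschitz_path_INF[OF _ False, of _ 0]) auto
    then have [measurable]: "(\<lambda>\<omega>. g (X \<omega>)) \<in> borel_measurable M" by (rule g)
    have "x \<in> U \<longleftrightarrow> g x > 0" if x: "x \<in> skorokhod_space" for x
    proof
      assume "x \<in> U"
      from skorokhod_open_ball[OF U this] obtain d where d: "d > 0"
        "\<And>y. y \<in> skorokhod_space \<Longrightarrow> path_dist x y < d \<Longrightarrow> y \<in> U" by blast
      have "d \<le> g x"
        unfolding g_def by (rule cINF_greatest[OF False]) (use d(2) in \<open>force simp: A_def\<close>)
      then show "g x > 0" using d by simp
    next
      assume pos: "g x > 0"
      show "x \<in> U"
      proof (rule ccontr)
        assume "x \<notin> U"
        then have "x \<in> A" using x by (simp add: A_def)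
        moreover have "bdd_below ((\<lambda>y. 0 + 1 * path_dist x y) ` A)"
          by (rule bdd_belowI[of _ 0]) (auto simp: path_dist_nonneg)
        ultimately have "g x \<le> 0 + 1 * path_dist x x" unfolding g_def by (intro cINF_lower)
        then show False using pos by (simp add: path_dist_refl)
      qed
    qed
    then have "X -` U \<inter> space M = {\<omega> \<in> space M. g (X \<omega>) > 0}" using X by auto
    then show ?thesis by simp
  qed
qed

section \<open>Borel functionals and their Lipschitz approximation from below\<close>

lemma space_borel_of_topology: "space (borel_of_topology T) = topspace T"
  unfolding borel_of_topology_def by (rule space_measure_of) (auto dest: openin_subset)

lemma continuous_map_borel_measurable:
  assumes "continuous_map T euclideanreal f"
  shows "f \<in> borel_measurable (borel_of_topology T)"
proof (rule borel_measurableI)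
  fix S :: "real set" assume "open S"
  then have "openin T {x \<in> topspace T. f x \<in> S}"
    using openin_continuous_map_preimage[OF assms] by simp
  moreover have "f -` S \<inter> space (borel_of_topology T) = {x \<in> topspace T. f x \<in> S}"
    unfolding space_borel_of_topology by auto
  ultimately show "f -` S \<inter> space (borel_of_topology T) \<in> sets (borel_of_topology T)"
    unfolding borel_of_topology_def
    by (subst sets_measure_of) (auto dest: openin_subset intro: sigma_sets.Basic)
qed

text \<open>The Pasch-Hausdorff envelope: for bounded \<open>f\<close> and \<open>L \<ge> 0\<close>,
  the largest \<open>L\<close>-Lipschitz function that lies below \<open>f\<close> on the Skorokhod
  space.\<close>

definition lipschitz_envelope :: "((real \<Rightarrow> real) \<Rightarrow> real) \<Rightarrow> real \<Rightarrow> (real \<Rightarrow> real) \<Rightarrow> real" where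
  "lipschitz_envelope f L x = (INF y\<in>skorokhod_space. f y + L * path_dist x y)"

lemma skorokhod_space_nonempty: "skorokhod_space \<noteq> {}"
proof -
  have "(\<lambda>t\<in>{0..}. 0) \<in> skorokhod_space"
  proof -
    have 1: "((\<lambda>t\<in>{0..}. 0::real) \<longlongrightarrow> (\<lambda>t\<in>{0..}. 0) t) (at_right t)" if "t \<ge> 0" for t :: real
    proof (rule tendsto_eventually)
      show "\<forall>\<^sub>F s in at_right t. (\<lambda>t\<in>{0..}. 0::real) s = (\<lambda>t\<in>{0..}. 0) t"
        using that by (auto simp: eventually_at_right_field intro: exI[of _ "t + 1"])
    qed
    have 2: "((\<lambda>t\<in>{0..}. 0::real) \<longlongrightarrow> 0) (at_left t)" if "t > 0" for t :: real
    proof (rule tendsto_eventually)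
      show "\<forall>\<^sub>F s in at_left t. (\<lambda>t\<in>{0..}. 0::real) s = 0"
        using that by (auto simp: eventually_at_left_field intro: exI[of _ 0])
    qed
    show ?thesis unfolding skorokhod_space_def using 1 2 by auto
  qed
  then show ?thesis by blast
qed

context
  fixes f :: "(real \<Rightarrow> real) \<Rightarrow> real" and B :: real
  assumes f: "\<And>x. x \<in> skorokhod_space \<Longrightarrow> \<bar>f x\<bar> \<le> B"
begin

lemma lipschitz_envelope_lipschitz: "L \<ge> 0 \<Longrightarrow> lipschitz_path L (lipschitz_envelope f L)"
  unfolding lipschitz_envelope_def[abs_def]
  by (rule lipschitz_path_INF[OF _ skorokhod_space_nonempty, of _ "- B"]) (use f abs_le_D2 in
      force)+

lemma lipschitz_envelope_bdd: "L \<ge> 0 \<Longrightarrow> bdd_below ((\<lambda>y. f y + L * path_dist x y) ` skorokhod_space)"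
proof (rule bdd_belowI[of _ "- B"])
  fix z assume "L \<ge> 0" "z \<in> (\<lambda>y. f y + L * path_dist x y) ` skorokhod_space"
  then obtain y where y: "y \<in> skorokhod_space" "z = f y + L * path_dist x y" by auto
  have "0 \<le> L * path_dist x y" using \<open>L \<ge> 0\<close> path_dist_nonneg by simp
  then show "- B \<le> z" using f[OF y(1)] y(2) by linarith
qed

lemma lipschitz_envelope_le: "L \<ge> 0 \<Longrightarrow> x \<in> skorokhod_space \<Longrightarrow> lipschitz_envelope f L x \<le> f x"
  unfolding lipschitz_envelope_def
  using cINF_lower[OF lipschitz_envelope_bdd, of L x x] by (simp add: path_dist_refl)

lemma lipschitz_envelope_ge: "L \<ge> 0 \<Longrightarrow> - B \<le> lipschitz_envelope f L x"
  unfolding lipschitz_envelope_def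
proof (rule cINF_greatest[OF skorokhod_space_nonempty])
  fix y assume y: "L \<ge> 0" "y \<in> skorokhod_space"
  then have "0 \<le> L * path_dist x y" using path_dist_nonneg by simp
  then show "- B \<le> f y + L * path_dist x y" using f[OF y(2)] by linarith
qed

text \<open>The argument may lie outside the Skorokhod space, where \<open>f x\<close> gives no
  upper bound; instead, any fixed path \<open>y\<close> is at distance at most 1.\<close>

lemma lipschitz_envelope_bounded: "L \<ge> 0 \<Longrightarrow> \<bar>lipschitz_envelope f L x\<bar> \<le> B + L"
proof -
  assume L: "L \<ge> 0"
  obtain y where y: "y \<in> skorokhod_space" using skorokhod_space_nonempty by blast
  have "lipschitz_envelope f L x \<le> f y + L * path_dist x y"
    unfolding lipschitz_envelope_def by (rule cINF_lower[OF lipschitz_envelope_bdd[OF L] y])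
  also have "\<dots> \<le> B + L * 1"
    using f[OF y] L path_dist_le_1 by (intro add_mono mult_left_mono) auto
  finally show ?thesis using lipschitz_envelope_ge[OF L, of x] L by linarith
qed

text \<open>Paths within distance \<open>d\<close> of \<open>x\<close> have nearly the value
  \<open>f x\<close>; for the others the penalty \<open>n d\<close> exceeds \<open>2 B\<close>, the
  largest possible drop of \<open>f\<close>.\<close>

lemma lipschitz_envelope_tendsto:
  assumes c: "continuous_map skorokhod euclideanreal f" and x: "x \<in> skorokhod_space"
  shows "(\<lambda>n. lipschitz_envelope f (real n) x) \<longlonglongrightarrow> f x"
proof (rule LIMSEQ_I)
  fix r :: real assume r: "r > 0"
  obtain d where d: "d > 0" "\<And>y. y \<in> skorokhod_space \<Longrightarrow> path_dist x y < d \<Longrightarrow> \<bar>f y - f x\<bar> < r / 2"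
    using skorokhod_continuous_at[OF c x, of "r / 2"] r by auto
  obtain n0 where n0: "real n0 > 2 * B / d" using reals_Archimedean2 by blast
  show "\<exists>n0. \<forall>n\<ge>n0. norm (lipschitz_envelope f (real n) x - f x) < r"
  proof (intro exI allI impI)
    fix n assume n: "n \<ge> n0"
    have "f x - r / 2 \<le> lipschitz_envelope f (real n) x"
      unfolding lipschitz_envelope_def
    proof (rule cINF_greatest[OF skorokhod_space_nonempty])
      fix y assume y: "y \<in> skorokhod_space"
      have nd: "0 \<le> real n * path_dist x y" using path_dist_nonneg by simp
      show "f x - r / 2 \<le> f y + real n * path_dist x y"
      proof (cases "path_dist x y < d")
        case True
        then show ?thesis using d(2)[OF y] nd by (smt (verit))
      next
        case False
        have "2 * B < real n0 * d" using n0 d by (simp add: divide_less_eq)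
        also have "\<dots> \<le> real n * path_dist x y" using n False d by (intro mult_mono) auto
        finally show ?thesis using f[OF x] f[OF y] r by linarith
      qed
    qed
    moreover have "lipschitz_envelope f (real n) x \<le> f x"
        by (rule lipschitz_envelope_le[OF _ x]) simp
    ultimately show "norm (lipschitz_envelope f (real n) x - f x) < r" using r by simp
  qed
qed

end

text \<open>Covers the shifted descent paths, whose value at \<open>t\<close> is a function of
  \<open>\<lfloor>n t + n e\<rfloor>\<close>.\<close>

lemma floor_path_in_skorokhod_space:
  fixes h :: "int \<Rightarrow> real"
  assumes a: "a \<ge> 0"
  shows "(\<lambda>t\<in>{0..}. h \<lfloor>a * t + b\<rfloor>) \<in> skorokhod_space"
proof -
  let ?x = "\<lambda>t\<in>{0..}. h \<lfloor>a * t + b\<rfloor>"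
  have lim: "((\<lambda>s. a * s + b) \<longlongrightarrow> a * t + b) (at t within A)" for t :: real and A
    by (intro tendsto_intros)
  have "(?x \<longlongrightarrow> ?x t) (at_right t)" if t: "t \<ge> 0" for t
  proof (rule tendsto_eventually)
    have "\<forall>\<^sub>F s in at_right t. a * s + b < of_int \<lfloor>a * t + b\<rfloor> + 1"
      by (rule order_tendstoD[OF lim]) linarith
    moreover have "\<forall>\<^sub>F s in at_right t. t < s" by (simp add: eventually_at_filter)
    ultimately show "\<forall>\<^sub>F s in at_right t. ?x s = ?x t"
    proof eventually_elim
      case (elim s)
      have "a * t \<le> a * s" using a elim by (intro mult_left_mono) auto
      then have "\<lfloor>a * s + b\<rfloor> = \<lfloor>a * t + b\<rfloor>" using elim by (intro floor_unique) linarith+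
      then show ?case using elim t by simp
    qed
  qed
  moreover have "\<exists>l. (?x \<longlongrightarrow> l) (at_left t)" if t: "t > 0" for t
  proof -
    have pos: "\<forall>\<^sub>F s in at_left t. 0 < s" using t by (rule order_tendstoD[OF tendsto_ident_at])
    show ?thesis
    proof (cases "a = 0")
      \<comment> \<open>Occurs for the index \<open>n = 0\<close>; the path is then
        constant.\<close>
      case True
      have "(?x \<longlongrightarrow> h \<lfloor>b\<rfloor>) (at_left t)"
        by (rule tendsto_eventually, use pos in eventually_elim) (simp add: True)
      then show ?thesis by blast
    next
      case False
      \<comment> \<open>Just to the left of \<open>t\<close> the integer part is
        \<open>\<lceil>a t + b\<rceil> - 1\<close>, whether or not there is a jump at
        \<open>t\<close>.\<close>
      have "(?x \<longlongrightarrow> h (\<lceil>a * t + b\<rceil> - 1)) (at_left t)"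
      proof (rule tendsto_eventually)
        have "\<forall>\<^sub>F s in at_left t. of_int (\<lceil>a * t + b\<rceil> - 1) < a * s + b"
          by (rule order_tendstoD[OF lim]) linarith
        moreover have "\<forall>\<^sub>F s in at_left t. s < t" by (simp add: eventually_at_filter)
        ultimately show "\<forall>\<^sub>F s in at_left t. ?x s = h (\<lceil>a * t + b\<rceil> - 1)"
          using pos
        proof eventually_elim
          case (elim s)
          have "a * s < a * t" using a False elim by (intro mult_strict_left_mono) auto
          then have "\<lfloor>a * s + b\<rfloor> = \<lceil>a * t + b\<rceil> - 1" using elim by (intro floor_unique) linarith+
          then show ?case using elim by simp
        qed
      qed
      then show ?thesis by blast
    qed
  qed
  ultimately show ?thesis unfolding skorokhod_space_def by auto
qed

lemma continuous_in_skorokhod_space: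
  assumes "continuous_on {0..} x"
  shows "restrict x {0..} \<in> skorokhod_space"
proof -
  have "(restrict x {0..} \<longlongrightarrow> restrict x {0..} t) (at_right t)" if t: "t \<ge> 0" for t
  proof (rule Lim_transform_eventually)
    have "(x \<longlongrightarrow> x t) (at t within {0..})" using assms t by (simp add: continuous_on_def)
    then show "(x \<longlongrightarrow> restrict x {0..} t) (at_right t)"
      using t by (auto intro: tendsto_within_subset)
    show "\<forall>\<^sub>F s in at_right t. x s = restrict x {0..} s"
      using t by (auto simp: eventually_at_filter)
  qed
  moreover have "\<exists>l. (restrict x {0..} \<longlongrightarrow> l) (at_left t)" if t: "t > 0" for t
  proof
    show "(restrict x {0..} \<longlongrightarrow> x t) (at_left t)"
    proof (rule Lim_transform_eventually)
      have "(x \<longlongrightarrow> x t) (at t within {0..})" using assms t by (simp add: continuous_on_def)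
      then have "(x \<longlongrightarrow> x t) (at t within {0<..<t})"
        by (rule tendsto_within_subset) auto
      moreover have "at_left t = at t within {0<..<t}"
        by (rule at_within_nhd[of _ "{0<..}"]) (use t in auto)
      ultimately show "(x \<longlongrightarrow> x t) (at_left t)" by simp
      have "\<forall>\<^sub>F s in at_left t. 0 < s" using t by (rule order_tendstoD[OF tendsto_ident_at])
      then show "\<forall>\<^sub>F s in at_left t. x s = restrict x {0..} s"
        by eventually_elim auto
    qed
  qed
  ultimately show ?thesis unfolding skorokhod_space_def by auto
qed

text \<open>Mesh \<open>1 / k\<close> on \<open>[0, k]\<close>, constant afterwards.\<close>

definition step_path :: "nat \<Rightarrow> (nat \<Rightarrow> real) \<Rightarrow> real \<Rightarrow> real" where
  "step_path k v = (\<lambda>t\<in>{0..}. v (min (nat \<lfloor>real k * t\<rfloor>) (k * k)))"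

text \<open>The value at any time is one of the \<open>k * k + 1\<close> coordinates, so a Lipschitz
  functional of step paths is a Lipschitz function of finitely many numbers.\<close>

lemma path_dist_step_path:
    "path_dist (step_path k v) (step_path k w) \<le> (\<Sum>i<Suc (k * k). \<bar>v i - w i\<bar>)"
proof (rule path_dist_least)
  fix t :: real assume t: "t \<ge> 0"
  let ?i = "min (nat \<lfloor>real k * t\<rfloor>) (k * k)"
  have "min 1 \<bar>step_path k v t - step_path k w t\<bar> / (1 + t)
      \<le> min 1 \<bar>step_path k v t - step_path k w t\<bar> / 1"
    using t by (intro divide_left_mono) auto
  also have "\<dots> \<le> \<bar>v ?i - w ?i\<bar>" using t by (simp add: step_path_def)
  also have "\<dots> \<le> (\<Sum>i<Suc (k * k). \<bar>v i - w i\<bar>)"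
    by (rule member_le_sum[of _ "{..<Suc (k * k)}" "\<lambda>i. \<bar>v i - w i\<bar>"]) auto
  finally show "min 1 \<bar>step_path k v t - step_path k w t\<bar> / (1 + t) \<le> (\<Sum>i<Suc (k * k). \<bar>v i - w i\<bar>)"
      .
qed

definition on_grid :: "nat \<Rightarrow> (real \<Rightarrow> real) \<Rightarrow> nat \<Rightarrow> real" where
  "on_grid k x i = x (real i / real k)"

lemma step_path_on_grid:
  assumes "0 \<le> t" "t < real k"
  shows "step_path k (on_grid k x) t = x (real_of_int \<lfloor>real k * t\<rfloor> / real k)"
proof -
  have "nat \<lfloor>real k * t\<rfloor> \<le> k * k"
  proof -
    have "real k * t \<le> real k * real k" using assms by (intro mult_left_mono) auto
    then have "\<lfloor>real k * t\<rfloor> \<le> int (k * k)" by (simp add: floor_le_iff)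
    then show ?thesis by (simp only: nat_le_iff)
  qed
  moreover have "0 \<le> \<lfloor>real k * t\<rfloor>" using assms by simp
  ultimately show ?thesis
    using assms by (simp add: step_path_def on_grid_def min_absorb1)
qed

lemma grid_point:
  assumes "0 \<le> t" "k > 0"
  shows "real_of_int \<lfloor>real k * t\<rfloor> / real k \<in> {t - 1 / real k<..t}"
      "0 \<le> real_of_int \<lfloor>real k * t\<rfloor> / real k"
proof -
  have "real_of_int \<lfloor>real k * t\<rfloor> \<le> real k * t" "real k * t < real_of_int \<lfloor>real k * t\<rfloor> + 1"
      by linarith+
  then have "(real k * t - 1) / real k < real_of_int \<lfloor>real k * t\<rfloor> / real k"
    and "real_of_int \<lfloor>real k * t\<rfloor> / real k \<le> real k * t / real k"
    using assms by (simp_all only: divide_strict_right_mono divide_right_mono diff_less_eq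
        of_nat_0_less_iff of_nat_0_le_iff)
  moreover
  have "real k * t / real k = t" using assms by simp
  ultimately show "real_of_int \<lfloor>real k * t\<rfloor> / real k \<in> {t - 1 / real k<..t}"
    unfolding diff_divide_distrib by simp
  show "0 \<le> real_of_int \<lfloor>real k * t\<rfloor> / real k" using assms by simp
qed

text \<open>Uniform continuity on \<open>[0, T]\<close>: the left grid point is within
  \<open>1 / k\<close> of \<open>t\<close>. Continuity is essential, since at a jump off the grid
  the uniform error would not vanish.\<close>

lemma step_path_tendsto:
  assumes c: "continuous_on {0..} x"
  shows "(\<lambda>k. path_dist (step_path k (on_grid k x)) x) \<longlonglongrightarrow> 0"
proof (rule LIMSEQ_I)
  fix r :: real assume r: "r > 0"
  obtain T :: nat where T: "1 / (1 + real T) < r / 2"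
    using order_tendstoD(2)[OF tendsto_inverse_Suc_null, of "r / 2"] r
    by (auto simp: eventually_sequentially)
  have "uniformly_continuous_on {0..real T} x"
    by (rule compact_uniformly_continuous[OF continuous_on_subset[OF c]]) auto
  then obtain d where d: "d > 0" "\<And>s t. s \<in> {0..real T} \<Longrightarrow> t \<in> {0..real T} \<Longrightarrow> dist s t < d
      \<Longrightarrow> dist (x s) (x t) < r / 2"
    unfolding uniformly_continuous_on_def using r by (metis half_gt_zero)
  obtain k0 :: nat where k0: "real k0 > 1 / d" using reals_Archimedean2 by blast
  show "\<exists>k0. \<forall>k\<ge>k0. norm (path_dist (step_path k (on_grid k x)) x - 0) < r"
  proof (intro exI allI impI)
    fix k assume k: "k \<ge> max (Suc T) (max 1 k0)"
    have "real k0 \<le> real k" using k by simp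
    then have "1 / d < real k" using k0 by linarith
    then have kd: "1 / real k < d" using d k by (simp add: field_simps)
    have "path_dist (step_path k (on_grid k x)) x \<le> r / 2 + 1 / (1 + real T)"
    proof (rule path_dist_le)
      fix t assume t: "0 \<le> t" "t < real T"
      have "real T \<le> real k" using k by simp
      then have "t < real k" using t by linarith
      note g = grid_point[OF t(1), of k]
      have "dist (x (real_of_int \<lfloor>real k * t\<rfloor> / real k)) (x t) < r / 2"
        by (rule d(2)) (use g k t kd in \<open>auto simp: dist_real_def\<close>)
      then show "\<bar>step_path k (on_grid k x) t - x t\<bar> \<le> r / 2"
        using step_path_on_grid[OF t(1) \<open>t < real k\<close>, of x] by (simp add: dist_real_def)
    qed (use r in auto)
    then show "norm (path_dist (step_path k (on_grid k x)) x - 0) < r"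
      using T path_dist_nonneg[of "step_path k (on_grid k x)" x] by simp
  qed
qed

section \<open>Convergence in distribution to a continuous limit\<close>

text \<open>What the functional limit theorem asks of a concrete process: convergence of
  characteristic functions at grid times, second moments bounded locally in time, and control of the
  oscillation on arbitrarily fine grids, outside an event that may depend on \<open>n\<close>.
  Measurability is assumed of \<open>X\<close>, whose paths jump, but proved for \<open>Y\<close>,
  whose continuous paths are limits of their step functions.\<close>

locale skorokhod_convergence = M: prob_space M + N: prob_space N
  for M :: "'a measure" and N :: "'b measure" +
  fixes X :: "nat \<Rightarrow> 'a \<Rightarrow> real \<Rightarrow> real" and Y :: "'b \<Rightarrow> real \<Rightarrow> real"
  assumes X_measurable: "\<And>n. X n \<in> measurable M (borel_of_topology skorokhod)"
    and X_coordinate: "\<And>n t. t \<ge> 0 \<Longrightarrow> (\<lambda>\<omega>. X n \<omega> t) \<in> borel_measurable M"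
    and Y_path: "\<And>\<omega>. \<omega> \<in> space N \<Longrightarrow> Y \<omega> \<in> skorokhod_space"
    and Y_continuous: "\<And>\<omega>. \<omega> \<in> space N \<Longrightarrow> continuous_on {0..} (Y \<omega>)"
    and Y_coordinate: "\<And>t. t \<ge> 0 \<Longrightarrow> (\<lambda>\<omega>. Y \<omega> t) \<in> borel_measurable N"
    and char: "\<And>k m c. k > 0 \<Longrightarrow> (\<lambda>n. \<integral>\<omega>. iexp (\<Sum>i<m. c i * X n \<omega> (real i / real k)) \<partial>M)
        \<longlonglongrightarrow> (\<integral>\<omega>. iexp (\<Sum>i<m. c i * Y \<omega> (real i / real k)) \<partial>N)"
    and X_square: "\<And>n t. t \<ge> 0 \<Longrightarrow> integrable M (\<lambda>\<omega>. (X n \<omega> t)\<^sup>2)"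
      "\<And>T. \<exists>C. \<forall>n. \<forall>t\<in>{0..T}. (\<integral>\<omega>. (X n \<omega> t)\<^sup>2 \<partial>M) \<le> C"
    and Y_square: "\<And>t. t \<ge> 0 \<Longrightarrow> integrable N (\<lambda>\<omega>. (Y \<omega> t)\<^sup>2)"
      "\<And>T. \<exists>C. \<forall>t\<in>{0..T}. (\<integral>\<omega>. (Y \<omega> t)\<^sup>2 \<partial>N) \<le> C"
    and oscillation: "\<And>T e \<eta> k0. T > 0 \<Longrightarrow> e > 0 \<Longrightarrow> \<eta> > 0 \<Longrightarrow>
        \<exists>k\<ge>k0. \<exists>A. (\<forall>n. A n \<in> M.events) \<and> (\<forall>\<^sub>F n in sequentially. M.prob (A n) \<le> \<eta> \<and>
           (\<forall>\<omega>\<in>space M - A n. \<forall>t\<in>{0..<T}. \<bar>X n \<omega> t - X n \<omega> (real_of_int \<lfloor>real k * t\<rfloor> / real k)\<bar>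
               \<le> e))"
begin

lemma lipschitz_step_path:
  assumes g: "lipschitz_path L g" and "L \<ge> 0"
  shows "\<bar>g (step_path k v) - g (step_path k w)\<bar> \<le> L * (\<Sum>i<Suc (k * k). \<bar>v i - w i\<bar>)"
proof -
  have "\<bar>g (step_path k v) - g (step_path k w)\<bar> \<le> L * path_dist (step_path k v) (step_path k w)"
    using g by (simp add: lipschitz_path_def)
  also have "\<dots> \<le> L * (\<Sum>i<Suc (k * k). \<bar>v i - w i\<bar>)"
    using path_dist_step_path assms(2) by (intro mult_left_mono)
  finally show ?thesis .
qed

lemma grid_measurable:
  shows "(\<lambda>\<omega>. on_grid k (X n \<omega>) i) \<in> borel_measurable M"
    and "(\<lambda>\<omega>. on_grid k (Y \<omega>) i) \<in> borel_measurable N"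
  unfolding on_grid_def by (auto intro: X_coordinate Y_coordinate)

lemma lipschitz_Y_measurable:
  assumes g: "lipschitz_path L g" and L: "L \<ge> 0"
  shows "(\<lambda>\<omega>. g (Y \<omega>)) \<in> borel_measurable N"
proof (rule borel_measurable_LIMSEQ_real)
  fix k
  show "(\<lambda>\<omega>. g (step_path k (on_grid k (Y \<omega>)))) \<in> borel_measurable N"
    by (rule lipschitz_coordinates_measurable[OF lipschitz_step_path[OF g L]])
        (rule grid_measurable)
next
  fix \<omega> assume "\<omega> \<in> space N"
  then show "(\<lambda>k. g (step_path k (on_grid k (Y \<omega>)))) \<longlonglongrightarrow> g (Y \<omega>)"
    by (intro lipschitz_path_tendsto[OF g] step_path_tendsto Y_continuous)
qed

lemma Y_measurable: "Y \<in> measurable N (borel_of_topology skorokhod)"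
  by (rule measurable_skorokhod) (auto intro: Y_path lipschitz_Y_measurable)

lemma lipschitz_converges:
  assumes g: "lipschitz_path L g" and L: "L \<ge> 0" and B: "\<And>x. \<bar>g x\<bar> \<le> B" and k: "k > 0"
  shows "(\<lambda>n. \<integral>\<omega>. g (step_path k (on_grid k (X n \<omega>))) \<partial>M)
      \<longlonglongrightarrow> (\<integral>\<omega>. g (step_path k (on_grid k (Y \<omega>))) \<partial>N)"
proof -
  let ?T = "real (k * k)"
  have le: "real i / real k \<in> {0..?T}" if "i < Suc (k * k)" for i
  proof -
    have "real i \<le> ?T" using that by (simp only: of_nat_le_iff)
    moreover have "real i / real k \<le> real i / 1" using k by (intro divide_left_mono) auto
    ultimately show ?thesis by auto
  qed
  obtain C where C: "\<forall>n. \<forall>t\<in>{0..?T}. (\<integral>\<omega>. (X n \<omega> t)\<^sup>2 \<partial>M) \<le> C" using X_square(2) by blast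
  obtain C' where C': "\<forall>t\<in>{0..?T}. (\<integral>\<omega>. (Y \<omega> t)\<^sup>2 \<partial>N) \<le> C'" using Y_square(2) by blast
  show ?thesis
  proof (rule lipschitz_functional_converges[OF M.prob_space_axioms N.prob_space_axioms, where
      m="Suc (k * k)" and L=L and B=B and C="max C C'"
        and F="\<lambda>v. g (step_path k v)" and X="\<lambda>n \<omega>. on_grid k (X n \<omega>)" and Y="\<lambda>\<omega>. on_grid k (Y \<omega>)"])
    show "\<bar>g (step_path k x) - g (step_path k y)\<bar> \<le> L * (\<Sum>i<Suc (k * k). \<bar>x i - y i\<bar>)" for x y
      by (rule lipschitz_step_path[OF g L])
    show "(\<lambda>n. \<integral>\<omega>. iexp (\<Sum>i<Suc (k * k). c i * on_grid k (X n \<omega>) i) \<partial>M)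
        \<longlonglongrightarrow> (\<integral>\<omega>. iexp (\<Sum>i<Suc (k * k). c i * on_grid k (Y \<omega>) i) \<partial>N)" for c
      unfolding on_grid_def by (rule char[OF k])
    show "(\<integral>\<omega>. (on_grid k (X n \<omega>) i)\<^sup>2 \<partial>M) \<le> max C C'" if "i < Suc (k * k)" for n i
      using C le[OF that] unfolding on_grid_def le_max_iff_disj by blast
    show "(\<integral>\<omega>. (on_grid k (Y \<omega>) i)\<^sup>2 \<partial>N) \<le> max C C'" if "i < Suc (k * k)" for i
      using C' le[OF that] unfolding on_grid_def le_max_iff_disj by blast
  qed (auto intro: X_coordinate Y_coordinate B simp: on_grid_def X_square(1) Y_square(1))
qed

text \<open>Four losses of \<open>r / 4\<close>: from \<open>f\<close> to an envelope under the law
  of \<open>Y\<close>, from the path of \<open>Y\<close> to its step function, from \<open>Y\<close>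
  to \<open>X n\<close> on the grid, and from the step function of \<open>X n\<close> back to its
  path. There the envelope lies below \<open>f\<close>, which ends the chain.\<close>

lemma expectation_lower_bound:
  assumes f: "continuous_map skorokhod euclideanreal f" and B: "\<And>x. x \<in> skorokhod_space \<Longrightarrow> \<bar>f x\<bar> \<le> B"
      and r: "r > 0"
  shows "\<forall>\<^sub>F n in sequentially. (\<integral>\<omega>. f (Y \<omega>) \<partial>N) - r \<le> (\<integral>\<omega>. f (X n \<omega>) \<partial>M)"
proof -
  have X_path: "X n \<omega> \<in> skorokhod_space" if "\<omega> \<in> space M" for n \<omega>
    using measurable_space[OF X_measurable that]
        by (simp add: space_borel_of_topology topspace_skorokhod)
  have fY[measurable]: "(\<lambda>\<omega>. f (Y \<omega>)) \<in> borel_measurable N"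
    by (rule measurable_compose[OF Y_measurable continuous_map_borel_measurable[OF f]])
  have fX[measurable]: "(\<lambda>\<omega>. f (X n \<omega>)) \<in> borel_measurable M" for n
    by (rule measurable_compose[OF X_measurable continuous_map_borel_measurable[OF f]])
  let ?g = "\<lambda>l. lipschitz_envelope f (real l)"
  have lip: "lipschitz_path (real l) (?g l)" for l by (rule lipschitz_envelope_lipschitz[OF B]) auto
  have gB: "\<bar>?g l x\<bar> \<le> B + real l" for l x by (rule lipschitz_envelope_bounded[OF B]) auto
  have gY[measurable]: "(\<lambda>\<omega>. ?g l (Y \<omega>)) \<in> borel_measurable N" for l
    by (rule lipschitz_Y_measurable[OF lip]) simp
  have "(\<lambda>l. \<integral>\<omega>. ?g l (Y \<omega>) \<partial>N) \<longlonglongrightarrow> (\<integral>\<omega>. f (Y \<omega>) \<partial>N)"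
  proof (rule integral_dominated_convergence[where w="\<lambda>_. B"])
    show "AE \<omega> in N. (\<lambda>l. ?g l (Y \<omega>)) \<longlonglongrightarrow> f (Y \<omega>)"
      by (rule AE_I2) (rule lipschitz_envelope_tendsto[OF B f Y_path])
    show "AE \<omega> in N. norm (?g l (Y \<omega>)) \<le> B" for l
    proof (rule AE_I2)
      fix \<omega> assume w: "\<omega> \<in> space N"
      have "?g l (Y \<omega>) \<le> f (Y \<omega>)" by (rule lipschitz_envelope_le[OF B]) (use Y_path[OF w] in auto)
      moreover have "- B \<le> ?g l (Y \<omega>)" by (rule lipschitz_envelope_ge[OF B]) auto
      ultimately show "norm (?g l (Y \<omega>)) \<le> B" using B[OF Y_path[OF w]] by (simp add: abs_le_iff)
    qed
  qed auto
  then have "\<forall>\<^sub>F l in sequentially. (\<integral>\<omega>. f (Y \<omega>) \<partial>N) - r / 4 < (\<integral>\<omega>. ?g l (Y \<omega>) \<partial>N)"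
    by (rule order_tendstoD) (use r in simp)
  then obtain l where l: "(\<integral>\<omega>. f (Y \<omega>) \<partial>N) - r / 4 < (\<integral>\<omega>. ?g l (Y \<omega>) \<partial>N)"
    using eventually_happens trivial_limit_sequentially by blast
  \<comment> \<open>The three parts of \<open>3 * e\<close> are the oscillation inside
    \<open>[0, T)\<close>, the tail \<open>1 / (1 + T)\<close> of \<open>path_dist\<close> and the
    probability of the bad event; the Lipschitz constant \<open>l\<close> of the envelope multiplies
    them.\<close>
  define e where "e = r / (12 * (real l + 1))"
  have e: "e > 0" using r by (simp add: e_def)
  have le: "real l * (3 * e) \<le> r / 4"
  proof -
    have "real l * (3 * (r / (12 * q))) = (real l / q) * (r / 4)" if "q > 0" for q
      using that by (simp add: field_simps)
    from this[of "real l + 1"] have "real l * (3 * e) = (real l / (real l + 1)) * (r / 4)"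
      by (simp add: e_def)
    also have "\<dots> \<le> 1 * (r / 4)" using r by (intro mult_right_mono) auto
    finally show ?thesis by simp
  qed
  obtain T :: nat where T: "1 / (1 + real T) < e" "T > 0"
  proof -
    have "\<forall>\<^sub>F T in sequentially. 1 / (1 + real T) < e \<and> T > 0"
      using order_tendstoD(2)[OF tendsto_inverse_Suc_null e] eventually_gt_at_top[of 0]
      by (rule eventually_conj)
    then show ?thesis using that eventually_happens trivial_limit_sequentially by blast
  qed
  let ?h = "\<lambda>k x. ?g l (step_path k (on_grid k x))"
  have hY[measurable]: "(\<lambda>\<omega>. ?h k (Y \<omega>)) \<in> borel_measurable N" for k
    by (rule lipschitz_coordinates_measurable[OF lipschitz_step_path[OF lip]])
        (auto intro: grid_measurable)
  have hX[measurable]: "(\<lambda>\<omega>. ?h k (X n \<omega>)) \<in> borel_measurable M" for k n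
    by (rule lipschitz_coordinates_measurable[OF lipschitz_step_path[OF lip]])
        (auto intro: grid_measurable)
  have "(\<lambda>k. \<integral>\<omega>. ?h k (Y \<omega>) \<partial>N) \<longlonglongrightarrow> (\<integral>\<omega>. ?g l (Y \<omega>) \<partial>N)"
  proof (rule integral_dominated_convergence[where w="\<lambda>_. B + real l"])
    show "AE \<omega> in N. (\<lambda>k. ?h k (Y \<omega>)) \<longlonglongrightarrow> ?g l (Y \<omega>)"
      by (rule AE_I2) (intro lipschitz_path_tendsto[OF lip] step_path_tendsto Y_continuous)
  qed (use gB in auto)
  then have "\<forall>\<^sub>F k in sequentially. (\<integral>\<omega>. ?g l (Y \<omega>) \<partial>N) - r / 4 < (\<integral>\<omega>. ?h k (Y \<omega>) \<partial>N)"
    by (rule order_tendstoD) (use r in simp)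
  then obtain k0 where k0: "\<And>k. k \<ge> k0 \<Longrightarrow> (\<integral>\<omega>. ?g l (Y \<omega>) \<partial>N) - r / 4 < (\<integral>\<omega>. ?h k (Y \<omega>) \<partial>N)"
    by (auto simp: eventually_sequentially)
  \<comment> \<open>The grid is chosen once, fine enough for \<open>Y\<close> and for the
    oscillation of \<open>X\<close>, and with \<open>k \<ge> T\<close> because step paths are frozen
    after time \<open>k\<close>; only then does \<open>n\<close> tend to infinity.\<close>
  obtain k A where k: "k \<ge> max k0 T" and A: "\<And>n. A n \<in> M.events"
    and A': "\<forall>\<^sub>F n in sequentially. M.prob (A n) \<le> e \<and>
           (\<forall>\<omega>\<in>space M - A n. \<forall>t\<in>{0..<real T}. \<bar>X n \<omega> t - X n \<omega> (real_of_int \<lfloor>real k * t\<rfloor> / real k)\<bar>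
               \<le> e)"
    using oscillation[of "real T" e e "max k0 T"] T(2) e by auto
  have "(\<lambda>n. \<integral>\<omega>. ?h k (X n \<omega>) \<partial>M) \<longlonglongrightarrow> (\<integral>\<omega>. ?h k (Y \<omega>) \<partial>N)"
    by (rule lipschitz_converges[OF lip _ gB]) (use k T(2) in auto)
  then have "\<forall>\<^sub>F n in sequentially. (\<integral>\<omega>. ?h k (Y \<omega>) \<partial>N) - r / 4 < (\<integral>\<omega>. ?h k (X n \<omega>) \<partial>M)"
    by (rule order_tendstoD) (use r in simp)
  then show ?thesis
    using A'
  proof eventually_elim
    case (elim n)
    have "(\<integral>\<omega>. ?h k (X n \<omega>) \<partial>M) - real l * (3 * e)
       \<le> (\<integral>\<omega>. ?h k (X n \<omega>) \<partial>M) - real l * (2 * e + M.prob (A n))"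
      using elim by (intro diff_left_mono mult_left_mono) auto
    also have "\<dots> = (\<integral>\<omega>. ?h k (X n \<omega>) - real l * (2 * e + indicator (A n) \<omega>) \<partial>M)"
    proof -
      have "integrable M (\<lambda>\<omega>. ?h k (X n \<omega>))"
        by (rule M.integrable_const_bound[of _ "B + real l"]) (use gB in auto)
      moreover have "integrable M (\<lambda>\<omega>. indicator (A n) \<omega> :: real)"
        using A[of n] by (intro M.integrable_const_bound[of _ 1]) (auto simp: indicator_def)
      ultimately show ?thesis using A[of n] by (simp add: M.prob_space)
    qed
    also have "\<dots> \<le> (\<integral>\<omega>. f (X n \<omega>) \<partial>M)"
    proof (rule integral_mono)
      show "integrable M (\<lambda>\<omega>. f (X n \<omega>))"
        by (rule M.integrable_const_bound[of _ B]) (use B X_path in auto)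
      have "integrable M (\<lambda>\<omega>. ?h k (X n \<omega>))"
        by (rule M.integrable_const_bound[of _ "B + real l"]) (use gB in auto)
      moreover have "integrable M (\<lambda>\<omega>. indicator (A n) \<omega> :: real)"
        using A[of n] by (intro M.integrable_const_bound[of _ 1]) (auto simp: indicator_def)
      ultimately show "integrable M (\<lambda>\<omega>. ?h k (X n \<omega>) - real l * (2 * e + indicator (A n) \<omega>))"
          by simp
      fix \<omega> assume w: "\<omega> \<in> space M"
      let ?d = "path_dist (step_path k (on_grid k (X n \<omega>))) (X n \<omega>)"
      \<comment> \<open>On the bad event the indicator pays for the trivial bound 1 on the
        distance.\<close>
      have d: "?d \<le> 2 * e + indicator (A n) \<omega>"
      proof (cases "\<omega> \<in> A n")
        case True
        then show ?thesis using path_dist_le_1[of "step_path k (on_grid k (X n \<omega>))" "X n \<omega>"] e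
            by simp
      next
        case False
        have "?d \<le> e + 1 / (1 + real T)"
        proof (rule path_dist_le)
          fix t assume t: "0 \<le> t" "t < real T"
          have "real T \<le> real k" using k by simp
          then have tk: "t < real k" using t by linarith
          show "\<bar>step_path k (on_grid k (X n \<omega>)) t - X n \<omega> t\<bar> \<le> e"
            unfolding step_path_on_grid[OF t(1) tk] using elim(2) False w t
            by (subst abs_minus_commute) auto
        qed (use e in auto)
        then show ?thesis using T False by simp
      qed
      have "?h k (X n \<omega>) - ?g l (X n \<omega>) \<le> real l * ?d"
        using lip[of l] unfolding lipschitz_path_def by (meson abs_le_D1)
      also have "\<dots> \<le> real l * (2 * e + indicator (A n) \<omega>)" using d by (intro mult_left_mono) auto
      finally have "?h k (X n \<omega>) - real l * (2 * e + indicator (A n) \<omega>) \<le> ?g l (X n \<omega>)" by simp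
      also have "\<dots> \<le> f (X n \<omega>)" by (rule lipschitz_envelope_le[OF B]) (use X_path[OF w] in auto)
      finally show "?h k (X n \<omega>) - real l * (2 * e + indicator (A n) \<omega>) \<le> f (X n \<omega>)" .
    qed
    finally show ?case using elim(1) l k0[of k] k le by simp
  qed
qed

theorem converges_in_distribution: "converges_in_distribution skorokhod M X N Y"
  unfolding converges_in_distribution_def
proof (intro conjI allI impI)
  show "X n \<in> measurable M (borel_of_topology skorokhod)" for n by (rule X_measurable)
  show "Y \<in> measurable N (borel_of_topology skorokhod)" by (rule Y_measurable)
  fix f :: "(real \<Rightarrow> real) \<Rightarrow> real"
  assume f: "continuous_map skorokhod euclideanreal f \<and> bounded (f ` topspace skorokhod)"
  then obtain B where B: "\<And>x. x \<in> skorokhod_space \<Longrightarrow> \<bar>f x\<bar> \<le> B"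
    unfolding bounded_iff topspace_skorokhod by auto
  have f1: "continuous_map skorokhod euclideanreal f" using f by blast
  then have f2: "continuous_map skorokhod euclideanreal (\<lambda>x. - f x)" by (intro continuous_intros)
  have B2: "\<And>x. x \<in> skorokhod_space \<Longrightarrow> \<bar>- f x\<bar> \<le> B" using B by simp
  show "(\<lambda>n. \<integral>\<omega>. f (X n \<omega>) \<partial>M) \<longlonglongrightarrow> (\<integral>\<omega>. f (Y \<omega>) \<partial>N)"
  proof (rule tendstoI)
    fix r :: real assume r: "r > 0"
    then have r2: "r / 2 > 0" by simp
    show "\<forall>\<^sub>F n in sequentially. dist (\<integral>\<omega>. f (X n \<omega>) \<partial>M) (\<integral>\<omega>. f (Y \<omega>) \<partial>N) < r"
    proof -
      have "\<forall>\<^sub>F n in sequentially. (\<integral>\<omega>. f (Y \<omega>) \<partial>N) - r / 2 \<le> (\<integral>\<omega>. f (X n \<omega>) \<partial>M)"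
        by (rule expectation_lower_bound[OF f1 _ r2]) (rule B)
      moreover have "\<forall>\<^sub>F n in sequentially. (\<integral>\<omega>. - f (Y \<omega>) \<partial>N) - r / 2 \<le> (\<integral>\<omega>. - f (X n \<omega>) \<partial>M)"
        by (rule expectation_lower_bound[OF f2 _ r2]) (rule B2)
      ultimately show ?thesis
        by eventually_elim (use r in \<open>auto simp: dist_real_def abs_less_iff\<close>)
    qed
  qed
qed

end

section \<open>Gaussian variables and the covariance of the Brownian bridge\<close>

text \<open>Uniqueness of the characteristic function identifies the law. The case
  \<open>v = 0\<close> is separate, since the law is then a Dirac measure without density.\<close>

lemma gaussian_variable_char:
  fixes X :: "'a \<Rightarrow> real"
  assumes M: "prob_space M" and X[measurable]: "X \<in> borel_measurable M" and v: "v \<ge> 0"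
    and char: "\<And>u. (\<integral>\<omega>. iexp (u * X \<omega>) \<partial>M) = exp (- (u\<^sup>2 * v / 2))"
  shows "gaussian_variable M X" "integrable M X" "(\<integral>\<omega>. X \<omega> \<partial>M) = 0"
    "integrable M (\<lambda>\<omega>. (X \<omega>)\<^sup>2)" "(\<integral>\<omega>. (X \<omega>)\<^sup>2 \<partial>M) = v"
    "v > 0 \<Longrightarrow> distributed M lborel X (normal_density 0 (sqrt v))"
proof -
  interpret prob_space M by fact
  have charX: "char (distr M borel (\<lambda>\<omega>. X \<omega> / s)) u = exp (- ((u / s)\<^sup>2 * v / 2))" for u s
    unfolding char_def using char[of "u / s"] by (subst integral_distr) auto
  have rd: "real_distribution (distr M borel (\<lambda>\<omega>. X \<omega> / s))" for s
    by (rule real_distribution_distr) auto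
  have D: "distributed M lborel X (normal_density 0 (sqrt v))" if v0: "v > 0"
  proof -
    have "char (distr M borel (\<lambda>\<omega>. X \<omega> / sqrt v)) = char std_normal_distribution"
      unfolding char_std_normal_distribution charX[abs_def] using v0
      by (auto simp: power_divide)
    then have "distr M borel (\<lambda>\<omega>. X \<omega> / sqrt v) = std_normal_distribution"
      using rd real_dist_normal_dist by (rule Levy_uniqueness[rotated 2])
    then have "distr M lborel (\<lambda>\<omega>. (X \<omega> - 0) / sqrt v) = density lborel std_normal_density"
      by (subst distr_cong[of M M lborel borel "\<lambda>\<omega>. (X \<omega> - 0) / sqrt v" "\<lambda>\<omega>. X \<omega> / sqrt v"]) auto
    then have "distributed M lborel (\<lambda>\<omega>. (X \<omega> - 0) / sqrt v) std_normal_density"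
      unfolding distributed_def by auto
    then show ?thesis
      using v0 by (subst normal_standard_normal_convert) auto
  qed
  then show "v > 0 \<Longrightarrow> distributed M lborel X (normal_density 0 (sqrt v))" .
  have Z: "AE \<omega> in M. X \<omega> = 0" if v0: "v = 0"
  proof -
    have "char (distr M borel X) = char (return borel 0)"
      using charX[of 1] unfolding v0 by (auto simp: char_def integral_return fun_eq_iff)
    then have "distr M borel X = return borel (0::real)"
    proof (rule Levy_uniqueness[rotated 2])
      show "real_distribution (distr M borel X)" by (rule real_distribution_distr) simp
      show "real_distribution (return borel (0::real))"
        by (auto simp: real_distribution_def real_distribution_axioms_def intro: prob_space_return)
    qed
    moreover have "AE x in return borel (0::real). x = 0" by (subst AE_return) auto
    ultimately have "AE x in distr M borel X. x = 0" by (simp only:)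
    then show ?thesis by (rule AE_distrD[OF X])
  qed
  have all: "gaussian_variable M X \<and> integrable M X \<and> (\<integral>\<omega>. X \<omega> \<partial>M) = 0 \<and>
    integrable M (\<lambda>\<omega>. (X \<omega>)\<^sup>2) \<and> (\<integral>\<omega>. (X \<omega>)\<^sup>2 \<partial>M) = v"
  proof (cases "v = 0")
    case True
    have e1: "AE \<omega> in M. X \<omega> = 0" by (rule Z[OF True])
    then have e2: "AE \<omega> in M. (X \<omega>)\<^sup>2 = 0" by eventually_elim simp
    have "gaussian_variable M X" unfolding gaussian_variable_def using e1 by auto
    moreover have "integrable M X" using e1 by (subst integrable_cong_AE[where g="\<lambda>_. 0"]) auto
    moreover have "integrable M (\<lambda>\<omega>. (X \<omega>)\<^sup>2)" using e2
        by (subst integrable_cong_AE[where g="\<lambda>_. 0"]) auto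
    moreover have "(\<integral>\<omega>. X \<omega> \<partial>M) = 0" using e1 by (subst integral_cong_AE[where g="\<lambda>_. 0"]) auto
    moreover have "(\<integral>\<omega>. (X \<omega>)\<^sup>2 \<partial>M) = 0" using e2 by (subst integral_cong_AE[where g="\<lambda>_. 0"]) auto
    ultimately show ?thesis using True by blast
  next
    case False
    then have v0: "v > 0" "sqrt v > 0" using v by auto
    note dist = D[OF v0(1)]
    have "gaussian_variable M X" unfolding gaussian_variable_def using dist v0 X by blast
    moreover have i: "integrable M (\<lambda>\<omega>. (X \<omega>) ^ k)" for k
      using distributed_integrable[OF dist, of "\<lambda>x. x ^ k"]
          integrable_normal_moment[OF v0(2), of 0 k] by simp
    moreover have "integrable M X" using i[of 1] by simp
    moreover have e: "expectation X = 0" by (rule normal_distributed_expectation[OF v0(2) dist])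
    moreover have "(\<integral>\<omega>. (X \<omega>)\<^sup>2 \<partial>M) = v"
      using normal_distributed_variance[OF v0(2) dist] v0 e by simp
    ultimately show ?thesis by blast
  qed
  then show "gaussian_variable M X" "integrable M X" "(\<integral>\<omega>. X \<omega> \<partial>M) = 0"
    "integrable M (\<lambda>\<omega>. (X \<omega>)\<^sup>2)" "(\<integral>\<omega>. (X \<omega>)\<^sup>2 \<partial>M) = v" by blast+
qed

text \<open>Independent standard normal coordinates. The index type makes this a measure on
  \<open>real \<Rightarrow> real\<close>; the coordinates that enter the series are those at the
  countably many indices \<open>schauder_index p\<close>.\<close>

definition gauss_space :: "(real \<Rightarrow> real) measure" where
  "gauss_space = PiM UNIV (\<lambda>_. std_normal_distribution)"

interpretation std_normal: prob_space std_normal_distribution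
  by (rule prob_space_normal_density) simp

interpretation gauss: product_prob_space "\<lambda>_::real. std_normal_distribution" UNIV
  by unfold_locales

lemma prob_space_gauss_space: "prob_space gauss_space"
  unfolding gauss_space_def by (rule prob_space_PiM) (rule std_normal.prob_space_axioms)

interpretation gs: prob_space gauss_space
  by (rule prob_space_gauss_space)

lemma gauss_coordinate_measurable [measurable]: "(\<lambda>\<omega>. \<omega> i) \<in> borel_measurable gauss_space"
proof -
  have "(\<lambda>\<omega>. \<omega> i) \<in> measurable gauss_space std_normal_distribution"
    unfolding gauss_space_def by (rule measurable_component_singleton) simp
  then show ?thesis by simp
qed

lemma gauss_coordinate_distr: "distr gauss_space borel (\<lambda>\<omega>. \<omega> i) = std_normal_distribution"
proof -
  have "distr gauss_space borel (\<lambda>\<omega>. \<omega> i) = distr gauss_space std_normal_distribution (\<lambda>\<omega>. \<omega> i)"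
    by (rule distr_cong) auto
  also have "\<dots> = std_normal_distribution"
    unfolding gauss_space_def
        by (rule distr_PiM_component) (auto intro: std_normal.prob_space_axioms)
  finally show ?thesis .
qed

lemma gauss_coordinates_indep:
  assumes "finite J"
  shows "gs.indep_vars (\<lambda>_. borel) (\<lambda>i \<omega>. \<omega> i) J"
proof (cases "J = {}")
  case True
  then show ?thesis unfolding gs.indep_vars_def2 by (simp add: gs.indep_sets_def)
next
  case False
  have "distr gauss_space (PiM J (\<lambda>_. borel)) (\<lambda>\<omega>. \<lambda>i\<in>J. \<omega> i)
     = distr gauss_space (PiM J (\<lambda>_. std_normal_distribution)) (\<lambda>\<omega>. restrict \<omega> J)"
    by (rule distr_cong) (auto intro!: sets_PiM_cong)
  also have "\<dots> = PiM J (\<lambda>_. std_normal_distribution)"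
    unfolding gauss_space_def by (rule gauss.distr_PiM_restrict_finite) (use assms in auto)
  finally show ?thesis
    by (subst gs.indep_vars_iff_distr_eq_PiM[OF False]) (auto simp: gauss_coordinate_distr)
qed

lemma gauss_linear_char:
  assumes J: "finite J" and inj: "inj_on \<iota> J"
  shows "(\<integral>\<omega>. iexp (\<Sum>p\<in>J. a p * \<omega> (\<iota> p)) \<partial>gauss_space) = exp (- ((\<Sum>p\<in>J. (a p)\<^sup>2) / 2))"
proof -
  define b where "b i = a (the_inv_into J \<iota> i)" for i
  have b: "b (\<iota> p) = a p" if "p \<in> J" for p using the_inv_into_f_f[OF inj that] by (simp add: b_def)
  have sum: "(\<Sum>p\<in>J. a p * \<omega> (\<iota> p)) = (\<Sum>i\<in>\<iota> ` J. b i * \<omega> i)" for \<omega> :: "real \<Rightarrow> real"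
    using inj b by (subst sum.reindex) auto
  have sum2: "(\<Sum>p\<in>J. (a p)\<^sup>2) = (\<Sum>i\<in>\<iota> ` J. (b i)\<^sup>2)"
    using inj b by (subst sum.reindex) auto
  have "gs.indep_vars (\<lambda>_. borel) (\<lambda>i \<omega>. b i * \<omega> i) (\<iota> ` J)"
    by (rule gs.indep_vars_compose2[OF gauss_coordinates_indep]) (use J in auto)
  from gs.char_distr_sum[OF this, of 1]
  have "(\<integral>\<omega>. iexp (\<Sum>i\<in>\<iota> ` J. b i * \<omega> i) \<partial>gauss_space)
      = (\<Prod>i\<in>\<iota> ` J. char (distr gauss_space borel (\<lambda>\<omega>. b i * \<omega> i)) 1)"
    unfolding char_def by (subst (asm) integral_distr) (auto simp del: of_real_sum)
  also have "\<dots> = (\<Prod>i\<in>\<iota> ` J. complex_of_real (exp (- ((b i)\<^sup>2) / 2)))"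
  proof (rule prod.cong[OF refl])
    fix i
    have "char (distr gauss_space borel (\<lambda>\<omega>. b i * \<omega> i)) 1 = (\<integral>\<omega>. iexp (b i * \<omega> i) \<partial>gauss_space)"
      unfolding char_def by (subst integral_distr) auto
    also have "\<dots> = (\<integral>x. iexp (b i * x) \<partial>distr gauss_space borel (\<lambda>\<omega>. \<omega> i))"
      by (subst integral_distr) auto
    also have "\<dots> = char std_normal_distribution (b i)"
      unfolding gauss_coordinate_distr char_def ..
    finally show "char (distr gauss_space borel (\<lambda>\<omega>. b i * \<omega> i)) 1
        = complex_of_real (exp (- ((b i)\<^sup>2) / 2))"
      unfolding char_std_normal_distribution .
  qed
  also have "\<dots> = complex_of_real (exp (\<Sum>i\<in>\<iota> ` J. - ((b i)\<^sup>2) / 2))"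
    using J by (simp add: exp_sum)
  finally show ?thesis unfolding sum sum2 by (simp add: sum_negf sum_divide_distrib)
qed

lemma gauss_fourth_moment:
  "integrable gauss_space (\<lambda>\<omega>. (\<omega> i) ^ 4)" "(\<integral>\<omega>. (\<omega> i) ^ 4 \<partial>gauss_space) = 3"
proof -
  have "integrable (distr gauss_space borel (\<lambda>\<omega>. \<omega> i)) (\<lambda>x. x ^ 4)"
    unfolding gauss_coordinate_distr by (rule integrable_std_normal_distribution_moment)
  then show "integrable gauss_space (\<lambda>\<omega>. (\<omega> i) ^ 4)" by (subst (asm) integrable_distr_eq) auto
  have "(\<integral>\<omega>. (\<omega> i) ^ 4 \<partial>gauss_space) = (\<integral>x. x ^ 4 \<partial>distr gauss_space borel (\<lambda>\<omega>. \<omega> i))"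
    by (subst integral_distr) auto
  also have "\<dots> = 3"
    unfolding gauss_coordinate_distr using std_normal_distribution_even_moments(1)[of 2]
        by (simp add: fact_numeral)
  finally show "(\<integral>\<omega>. (\<omega> i) ^ 4 \<partial>gauss_space) = 3" .
qed

section \<open>The Schauder system and the expansion of the bridge covariance\<close>

definition hat :: "real \<Rightarrow> real" where
  "hat x = max 0 (1 - \<bar>2 * x - 1\<bar>)"

lemma hat_bounds: "0 \<le> hat x" "hat x \<le> 1"
  by (auto simp: hat_def)

text \<open>Integer translates of the tent do not overlap: only the translate at the integer part of
  \<open>x\<close> can be nonzero.\<close>

lemma hat_le_floor: "hat (x - real k) \<le> of_bool (int k = \<lfloor>x\<rfloor>)"
proof (cases "int k = \<lfloor>x\<rfloor>")
  case False
  then have "x - real k < 0 \<or> x - real k \<ge> 1"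
    by linarith
  then show ?thesis by (auto simp: hat_def)
qed (simp add: hat_bounds)

lemma sum_hat_le_1: "(\<Sum>k<n. hat (x - real k)) \<le> 1"
proof -
  have "(\<Sum>k<n. hat (x - real k)) \<le> (\<Sum>k<n. of_bool (int k = \<lfloor>x\<rfloor>))"
    by (intro sum_mono hat_le_floor)
  also have "\<dots> \<le> (\<Sum>k<n. of_bool (k = nat \<lfloor>x\<rfloor>))"
    by (intro sum_mono) auto
  also have "\<dots> \<le> 1" by (simp add: of_bool_def)
  finally show ?thesis .
qed

text \<open>Extended by zero, the covariance satisfies the two-scale relation below for all arguments, boundary
cases included.\<close>

definition bridge_cov :: "real \<Rightarrow> real \<Rightarrow> real" where
  "bridge_cov s t = (if s \<in> {0..1} \<and> t \<in> {0..1} then min s t - s * t else 0)"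

text \<open>Levy's midpoint construction in terms of covariances: the value at \<open>1 / 2\<close>
  has variance \<open>1 / 4\<close> and is interpolated by the tent, and the deviations on the two
  halves are independent bridges run at double speed with the variance halved.\<close>

lemma bridge_cov_step:
  "bridge_cov s t = hat s * hat t / 4
      + (bridge_cov (2 * s) (2 * t) + bridge_cov (2 * s - 1) (2 * t - 1)) / 2"
proof -
  consider "s < 0 \<or> t < 0 \<or> s > 1 \<or> t > 1" | "s \<in> {0..1/2}" "t \<in> {0..1/2}" | "s \<in> {0..1/2}"
      "t \<in> {1/2<..1}"
    | "t \<in> {0..1/2}" "s \<in> {1/2<..1}" | "s \<in> {1/2<..1}" "t \<in> {1/2<..1}" by force
  then show ?thesis
  proof cases
    case 1
    then have "hat s = 0 \<or> hat t = 0" by (simp add: hat_def) linarith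
    moreover have "bridge_cov s t = 0" "bridge_cov (2 * s) (2 * t) = 0"
        "bridge_cov (2 * s - 1) (2 * t - 1) = 0"
      using 1 unfolding bridge_cov_def
          by (simp_all only: atLeastAtMost_iff split: if_split) linarith+
    ultimately show ?thesis by auto
  next
    case 2
    then have "hat s = 2 * s" "hat t = 2 * t" "bridge_cov (2 * s - 1) (2 * t - 1) = 0"
      "bridge_cov (2 * s) (2 * t) = 2 * min s t - 4 * (s * t)" "bridge_cov s t = min s t - s * t"
      by (auto simp: bridge_cov_def hat_def min_def)
    then show ?thesis by (simp add: diff_divide_distrib)
  next
    case 3
    then have "hat s = 2 * s" "hat t = 2 - 2 * t" "bridge_cov (2 * s) (2 * t) = 0"
      "bridge_cov (2 * s - 1) (2 * t - 1) = 0" "bridge_cov s t = s - s * t"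
      by (auto simp: bridge_cov_def hat_def min_def)
    then show ?thesis by (simp add: right_diff_distrib)
  next
    case 4
    then have "hat t = 2 * t" "hat s = 2 - 2 * s" "bridge_cov (2 * s) (2 * t) = 0"
      "bridge_cov (2 * s - 1) (2 * t - 1) = 0" "bridge_cov s t = t - s * t"
      by (auto simp: bridge_cov_def hat_def min_def)
    then show ?thesis by (simp add: left_diff_distrib)
  next
    case 5
    then have "hat s = 2 - 2 * s" "hat t = 2 - 2 * t" "bridge_cov (2 * s) (2 * t) = 0"
      "bridge_cov (2 * s - 1) (2 * t - 1) = 2 * min s t - 1 - (2 * s - 1) * (2 * t - 1)"
      "bridge_cov s t = min s t - s * t"
      by (auto simp: bridge_cov_def hat_def min_def)
    then show ?thesis by (simp add: left_diff_distrib right_diff_distrib diff_divide_distrib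
        add_divide_distrib)
  qed
qed

lemma bridge_cov_nonneg: "0 \<le> bridge_cov s t"
  by (auto simp: bridge_cov_def min_def mult_left_le mult_left_le_one_le)

lemma bridge_cov_le_hat: "bridge_cov s t \<le> hat s"
proof (cases "s \<in> {0..1} \<and> t \<in> {0..1}")
  case True
  then have 1: "bridge_cov s t \<le> s" "bridge_cov s t \<le> 1 - s"
  proof -
    have "0 \<le> s * t" using True by simp
    moreover have "bridge_cov s t \<le> s - s * t" using True by (simp add: bridge_cov_def)
    ultimately show "bridge_cov s t \<le> s" by linarith
    have "(1 - s) * t \<le> (1 - s) * 1" using True by (intro mult_left_mono) auto
    moreover have "bridge_cov s t \<le> t - s * t" using True by (auto simp: bridge_cov_def)
    ultimately show "bridge_cov s t \<le> 1 - s" by (simp add: algebra_simps)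
  qed
  have "min s (1 - s) \<le> hat s" using True by (auto simp: hat_def)
  then show ?thesis using 1 by auto
qed (auto simp: bridge_cov_def hat_bounds)

lemma sum_even_odd: "(\<Sum>k<n. f (2 * k) + f (2 * k + 1)) = (\<Sum>k<2 * n. f k :: real)" for n :: nat
  by (induction n) (auto simp: algebra_simps)

text \<open>The two-scale relation iterated \<open>m\<close> times; the cell \<open>k\<close> of one
  level splits into the cells \<open>2 k\<close> and \<open>2 k + 1\<close> of the next.\<close>

lemma bridge_cov_expansion:
  "bridge_cov s t = (\<Sum>n<m. \<Sum>k<2 ^ n. (1/2) ^ n / 4
      * (hat (2 ^ n * s - real k) * hat (2 ^ n * t - real k)))
     + (1/2) ^ m * (\<Sum>k<2 ^ m. bridge_cov (2 ^ m * s - real k) (2 ^ m * t - real k))"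
proof (induction m)
  case (Suc m)
  let ?f = "\<lambda>k. bridge_cov (2 ^ Suc m * s - real k) (2 ^ Suc m * t - real k)"
  let ?h = "\<lambda>k. hat (2 ^ m * s - real k) * hat (2 ^ m * t - real k)"
  have "(\<Sum>k<2 ^ m. bridge_cov (2 ^ m * s - real k) (2 ^ m * t - real k))
     = (\<Sum>k<2 ^ m. ?h k / 4 + (?f (2 * k) + ?f (2 * k + 1)) / 2)"
    by (intro sum.cong refl, subst bridge_cov_step) (simp add: algebra_simps)
  also have "\<dots> = (\<Sum>k<2 ^ m. ?h k) / 4 + (\<Sum>k<2 ^ m. ?f (2 * k) + ?f (2 * k + 1)) / 2"
    unfolding sum_divide_distrib by (rule sum.distrib)
  also have "(\<Sum>k<2 ^ m. ?f (2 * k) + ?f (2 * k + 1)) = (\<Sum>k<2 ^ Suc m. ?f k)"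
    using sum_even_odd[of ?f "2 ^ m"] by (simp only: power_Suc)
  finally show ?case
    unfolding Suc.IH by (simp add: sum_distrib_left sum_divide_distrib algebra_simps)
qed simp

text \<open>By \<open>bridge_cov_le_hat\<close> the inner sum of the remainder is at most a sum of
  tents, hence at most 1, and the factor \<open>(1/2) ^ m\<close> remains.\<close>

lemma bridge_cov_sums:
  "(\<lambda>m. \<Sum>n<m. \<Sum>k<2 ^ n. (1/2) ^ n / 4 * (hat (2 ^ n * s - real k) * hat (2 ^ n * t - real k)))
      \<longlonglongrightarrow> bridge_cov s t"
proof -
  define R where "R m = (1/2) ^ m
      * (\<Sum>k<2 ^ m. bridge_cov (2 ^ m * s - real k) (2 ^ m * t - real k))" for m :: nat
  have "R \<longlonglongrightarrow> 0"
  proof (rule Lim_null_comparison)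
    show "\<forall>\<^sub>F m in sequentially. norm (R m) \<le> (1/2) ^ m"
    proof (rule always_eventually, rule allI)
      fix m :: nat
      have "(\<Sum>k<2 ^ m. bridge_cov (2 ^ m * s - real k) (2 ^ m * t - real k))
          \<le> (\<Sum>k<2 ^ m. hat (2 ^ m * s - real k))"
        by (intro sum_mono bridge_cov_le_hat)
      also have "\<dots> \<le> 1" by (rule sum_hat_le_1)
      finally have "R m \<le> (1/2) ^ m * 1" unfolding R_def by (intro mult_left_mono) auto
      moreover have "R m \<ge> 0" unfolding R_def
          by (intro mult_nonneg_nonneg sum_nonneg bridge_cov_nonneg) auto
      ultimately show "norm (R m) \<le> (1/2) ^ m" by simp
    qed
    show "(\<lambda>m. (1/2::real) ^ m) \<longlonglongrightarrow> 0" by (rule LIMSEQ_power_zero) simp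
  qed
  then have "(\<lambda>m. bridge_cov s t - R m) \<longlonglongrightarrow> bridge_cov s t - 0" by (intro tendsto_intros)
  moreover have "bridge_cov s t - R m
      = (\<Sum>n<m. \<Sum>k<2 ^ n. (1/2) ^ n / 4 * (hat (2 ^ n * s - real k) * hat (2 ^ n * t - real k)))"
      for m
    using bridge_cov_expansion[of s t m] unfolding R_def by simp
  ultimately show ?thesis by simp
qed

section \<open>The limit process\<close>

definition schauder_index :: "nat \<times> nat \<Rightarrow> real" where
  "schauder_index p = real (prod_encode p)"

lemma inj_schauder_index: "inj_on schauder_index A"
  by (auto simp: schauder_index_def inj_on_def)

text \<open>Level \<open>n\<close> of the Levy-Ciesielski series of the bridge. The amplitude
  squares to \<open>(1/2) ^ n / 4\<close>, the weight in the expansion of the covariance.\<close>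

definition level :: "nat \<Rightarrow> real \<Rightarrow> (real \<Rightarrow> real) \<Rightarrow> real" where
  "level n t \<omega> = (1 / sqrt 2) ^ n / 2
      * (\<Sum>k<2 ^ n. hat (2 ^ n * t - real k) * \<omega> (schauder_index (n, k)))"

text \<open>With \<open>l = (5/4)\<^sup>n\<close> in \<open>\<bar>z\<bar> \<le> l + z\<^sup>4 / l\<^sup>3\<close>, the expectations of these bounds are summable because
\<open>5/4 < \<surd>2 < (5/4)\<^sup>3\<close>.\<close>

definition majorant :: "nat \<Rightarrow> (real \<Rightarrow> real) \<Rightarrow> real" where
  "majorant n \<omega> = (1 / sqrt 2) ^ n
      * ((5/4) ^ n + (\<Sum>k<2 ^ n. \<omega> (schauder_index (n, k)) ^ 4) / ((5/4) ^ n) ^ 3)"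

lemma majorant_nonneg: "majorant n \<omega> \<ge> 0"
  unfolding majorant_def
      by (intro mult_nonneg_nonneg add_nonneg_nonneg divide_nonneg_nonneg sum_nonneg) auto

lemma abs_le_fourth_power:
  fixes z :: real
  assumes l: "l > 0"
  shows "\<bar>z\<bar> \<le> l + z ^ 4 / l ^ 3"
proof (cases "\<bar>z\<bar> \<le> l")
  case True
  have "0 \<le> z ^ 4 / l ^ 3" using l by simp
  then show ?thesis using True by linarith
next
  case False
  then have "l ^ 3 \<le> \<bar>z\<bar> ^ 3" using l by (intro power_mono) auto
  then have "\<bar>z\<bar> * l ^ 3 \<le> \<bar>z\<bar> * \<bar>z\<bar> ^ 3" by (intro mult_left_mono) auto
  also have "\<bar>z\<bar> * \<bar>z\<bar> ^ 3 = \<bar>z\<bar> ^ 4" by (simp add: power4_eq_xxxx power3_eq_cube)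
  also have "\<bar>z\<bar> ^ 4 = z ^ 4" by simp
  finally have "\<bar>z\<bar> \<le> z ^ 4 / l ^ 3" using l by (simp add: le_divide_eq)
  then show ?thesis using l by linarith
qed

text \<open>The tents of a level sum to at most 1 at any time, so the level is bounded by its
  largest coefficient; \<open>abs_le_fourth_power\<close> replaces this maximum by a sum whose mean
  is known. The bound is uniform in \<open>t\<close>.\<close>

lemma level_le_majorant: "\<bar>level n t \<omega>\<bar> \<le> majorant n \<omega>"
proof -
  define q :: real where "q = (5/4) ^ n"
  have q: "q > 0" by (simp add: q_def)
  let ?z = "\<lambda>k. \<omega> (schauder_index (n, k))"
  define w where "w = (\<Sum>k<2 ^ n. ?z k ^ 4)"
  have w0: "w \<ge> 0" unfolding w_def by (intro sum_nonneg) auto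
  have z: "\<bar>?z k\<bar> \<le> q + w / q ^ 3" if "k < 2 ^ n" for k
  proof -
    have "?z k ^ 4 \<le> w" unfolding w_def by (rule member_le_sum) (use that in auto)
    then have "?z k ^ 4 / q ^ 3 \<le> w / q ^ 3" using q by (intro divide_right_mono) auto
    then show ?thesis using abs_le_fourth_power[OF q, of "?z k"] by linarith
  qed
  have "\<bar>\<Sum>k<2 ^ n. hat (2 ^ n * t - real k) * ?z k\<bar> \<le> (\<Sum>k<2 ^ n. \<bar>hat (2 ^ n * t - real k) * ?z k\<bar>)"
    by (rule sum_abs)
  also have "\<dots> \<le> (\<Sum>k<2 ^ n. hat (2 ^ n * t - real k) * (q + w / q ^ 3))"
    using z hat_bounds by (intro sum_mono) (auto simp: abs_mult intro!: mult_left_mono)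
  also have "\<dots> = (\<Sum>k<2 ^ n. hat (2 ^ n * t - real k)) * (q + w / q ^ 3)"
    by (simp add: sum_distrib_right)
  also have "\<dots> \<le> 1 * (q + w / q ^ 3)"
    using q w0 sum_hat_le_1 by (intro mult_right_mono) auto
  finally have "(1 / sqrt 2) ^ n / 2 * \<bar>\<Sum>k<2 ^ n. hat (2 ^ n * t - real k) * ?z k\<bar>
      \<le> (1 / sqrt 2) ^ n * (q + w / q ^ 3)"
    by (intro mult_mono) auto
  then show ?thesis
    unfolding level_def majorant_def q_def w_def by (simp add: abs_mult)
qed

lemma level_measurable [measurable]: "level n t \<in> borel_measurable gauss_space"
  unfolding level_def[abs_def] by measurable

lemma majorant_measurable [measurable]: "majorant n \<in> borel_measurable gauss_space"
  unfolding majorant_def[abs_def] by measurable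

lemma majorant_integral:
  "integrable gauss_space (majorant n)"
  "(\<integral>\<omega>. majorant n \<omega> \<partial>gauss_space) = (5 / (4 * sqrt 2)) ^ n + 3 * (64 * sqrt 2 / 125) ^ n"
proof -
  have i: "integrable gauss_space (\<lambda>\<omega>. \<Sum>k<2 ^ n. \<omega> (schauder_index (n, k)) ^ 4)"
    by (intro Bochner_Integration.integrable_sum gauss_fourth_moment)
  then show "integrable gauss_space (majorant n)"
    unfolding majorant_def[abs_def] by simp
  have "(\<integral>\<omega>. (\<Sum>k<2 ^ n. \<omega> (schauder_index (n, k)) ^ 4) \<partial>gauss_space) = (\<Sum>k<(2::nat) ^ n. 3)"
    by (subst Bochner_Integration.integral_sum) (auto simp: gauss_fourth_moment)
  then have "(\<integral>\<omega>. majorant n \<omega> \<partial>gauss_space)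
      = (1 / sqrt 2) ^ n * ((5/4) ^ n + (2 ^ n * 3) / ((5/4) ^ n) ^ 3)"
    unfolding majorant_def using i by (simp add: gs.prob_space)
  also have "\<dots> = (1 / sqrt 2 * (5/4)) ^ n + 3 * ((1 / sqrt 2) ^ n * (2 ^ n / ((5/4) ^ 3) ^ n))"
    unfolding power_mult_distrib power_commuting_commutes
        by (simp add: algebra_simps flip: power_mult)
  also have "(1 / sqrt 2) ^ n * (2 ^ n / ((5/4) ^ 3) ^ n) = (1 / sqrt 2 * (2 / (5/4) ^ 3)) ^ n"
    by (simp only: power_mult_distrib power_divide)
  also have "1 / sqrt 2 * (2 / (5/4) ^ 3) = 64 * sqrt 2 / 125"
    by (simp add: field_simps power3_eq_cube)
  also have "1 / sqrt 2 * (5/4) = 5 / (4 * sqrt 2)" by simp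
  finally show "(\<integral>\<omega>. majorant n \<omega> \<partial>gauss_space)
      = (5 / (4 * sqrt 2)) ^ n + 3 * (64 * sqrt 2 / 125) ^ n" .
qed

text \<open>Stated in the extended nonnegative reals, where the series is always defined and
  measurable, and where finiteness follows from a finite integral.\<close>

definition majorant_summable :: "(real \<Rightarrow> real) \<Rightarrow> bool" where
  "majorant_summable \<omega> \<longleftrightarrow> (\<Sum>n. ennreal (majorant n \<omega>)) < \<infinity>"

lemma majorant_summableD: "majorant_summable \<omega> \<Longrightarrow> summable (\<lambda>n. majorant n \<omega>)"
  unfolding majorant_summable_def by (intro summable_suminf_not_top majorant_nonneg) auto

lemma majorant_summable_measurable [measurable]: "Measurable.pred gauss_space majorant_summable"
  unfolding majorant_summable_def[abs_def] by measurable

lemma AE_majorant_summable: "AE \<omega> in gauss_space. majorant_summable \<omega>"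
proof -
  have s: "summable (\<lambda>n. (5 / (4 * sqrt 2)) ^ n + 3 * (64 * sqrt 2 / 125) ^ n)"
  proof (intro summable_add summable_mult summable_geometric)
    have "5 / 4 < sqrt (2 :: real)" by (rule real_less_rsqrt) (simp add: power2_eq_square)
    then show "norm (5 / (4 * sqrt 2)) < 1" by simp
    have "sqrt (2 :: real) < 3 / 2" by (rule real_less_lsqrt) (auto simp: power2_eq_square)
    then show "norm (64 * sqrt 2 / 125) < 1" by simp
  qed
  have "(\<integral>\<^sup>+\<omega>. (\<Sum>n. ennreal (majorant n \<omega>)) \<partial>gauss_space)
      = (\<Sum>n. \<integral>\<^sup>+\<omega>. ennreal (majorant n \<omega>) \<partial>gauss_space)"
    by (rule nn_integral_suminf) measurable
  also have "\<dots> = (\<Sum>n. ennreal ((5 / (4 * sqrt 2)) ^ n + 3 * (64 * sqrt 2 / 125) ^ n))"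
    by (subst nn_integral_eq_integral) (auto simp: majorant_integral majorant_nonneg)
  also have "\<dots> \<noteq> \<infinity>"
    using s by (subst suminf_ennreal_eq[OF _ summable_sums]) auto
  finally have "AE \<omega> in gauss_space. (\<Sum>n. ennreal (majorant n \<omega>)) \<noteq> \<infinity>"
    by (intro nn_integral_PInf_AE) measurable
  then show ?thesis
    unfolding majorant_summable_def by (simp add: less_top)
qed

text \<open>Set to 0 off the event of summability, so that every path is continuous and not only
  almost every one.\<close>

definition bridge :: "real \<Rightarrow> (real \<Rightarrow> real) \<Rightarrow> real" where
  "bridge t \<omega> = (if majorant_summable \<omega> then (\<Sum>n. level n t \<omega>) else 0)"

lemma bridge_measurable [measurable]: "bridge t \<in> borel_measurable gauss_space"
  unfolding bridge_def[abs_def] by measurable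

lemma bridge_LIMSEQ:
  assumes "majorant_summable \<omega>"
  shows "(\<lambda>m. \<Sum>n<m. level n t \<omega>) \<longlonglongrightarrow> bridge t \<omega>"
proof -
  have "summable (\<lambda>n. level n t \<omega>)"
    by (rule summable_comparison_test'[OF majorant_summableD[OF assms]])
        (simp add: level_le_majorant)
  then show ?thesis using assms by (simp add: bridge_def summable_LIMSEQ)
qed

lemma hat_continuous: "continuous_on A hat"
  unfolding hat_def[abs_def] by (intro continuous_intros)

lemma bridge_continuous: "continuous_on UNIV (\<lambda>t. bridge t \<omega>)"
proof (cases "majorant_summable \<omega>")
  case True
  have ul: "uniform_limit UNIV (\<lambda>m t. \<Sum>n<m. level n t \<omega>) (\<lambda>t. \<Sum>n. level n t \<omega>) sequentially"
    by (rule Weierstrass_m_test[OF _ majorant_summableD[OF True]]) (simp add: level_le_majorant)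
  have "continuous_on UNIV (\<lambda>t. level n t \<omega>)" for n
    unfolding level_def by
        (intro continuous_intros continuous_on_compose2[OF hat_continuous[of UNIV]]) auto
  then have "continuous_on UNIV (\<lambda>t. \<Sum>n<m. level n t \<omega>)" for m
    by (intro continuous_on_sum)
  then have "continuous_on UNIV (\<lambda>t. \<Sum>n. level n t \<omega>)"
    by (intro uniform_limit_theorem[OF _ ul]) auto
  then show ?thesis using True by (simp add: bridge_def)
next
  case False
  then show ?thesis by (simp add: bridge_def)
qed

text \<open>A partial sum is linear in independent standard normals, with coefficient
  \<open>A p\<close> at the Schauder function \<open>p\<close>. The sum of the squares
  \<open>(A p)^2\<close> expands into the quadratic form of the truncated covariance.\<close>

lemma partial_sum_char:
  fixes I :: "'a set"
  assumes I: "finite I"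
  shows "(\<integral>\<omega>. iexp (\<Sum>i\<in>I. a i * (\<Sum>n<m. level n (\<tau> i) \<omega>)) \<partial>gauss_space)
    = exp (- ((\<Sum>i\<in>I. \<Sum>j\<in>I. a i * a j
        * (\<Sum>n<m. \<Sum>k<2 ^ n. (1/2) ^ n / 4
        * (hat (2 ^ n * \<tau> i - real k) * hat (2 ^ n * \<tau> j - real k)))) / 2))"
proof -
  define J where "J = Sigma {..<m} (\<lambda>n. {..<(2::nat) ^ n})"
  define A where "A p =
      (case p of (n, k) \<Rightarrow> (\<Sum>i\<in>I. a i * ((1 / sqrt 2) ^ n / 2 * hat (2 ^ n * \<tau> i - real k))))"
      for p :: "nat \<times> nat"
  have J: "finite J" by (simp add: J_def)
  have swap: "(\<Sum>k<(q::nat). \<Sum>i\<in>I. \<Sum>j\<in>I. f k i j) = (\<Sum>i\<in>I. \<Sum>j\<in>I. \<Sum>k<q. f k i j)" for q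
      and f :: "nat \<Rightarrow> 'a \<Rightarrow> 'a \<Rightarrow> real"
    by (subst sum.swap, intro sum.cong refl) (rule sum.swap)
  have "(\<Sum>i\<in>I. a i * (\<Sum>n<m. level n (\<tau> i) \<omega>)) = (\<Sum>p\<in>J. A p * \<omega> (schauder_index p))" for \<omega>
  proof -
    have "(\<Sum>i\<in>I. a i * (\<Sum>n<m. level n (\<tau> i) \<omega>))
      = (\<Sum>i\<in>I. \<Sum>n<m. \<Sum>k<2 ^ n. a i * ((1 / sqrt 2) ^ n / 2 * hat (2 ^ n * \<tau> i - real k))
          * \<omega> (schauder_index (n, k)))"
      unfolding level_def by (simp add: sum_distrib_left mult_ac)
    also have "\<dots> = (\<Sum>i\<in>I. \<Sum>(n, k)\<in>J. a i * ((1 / sqrt 2) ^ n / 2 * hat (2 ^ n * \<tau> i - real k))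
        * \<omega> (schauder_index (n, k)))"
      unfolding J_def by (simp add: sum.Sigma)
    also have "\<dots> = (\<Sum>p\<in>J. A p * \<omega> (schauder_index p))"
      by (subst sum.swap) (auto intro!: sum.cong simp: A_def sum_distrib_right)
    finally show ?thesis .
  qed
  then have "(\<integral>\<omega>. iexp (\<Sum>i\<in>I. a i * (\<Sum>n<m. level n (\<tau> i) \<omega>)) \<partial>gauss_space)
      = exp (- ((\<Sum>p\<in>J. (A p)\<^sup>2) / 2))"
    using gauss_linear_char[OF J inj_schauder_index[of J], of A] by simp
  also have "(\<Sum>p\<in>J. (A p)\<^sup>2)
      = (\<Sum>(n, k)\<in>J. \<Sum>i\<in>I. \<Sum>j\<in>I. a i * a j
      * ((1/2) ^ n / 4 * (hat (2 ^ n * \<tau> i - real k) * hat (2 ^ n * \<tau> j - real k))))"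
  proof (rule sum.cong[OF refl])
    fix p assume "p \<in> J"
    obtain n k where p: "p = (n, k)" by force
    have "((1 / sqrt 2) ^ n / 2) * ((1 / sqrt 2) ^ n / 2)
        = (1 / sqrt 2 * (1 / sqrt 2)) ^ n / (4 :: real)"
      by (simp only: power_mult_distrib)
    then have r: "((1 / sqrt 2) ^ n / 2) * ((1 / sqrt 2) ^ n / 2) = (1/2) ^ n / (4 :: real)" by simp
    have eq: "(a i * ((1 / sqrt 2) ^ n / 2 * x)) * (a j * ((1 / sqrt 2) ^ n / 2 * y))
        = a i * a j * ((1/2) ^ n / 4 * (x * y))" for i j x y
      unfolding r[symmetric] by (simp only: mult_ac)
    show "(A p)\<^sup>2 = (case p of (n, k) \<Rightarrow> \<Sum>i\<in>I. \<Sum>j\<in>I. a i * a j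
        * ((1/2) ^ n / 4 * (hat (2 ^ n * \<tau> i - real k) * hat (2 ^ n * \<tau> j - real k))))"
      unfolding p A_def power2_eq_square prod.case sum_product eq ..
  qed
  also have "\<dots> = (\<Sum>n<m. \<Sum>k<2 ^ n. \<Sum>i\<in>I. \<Sum>j\<in>I. a i * a j
      * ((1/2) ^ n / 4 * (hat (2 ^ n * \<tau> i - real k) * hat (2 ^ n * \<tau> j - real k))))"
    unfolding J_def by (simp add: sum.Sigma)
  also have "\<dots> = (\<Sum>i\<in>I. \<Sum>j\<in>I. a i * a j
      * (\<Sum>n<m. \<Sum>k<2 ^ n. (1/2) ^ n / 4
      * (hat (2 ^ n * \<tau> i - real k) * hat (2 ^ n * \<tau> j - real k))))"
    unfolding sum_distrib_left
    by (simp only: swap)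
  finally show ?thesis .
qed

lemma bridge_char:
  assumes I: "finite I"
  shows "(\<integral>\<omega>. iexp (\<Sum>i\<in>I. a i * bridge (\<tau> i) \<omega>) \<partial>gauss_space)
    = exp (- ((\<Sum>i\<in>I. \<Sum>j\<in>I. a i * a j * bridge_cov (\<tau> i) (\<tau> j)) / 2))"
proof (rule LIMSEQ_unique)
  show "(\<lambda>m. \<integral>\<omega>. iexp (\<Sum>i\<in>I. a i * (\<Sum>n<m. level n (\<tau> i) \<omega>)) \<partial>gauss_space)
      \<longlonglongrightarrow> (\<integral>\<omega>. iexp (\<Sum>i\<in>I. a i * bridge (\<tau> i) \<omega>) \<partial>gauss_space)"
  proof (rule integral_dominated_convergence[where w="\<lambda>_. 1"])
    show "AE \<omega> in gauss_space. (\<lambda>m. iexp (\<Sum>i\<in>I. a i * (\<Sum>n<m. level n (\<tau> i) \<omega>)))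
        \<longlonglongrightarrow> iexp (\<Sum>i\<in>I. a i * bridge (\<tau> i) \<omega>)"
      using AE_majorant_summable
      by eventually_elim (intro tendsto_intros bridge_LIMSEQ)
  qed (auto simp del: of_real_sum of_real_mult)
  show "(\<lambda>m. \<integral>\<omega>. iexp (\<Sum>i\<in>I. a i * (\<Sum>n<m. level n (\<tau> i) \<omega>)) \<partial>gauss_space)
      \<longlonglongrightarrow> exp (- ((\<Sum>i\<in>I. \<Sum>j\<in>I. a i * a j * bridge_cov (\<tau> i) (\<tau> j)) / 2))"
    unfolding partial_sum_char[OF I] by (intro tendsto_intros bridge_cov_sums) simp
qed

text \<open>\<open>(1 + v) b(v / (1 + v))\<close> is a Brownian motion in \<open>v\<close>, here run at \<open>v = t\<^sup>3\<close>.\<close>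

definition limit_process :: "real \<Rightarrow> (real \<Rightarrow> real) \<Rightarrow> real" where
  "limit_process t \<omega> = (if t \<le> 0 then 0 else (1 + t ^ 3) / (sqrt 12 * t\<^sup>2)
      * bridge (t ^ 3 / (1 + t ^ 3)) \<omega>)"

text \<open>The value 0 at nonpositive times matches \<open>limit_process\<close>, so that the
  formulas for the law carry no sign condition on the times.\<close>

definition limit_cov :: "real \<Rightarrow> real \<Rightarrow> real" where
  "limit_cov s t = (if s \<le> 0 \<or> t \<le> 0 then 0 else min s t / (12 * (max s t)\<^sup>2))"

lemma limit_cov_commute: "limit_cov s t = limit_cov t s"
  by (auto simp: limit_cov_def min.commute max.commute)

lemma bridge_cov_commute: "bridge_cov s t = bridge_cov t s"
  by (auto simp: bridge_cov_def min.commute)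

text \<open>For \<open>s \<le> t\<close> the bridge covariance is \<open>u (1 - v)\<close> with
  \<open>u = s^3 / (1 + s^3)\<close> and \<open>v = t^3 / (1 + t^3)\<close>. The factors
  \<open>1 + s^3\<close> and \<open>1 + t^3\<close> cancel, leaving
  \<open>s^3 / (12 s^2 t^2)\<close>.\<close>

lemma bridge_cov_time_change:
  assumes "0 < s" "0 < t"
  shows "((1 + s ^ 3) / (sqrt 12 * s\<^sup>2)) * ((1 + t ^ 3) / (sqrt 12 * t\<^sup>2))
      * bridge_cov (s ^ 3 / (1 + s ^ 3)) (t ^ 3 / (1 + t ^ 3)) = limit_cov s t"
proof -
  have key: "((1 + s ^ 3) / (sqrt 12 * s\<^sup>2)) * ((1 + t ^ 3) / (sqrt 12 * t\<^sup>2))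
      * bridge_cov (s ^ 3 / (1 + s ^ 3)) (t ^ 3 / (1 + t ^ 3)) = limit_cov s t"
    if "0 < s" "s \<le> t" for s t :: real
  proof -
    define S where "S = s ^ 3"
    define T where "T = t ^ 3"
    have ST: "0 < S" "0 < T" "S \<le> T" using that by (auto simp: S_def T_def power_mono)
    then have le: "S / (1 + S) \<le> T / (1 + T)" by (simp add: field_simps)
    have u: "S / (1 + S) \<in> {0..1}" "T / (1 + T) \<in> {0..1}" using ST by auto
    have "bridge_cov (S / (1 + S)) (T / (1 + T)) = S / (1 + S) * (1 / (1 + T))"
    proof -
      have "1 - T / (1 + T) = 1 / (1 + T)" using ST by (simp add: field_simps)
      moreover have "bridge_cov (S / (1 + S)) (T / (1 + T)) = S / (1 + S) * (1 - T / (1 + T))"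
        using u le unfolding bridge_cov_def
            by (simp only: min_absorb1 simp_thms if_True right_diff_distrib mult_1_right)
      ultimately show ?thesis by simp
    qed
    moreover have "((1 + S) / x) * ((1 + T) / y) * (S / (1 + S) * (1 / (1 + T))) = S / (x * y)"
        for x y
    proof -
      have "1 + S \<noteq> 0" "1 + T \<noteq> 0" using ST by auto
      then show ?thesis by simp
    qed
    ultimately have "((1 + S) / (sqrt 12 * s\<^sup>2)) * ((1 + T) / (sqrt 12 * t\<^sup>2))
        * bridge_cov (S / (1 + S)) (T / (1 + T))
        = S / (sqrt 12 * sqrt 12 * s\<^sup>2 * t\<^sup>2)"
      by (simp only: mult_ac)
    also have "sqrt 12 * sqrt 12 = (12 :: real)" by simp
    also have "S / (12 * s\<^sup>2 * t\<^sup>2) = s / (12 * t\<^sup>2)"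
      using that by (simp add: S_def power2_eq_square power3_eq_cube field_simps)
    finally show ?thesis using that unfolding S_def T_def
        by (simp add: limit_cov_def min_absorb1 max_absorb2)
  qed
  show ?thesis
  proof (cases "s \<le> t")
    case True
    then show ?thesis using key assms by blast
  next
    case False
    then show ?thesis using key[of t s] assms
      by (simp only: limit_cov_commute[of s t] bridge_cov_commute[of "s ^ 3 / _"]
          mult.commute[of "(1 + s ^ 3) / _"] nle_le)
  qed
qed

section \<open>Law and path continuity of the limit process\<close>

lemma limit_process_measurable [measurable]: "limit_process t \<in> borel_measurable gauss_space"
  unfolding limit_process_def[abs_def] by measurable

lemma limit_process_char:
  assumes I: "finite I"
  shows "(\<integral>\<omega>. iexp (\<Sum>i\<in>I. a i * limit_process (\<tau> i) \<omega>) \<partial>gauss_space)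
    = exp (- ((\<Sum>i\<in>I. \<Sum>j\<in>I. a i * a j * limit_cov (\<tau> i) (\<tau> j)) / 2))"
proof -
  define c where "c t = (if t \<le> 0 then 0 else (1 + t ^ 3) / (sqrt 12 * t\<^sup>2))" for t :: real
  define u where "u t = t ^ 3 / (1 + t ^ 3)" for t :: real
  have W: "limit_process t \<omega> = c t * bridge (u t) \<omega>" for t \<omega>
    by (simp add: limit_process_def c_def u_def)
  have cov: "c s * c t * bridge_cov (u s) (u t) = limit_cov s t" for s t
    using bridge_cov_time_change[of s t] by (auto simp: c_def u_def limit_cov_def)
  have "(\<integral>\<omega>. iexp (\<Sum>i\<in>I. (a i * c (\<tau> i)) * bridge (u (\<tau> i)) \<omega>) \<partial>gauss_space)
    = exp (- ((\<Sum>i\<in>I. \<Sum>j\<in>I. (a i * c (\<tau> i)) * (a j * c (\<tau> j)) * bridge_cov (u (\<tau> i)) (u (\<tau> j)))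
        / 2))"
    by (rule bridge_char[OF I])
  moreover have "(a i * c s) * (a j * c t) * bridge_cov (u s) (u t) = a i * a j * limit_cov s t"
      for i j s t
    unfolding cov[symmetric] by (simp only: mult_ac)
  ultimately show ?thesis by (simp only: W mult.assoc)
qed

lemma limit_process_continuous: "continuous_on {0<..} (\<lambda>t. limit_process t \<omega>)"
proof -
  have "continuous_on {0<..} (\<lambda>t. (1 + t ^ 3) / (sqrt 12 * t\<^sup>2) * bridge (t ^ 3 / (1 + t ^ 3)) \<omega>)"
    by (intro continuous_intros continuous_on_compose2[OF bridge_continuous])
        (auto simp: add_pos_pos less_imp_neq[THEN not_sym])
  then show ?thesis
    by (rule continuous_on_eq) (auto simp: limit_process_def)
qed

lemma limit_process_gaussian:
  fixes a \<tau> :: "'i \<Rightarrow> real"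
  assumes I: "finite I"
  defines "X \<equiv> \<lambda>\<omega>. \<Sum>i\<in>I. a i * limit_process (\<tau> i) \<omega>"
    and "v \<equiv> \<Sum>i\<in>I. \<Sum>j\<in>I. a i * a j * limit_cov (\<tau> i) (\<tau> j)"
  shows "gaussian_variable gauss_space X" "integrable gauss_space X" "(\<integral>\<omega>. X \<omega> \<partial>gauss_space) = 0"
    "integrable gauss_space (\<lambda>\<omega>. (X \<omega>)\<^sup>2)" "(\<integral>\<omega>. (X \<omega>)\<^sup>2 \<partial>gauss_space) = v"
    "v > 0 \<Longrightarrow> distributed gauss_space lborel X (normal_density 0 (sqrt v))"
proof -
  have X: "X \<in> borel_measurable gauss_space" unfolding X_def by measurable
  have char: "(\<integral>\<omega>. iexp (u * X \<omega>) \<partial>gauss_space) = exp (- (u\<^sup>2 * v / 2))" for u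
  proof -
    have "(\<integral>\<omega>. iexp (\<Sum>i\<in>I. (u * a i) * limit_process (\<tau> i) \<omega>) \<partial>gauss_space)
      = exp (- ((\<Sum>i\<in>I. \<Sum>j\<in>I. (u * a i) * (u * a j) * limit_cov (\<tau> i) (\<tau> j)) / 2))"
      by (rule limit_process_char[OF I])
    moreover have "(\<Sum>i\<in>I. \<Sum>j\<in>I. (u * a i) * (u * a j) * limit_cov (\<tau> i) (\<tau> j)) = u\<^sup>2 * v"
      unfolding v_def by (simp add: sum_distrib_left power2_eq_square mult_ac)
    moreover have "(\<Sum>i\<in>I. (u * a i) * limit_process (\<tau> i) \<omega>) = u * X \<omega>" for \<omega>
      unfolding X_def by (simp add: sum_distrib_left mult_ac)
    ultimately show ?thesis by simp
  qed
  \<comment> \<open>Nonnegativity of the quadratic form is read off from the characteristic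
    function, whose modulus is at most 1.\<close>
  have v: "v \<ge> 0"
  proof (rule ccontr)
    assume "\<not> v \<ge> 0"
    then have "1 < exp (- (1\<^sup>2 * v / 2))" by simp
    moreover have "norm (\<integral>\<omega>. iexp (1 * X \<omega>) \<partial>gauss_space)
        \<le> (\<integral>\<omega>. norm (iexp (1 * X \<omega>)) \<partial>gauss_space)"
      by (rule integral_norm_bound)
    ultimately show False unfolding char by (simp add: gs.prob_space)
  qed
  note g = gaussian_variable_char[OF prob_space_gauss_space X v char]
  show "gaussian_variable gauss_space X" "integrable gauss_space X" "(\<integral>\<omega>. X \<omega> \<partial>gauss_space) = 0"
    "integrable gauss_space (\<lambda>\<omega>. (X \<omega>)\<^sup>2)" "(\<integral>\<omega>. (X \<omega>)\<^sup>2 \<partial>gauss_space) = v"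
    "v > 0 \<Longrightarrow> distributed gauss_space lborel X (normal_density 0 (sqrt v))"
    by (rule g; assumption)+
qed

section \<open>Scaled paths\<close>

text \<open>The descent process as a functional of the numbers of descents rather than of the
  insertion positions, so that \<open>determined_upto\<close> applies.\<close>

definition scaled :: "(nat \<Rightarrow> nat) \<Rightarrow> nat \<Rightarrow> real \<Rightarrow> real" where
  "scaled x n t = (let m = nat \<lfloor>real n * t\<rfloor> in sqrt (real n) * (real (x m) / real m - 1 / 2))"

lemma path_from_scaled:
  "path_from e (scaled x n)
      = (\<lambda>t\<in>{0..}. (\<lambda>i. sqrt (real n) * (real (x (nat i)) / real (nat i) - 1 / 2)) \<lfloor>real n * t
      + real n * e\<rfloor>)"
  unfolding path_from_def scaled_def Let_def by (simp add: distrib_left add.commute)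

lemma path_from_scaled_in_skorokhod_space: "path_from e (scaled x n) \<in> skorokhod_space"
  unfolding path_from_scaled by (rule floor_path_in_skorokhod_space) simp

text \<open>The martingale is centred at \<open>(m - 1) / 2\<close>, the process at
  \<open>m / 2\<close>; the difference leaves the deterministic drift
  \<open>\<surd>n / (2 m)\<close>.\<close>

lemma scaled_eq_mart:
  assumes "m = nat \<lfloor>real n * t\<rfloor>" "m \<ge> 1"
  shows "scaled x n t = sqrt (real n) * (mart x m / (real m)\<^sup>2) - sqrt (real n) / (2 * real m)"
proof -
  have "real (x m) / real m - 1 / 2 = mart x m / (real m)\<^sup>2 - 1 / (2 * real m)"
    using assms(2) by (simp add: mart_def field_simps power2_eq_square)
  then show ?thesis unfolding scaled_def assms(1)[symmetric] Let_def
      by (simp add: right_diff_distrib)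
qed

lemma half_le_floor:
  assumes "y \<ge> (1 :: real)"
  shows "y / 2 \<le> real (nat \<lfloor>y\<rfloor>)" "1 \<le> nat \<lfloor>y\<rfloor>" "real (nat \<lfloor>y\<rfloor>) \<le> y"
proof -
  have f: "1 \<le> \<lfloor>y\<rfloor>" using assms by simp
  then have r: "real (nat \<lfloor>y\<rfloor>) = of_int \<lfloor>y\<rfloor>" by simp
  have y: "of_int \<lfloor>y\<rfloor> \<le> y" "y < of_int \<lfloor>y\<rfloor> + 1" by linarith+
  have "(1 :: real) \<le> of_int \<lfloor>y\<rfloor>" using f by linarith
  with y show "y / 2 \<le> real (nat \<lfloor>y\<rfloor>)" "real (nat \<lfloor>y\<rfloor>) \<le> y" unfolding r by linarith+
  show "1 \<le> nat \<lfloor>y\<rfloor>" using f by linarith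
qed

context random_insertions
begin

lemma descent_process_eq: "descent_process (\<lambda>m. V m \<omega>) n = scaled (D \<omega>) n"
  unfolding descent_process_def scaled_def D_def by simp

text \<open>A path may involve infinitely many \<open>D \<omega> i\<close>. Cutting these off after
  index \<open>j\<close> gives functionals of finitely many values, and the cut paths agree with the
  path on longer and longer intervals.\<close>

lemma path_measurable:
  assumes e: "e > 0"
  shows "(\<lambda>\<omega>. path_from e (scaled (D \<omega>) n)) \<in> measurable M (borel_of_topology skorokhod)"
proof (rule measurable_skorokhod)
  show "path_from e (scaled (D \<omega>) n) \<in> skorokhod_space" for \<omega>
    by (rule path_from_scaled_in_skorokhod_space)
  fix g assume g: "lipschitz_path 1 g"
  define trunc where "trunc j x i = (if i \<le> j then x i else 0)" for j and x :: "nat \<Rightarrow> nat" and i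
  show "(\<lambda>\<omega>. g (path_from e (scaled (D \<omega>) n))) \<in> borel_measurable M"
  proof (rule borel_measurable_LIMSEQ_real)
    fix j
    have "trunc j x = trunc j y" if "\<forall>i\<le>j. x i = y i" for x y
      using that by (auto simp: trunc_def fun_eq_iff)
    then have "determined_upto j (\<lambda>x. g (path_from e (scaled (trunc j x) n)))"
      unfolding determined_upto_def by metis
    then show "(\<lambda>\<omega>. g (path_from e (scaled (trunc j (D \<omega>)) n))) \<in> borel_measurable M"
      by (rule measurable_determined) simp
  next
    fix \<omega>
    have "(\<lambda>j. path_dist (path_from e (scaled (trunc j (D \<omega>)) n)) (path_from e (scaled (D \<omega>) n)))
        \<longlonglongrightarrow> 0"
    proof (rule LIMSEQ_I)
      fix r :: real assume r: "r > 0"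
      obtain T :: nat where T: "1 / (1 + real T) < r"
        using order_tendstoD(2)[OF tendsto_inverse_Suc_null r]
            by (auto simp: eventually_sequentially)
      show "\<exists>j0. \<forall>j\<ge>j0. norm
          (path_dist (path_from e (scaled (trunc j (D \<omega>)) n)) (path_from e (scaled (D \<omega>) n)) - 0)
          < r"
      proof (intro exI allI impI)
        fix j assume j: "j \<ge> nat \<lfloor>real n * (e + real T)\<rfloor>"
        have "path_dist (path_from e (scaled (trunc j (D \<omega>)) n)) (path_from e (scaled (D \<omega>) n))
            \<le> 0 + 1 / (1 + real T)"
        proof (rule path_dist_le)
          fix t assume t: "0 \<le> t" "t < real T"
          have "real n * (e + t) \<le> real n * (e + real T)" using t by (intro mult_left_mono) auto
          then have "nat \<lfloor>real n * (e + t)\<rfloor> \<le> nat \<lfloor>real n * (e + real T)\<rfloor>"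
            by (intro nat_mono floor_mono)
          then have "nat \<lfloor>real n * (e + t)\<rfloor> \<le> j" using j by simp
          then have "scaled (trunc j (D \<omega>)) n (e + t) = scaled (D \<omega>) n (e + t)"
            unfolding scaled_def Let_def trunc_def by simp
          then show "\<bar>path_from e (scaled (trunc j (D \<omega>)) n) t - path_from e (scaled (D \<omega>) n) t\<bar>
              \<le> 0"
            by (simp add: path_from_def)
        qed auto
        then show "norm (path_dist (path_from e (scaled (trunc j (D \<omega>)) n))
            (path_from e (scaled (D \<omega>) n)) - 0) < r"
          using T path_dist_nonneg[of "path_from e (scaled (trunc j (D \<omega>)) n)"
              "path_from e (scaled (D \<omega>) n)"] by simp
      qed
    qed
    then show "(\<lambda>j. g (path_from e (scaled (trunc j (D \<omega>)) n))) \<longlonglongrightarrow> g (path_from e (scaled (D \<omega>) n))"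
      by (rule lipschitz_path_tendsto[OF g])
  qed
qed

lemma determined_upto_scaled: "determined_upto (nat \<lfloor>real n * t\<rfloor>) (\<lambda>x. \<phi> (scaled x n t))"
  unfolding determined_upto_def scaled_def Let_def by simp

lemma scaled_measurable: "(\<lambda>\<omega>. scaled (D \<omega>) n t) \<in> borel_measurable M"
  using measurable_determined[OF determined_upto_scaled[of n t "\<lambda>x. x"], of borel] by simp

lemma scaled_square_integrable: "integrable M (\<lambda>\<omega>. (scaled (D \<omega>) n t)\<^sup>2)"
  by (rule integrable_determined[OF determined_upto_scaled[of n t "\<lambda>x. x\<^sup>2"]])

text \<open>A bound uniform in \<open>n\<close>, including the small \<open>n\<close> that no
  asymptotic argument reaches. The constant is crude: it uses
  \<open>\<lfloor>y\<rfloor> \<ge> y / 2\<close> for \<open>y \<ge> 1\<close> and the bound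
  \<open>m^3\<close> for the second moment of the martingale.\<close>

lemma scaled_second_moment:
  assumes e: "e > 0" "e \<le> t"
  shows "expectation (\<lambda>\<omega>. (scaled (D \<omega>) n t)\<^sup>2) \<le> 8 / e"
proof (cases "real n * t < 1")
  case True
  have "real n * e \<le> real n * t" using e by (intro mult_left_mono) auto
  then have ne: "real n * e < 1" using True by linarith
  \<comment> \<open>Here the quotient is \<open>0 / 0 = 0\<close>, so the process equals
    \<open>- \<surd>n / 2\<close>, and \<open>n e < 1\<close> bounds its square.\<close>
  have "nat \<lfloor>real n * t\<rfloor> = 0" using True e by (simp add: floor_less_iff)
  then have eq: "(scaled (D \<omega>) n t)\<^sup>2 = real n / 4" for \<omega>
    unfolding scaled_def Let_def by (simp add: power_divide)
  have "real n / 4 \<le> 8 / e" using ne e by (simp add: le_divide_eq)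
  then show ?thesis unfolding eq by (simp add: prob_space)
next
  case False
  define m where "m = nat \<lfloor>real n * t\<rfloor>"
  have m: "real n * t / 2 \<le> real m" "1 \<le> m"
    using half_le_floor[of "real n * t"] False by (auto simp: m_def)
  have "(scaled (D \<omega>) n t)\<^sup>2 \<le> 2 * real n * (mart (D \<omega>) m)\<^sup>2 / (real m) ^ 4 + real n
      / (2 * (real m)\<^sup>2)" for \<omega>
  proof -
    have sq: "(u - w)\<^sup>2 \<le> 2 * u\<^sup>2 + 2 * w\<^sup>2" for u w :: real
    proof -
      have "2 * u\<^sup>2 + 2 * w\<^sup>2 - (u - w)\<^sup>2 = (u + w)\<^sup>2" by (simp add: power2_eq_square algebra_simps)
      then show ?thesis using zero_le_power2[of "u + w"] by linarith
    qed
    have "(scaled (D \<omega>) n t)\<^sup>2 \<le> 2 * (sqrt (real n) * (mart (D \<omega>) m / (real m)\<^sup>2))\<^sup>2 + 2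
        * (sqrt (real n) / (2 * real m))\<^sup>2"
      unfolding scaled_eq_mart[OF m_def m(2)] by (rule sq)
    also have "\<dots> = 2 * real n * (mart (D \<omega>) m)\<^sup>2 / (real m) ^ 4 + real n / (2 * (real m)\<^sup>2)"
      by (simp add: power_mult_distrib power_divide flip: power_mult)
    finally show ?thesis .
  qed
  moreover have i: "integrable M (\<lambda>\<omega>. (mart (D \<omega>) m)\<^sup>2)"
    by (rule integrable_determined[OF determined_upto_mart[OF order_refl]])
  ultimately have "expectation (\<lambda>\<omega>. (scaled (D \<omega>) n t)\<^sup>2)
      \<le> expectation (\<lambda>\<omega>. 2 * real n * (mart (D \<omega>) m)\<^sup>2 / (real m) ^ 4 + real n / (2 * (real m)\<^sup>2))"
    using scaled_square_integrable by (intro integral_mono) auto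
  also have "\<dots> = 2 * real n * expectation (\<lambda>\<omega>. (mart (D \<omega>) m)\<^sup>2) / (real m) ^ 4 + real n
      / (2 * (real m)\<^sup>2)"
    using i by (simp add: prob_space)
  also have "\<dots> \<le> 2 * real n * real m ^ 3 / (real m) ^ 4 + real n / (2 * (real m)\<^sup>2)"
    using second_moment_mart[OF m(2)] by (intro add_mono divide_right_mono mult_left_mono) auto
  also have "2 * real n * real m ^ 3 / (real m) ^ 4 = 2 * (real n / real m)"
    using m by (simp add: power3_eq_cube power4_eq_xxxx)
  also have "real n / (2 * (real m)\<^sup>2) \<le> real n / real m"
  proof (rule divide_left_mono)
    have "1 * real m \<le> real m * real m" using m by (intro mult_right_mono) auto
    then show "real m \<le> 2 * (real m)\<^sup>2" by (simp add: power2_eq_square)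
  qed (use m in auto)
  also have "2 * (real n / real m) + real n / real m \<le> 4 * (real n / real m)"
    using divide_nonneg_nonneg[of "real n" "real m"] by linarith
  also have "real n / real m \<le> 2 / t"
    using m e by (simp add: field_simps)
  also have "4 * (2 / t) \<le> 8 / e" using e by (simp add: frac_le)
  finally show ?thesis by simp
qed

end

section \<open>Finite-dimensional distributions\<close>

lemma nat_floor_over_tendsto:
  assumes "t \<ge> 0"
  shows "(\<lambda>n. real (nat \<lfloor>real n * t\<rfloor>) / real n) \<longlonglongrightarrow> t"
proof (rule tendsto_sandwich)
  show "(\<lambda>n. t - 1 / real n) \<longlonglongrightarrow> t"
    using tendsto_diff[OF tendsto_const[of t] lim_1_over_n] by simp
  show "\<forall>\<^sub>F n in sequentially. t - 1 / real n \<le> real (nat \<lfloor>real n * t\<rfloor>) / real n"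
    using eventually_gt_at_top[of 0]
  proof eventually_elim
    case (elim n)
    have "real n * t - 1 \<le> real (nat \<lfloor>real n * t\<rfloor>)" by linarith
    then have "(real n * t - 1) / real n \<le> real (nat \<lfloor>real n * t\<rfloor>) / real n"
        by (intro divide_right_mono) auto
    then show ?case using elim by (simp add: diff_divide_distrib)
  qed
  show "\<forall>\<^sub>F n in sequentially. real (nat \<lfloor>real n * t\<rfloor>) / real n \<le> t"
    using eventually_gt_at_top[of 0]
  proof eventually_elim
    case (elim n)
    have "0 \<le> real n * t" using assms by simp
    then have "real (nat \<lfloor>real n * t\<rfloor>) \<le> real n * t" by linarith
    then show ?case using elim by (simp add: divide_le_eq mult.commute)
  qed
qed simp

text \<open>The squares run from \<open>2^2\<close> to \<open>p^2\<close>, whence the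
  \<open>- 1\<close>.\<close>

lemma sum_squares_closed:
    "p \<ge> 1 \<Longrightarrow> (\<Sum>l = 1..<p. (real (Suc l))\<^sup>2) = real p * (real p + 1) * (2 * real p + 1) / 6 - 1"
proof (induction p rule: nat_induct_at_least)
  case (Suc p)
  then show ?case by (simp add: sum.atLeastLessThan_Suc power2_eq_square field_simps)
qed simp

context random_insertions
begin

lemma mart_telescope: "m \<ge> 1 \<Longrightarrow> mart (D \<omega>) m = (\<Sum>l = 1..<m. incr (D \<omega>) l)"
proof (induction m rule: nat_induct_at_least)
  case base
  show ?case by (simp add: mart_D_1[unfolded One_nat_def])
next
  case (Suc m)
  then show ?case by (simp add: incr_def sum.atLeastLessThan_Suc)
qed

text \<open>The linear combination of process values is a drift plus a linear combination of
  increments, to which \<open>char_phase\<close> applies. The exponents sum up to half the quadratic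
  form: \<open>n / (m_i^2 m_j^2)\<close> times the sum of \<open>(l + 1)^2 / 8\<close> over
  \<open>l < min m_i m_j\<close> tends to \<open>(min s_i s_j)^3 / (24 s_i^2 s_j^2)\<close>.\<close>

lemma scaled_char:
  fixes c s :: "'i \<Rightarrow> real"
  assumes I: "finite I" and s: "\<And>i. i \<in> I \<Longrightarrow> s i > 0"
  shows "(\<lambda>n. expectation (\<lambda>\<omega>. iexp (\<Sum>i\<in>I. c i * scaled (D \<omega>) n (s i))))
    \<longlonglongrightarrow> exp (- ((\<Sum>i\<in>I. \<Sum>j\<in>I. c i * c j * limit_cov (s i) (s j)) / 2))"
proof -
  define m where "m i n = nat \<lfloor>real n * s i\<rfloor>" for i n
  obtain R :: nat where R: "(\<Sum>i\<in>I. s i) \<le> real R" "R \<ge> 1"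
    using real_arch_simple[of "max 1 (\<Sum>i\<in>I. s i)"] by (metis max.bounded_iff of_nat_1 of_nat_le_iff)
  have sR: "s i \<le> real R" if "i \<in> I" for i
  proof -
    have "s i \<le> (\<Sum>i\<in>I. s i)" using I s that by (intro member_le_sum) (auto intro: less_imp_le)
    then show ?thesis using R by linarith
  qed
  \<comment> \<open>The 4 comes from \<open>m i n \<ge> n s_i / 2\<close>, which gives
    \<open>\<surd>n / (m i n)^2 \<le> 4 / (s_i^2 n^(3/2))\<close>.\<close>
  define A0 where "A0 = (\<Sum>i\<in>I. \<bar>c i\<bar> * 4 / (s i)\<^sup>2)"
  have A00: "A0 \<ge> 0" unfolding A0_def by (intro sum_nonneg) auto
  \<comment> \<open>The coefficient of the increment \<open>l\<close> collects all times
    \<open>i\<close> whose index \<open>m i n\<close> lies beyond \<open>l\<close>.\<close>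
  define \<gamma> where "\<gamma> n l = (\<Sum>i\<in>I. c i * (sqrt (real n) / (real (m i n))\<^sup>2) * of_bool (l < m i n))"
      for n l
  define A where "A n = A0 / (real n * sqrt (real n))" for n
  define drift where "drift n = (\<Sum>i\<in>I. c i * (sqrt (real n) / (2 * real (m i n))))" for n
  \<comment> \<open>A horizon beyond all \<open>m i n\<close>, so that one range of increments
    serves for every time.\<close>
  define Q where "Q n = n * R" for n
  define err where "err n
      = real (Q n) * (A n ^ 3 * real (Q n) ^ 3 / 6 + (A n)\<^sup>2 * real (Q n) / 2 + A n ^ 4
      * real (Q n) ^ 4 / 128)" for n
  define var where "var n = (\<Sum>l = 1..<Q n. (\<gamma> n l)\<^sup>2 * (real (Suc l))\<^sup>2 / 8)" for n
  have large: "\<forall>\<^sub>F n in sequentially. \<forall>i\<in>I. real n * s i \<ge> 1"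
  proof (rule eventually_ball_finite[OF I], rule ballI)
    fix i assume i: "i \<in> I"
    obtain n0 :: nat where n0: "1 / s i \<le> real n0" using real_arch_simple by blast
    show "\<forall>\<^sub>F n in sequentially. real n * s i \<ge> 1"
      using eventually_ge_at_top[of n0]
    proof eventually_elim
      case (elim n)
      then have "1 / s i \<le> real n" using n0 by linarith
      then show ?case using s[OF i] by (simp add: divide_le_eq)
    qed
  qed
  have good: "\<forall>\<^sub>F n in sequentially. n \<ge> 1
      \<and> (\<forall>i\<in>I. m i n \<ge> 1 \<and> m i n \<le> Q n \<and> real n * s i / 2 \<le> real (m i n))"
    using large eventually_ge_at_top[of 1]
  proof eventually_elim
    case (elim n)
    show ?case
    proof (intro conjI ballI)
      fix i assume i: "i \<in> I"
      note h = half_le_floor[of "real n * s i"]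
      show "m i n \<ge> 1" "real n * s i / 2 \<le> real (m i n)" using h elim i by (auto simp: m_def)
      have "real (m i n) \<le> real n * s i" using h elim i by (auto simp: m_def)
      also have "\<dots> \<le> real n * real R" using sR[OF i] by (intro mult_left_mono) auto
      finally show "m i n \<le> Q n" unfolding Q_def by (simp flip: of_nat_mult)
    qed (use elim in simp)
  qed
  have split: "\<forall>\<^sub>F n in sequentially. expectation (\<lambda>\<omega>. iexp (\<Sum>i\<in>I. c i * scaled (D \<omega>) n (s i)))
     = iexp (- drift n) * expectation (\<lambda>\<omega>. iexp (phase (\<gamma> n) (Q n) (D \<omega>)))"
    using good
  proof eventually_elim
    case (elim n)
    have "(\<Sum>i\<in>I. c i * scaled (D \<omega>) n (s i)) = - drift n + phase (\<gamma> n) (Q n) (D \<omega>)" for \<omega>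
    proof -
      have "c i * scaled (D \<omega>) n (s i) = c i * (sqrt (real n) / (real (m i n))\<^sup>2)
          * mart (D \<omega>) (m i n) - c i * (sqrt (real n) / (2 * real (m i n)))" if "i \<in> I" for i
        using scaled_eq_mart[of "m i n" n "s i" "D \<omega>"] elim that
            by (simp add: m_def right_diff_distrib)
      then have "(\<Sum>i\<in>I. c i * scaled (D \<omega>) n (s i))
          = (\<Sum>i\<in>I. c i * (sqrt (real n) / (real (m i n))\<^sup>2) * mart (D \<omega>) (m i n)) - drift n"
        unfolding drift_def by (simp add: sum_subtractf)
      also have "(\<Sum>i\<in>I. c i * (sqrt (real n) / (real (m i n))\<^sup>2) * mart (D \<omega>) (m i n))
        = (\<Sum>i\<in>I. \<Sum>l = 1..<Q n. c i * (sqrt (real n) / (real (m i n))\<^sup>2) * of_bool (l < m i n)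
            * incr (D \<omega>) l)"
      proof (rule sum.cong[OF refl])
        fix i assume i: "i \<in> I"
        have "mart (D \<omega>) (m i n) = (\<Sum>l = 1..<m i n. incr (D \<omega>) l)"
          by (rule mart_telescope) (use elim i in auto)
        also have "\<dots> = (\<Sum>l = 1..<Q n. of_bool (l < m i n) * incr (D \<omega>) l)"
          using elim i by (intro sum.mono_neutral_cong_left) auto
        finally show "c i * (sqrt (real n) / (real (m i n))\<^sup>2) * mart (D \<omega>) (m i n)
          = (\<Sum>l = 1..<Q n. c i * (sqrt (real n) / (real (m i n))\<^sup>2) * of_bool (l < m i n)
              * incr (D \<omega>) l)"
          by (simp only: sum_distrib_left mult.assoc)
      qed
      also have "\<dots> = phase (\<gamma> n) (Q n) (D \<omega>)"
        unfolding phase_def \<gamma>_def sum_distrib_right by (rule sum.swap)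
      finally show ?thesis by simp
    qed
    then have "iexp (\<Sum>i\<in>I. c i * scaled (D \<omega>) n (s i))
        = iexp (- drift n) * iexp (phase (\<gamma> n) (Q n) (D \<omega>))" for \<omega>
      by (simp only: of_real_add distrib_left exp_add)
    then show ?case by simp
  qed
  have gA: "\<bar>\<gamma> n l\<bar> \<le> A n"
      if n: "n \<ge> 1" "\<forall>i\<in>I. m i n \<ge> 1 \<and> m i n \<le> Q n \<and> real n * s i / 2 \<le> real (m i n)" for n l
  proof -
    have "\<bar>\<gamma> n l\<bar> \<le> (\<Sum>i\<in>I. \<bar>c i * (sqrt (real n) / (real (m i n))\<^sup>2) * of_bool (l < m i n)\<bar>)"
      unfolding \<gamma>_def by (rule sum_abs)
    also have "\<dots> \<le> (\<Sum>i\<in>I. (\<bar>c i\<bar> * 4 / (s i)\<^sup>2) / (real n * sqrt (real n)))"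
    proof (rule sum_mono)
      fix i assume i: "i \<in> I"
      have "(real n * s i / 2)\<^sup>2 \<le> (real (m i n))\<^sup>2" using n(2) i s[OF i] by (intro power_mono) auto
      then have "sqrt (real n) / (real (m i n))\<^sup>2 \<le> sqrt (real n) / (real n * s i / 2)\<^sup>2"
      proof (rule divide_left_mono)
        have "real (m i n) > 0" using n(2) i by (simp add: Suc_le_eq)
        then show "0 < (real (m i n))\<^sup>2 * (real n * s i / 2)\<^sup>2" using n(1) s[OF i] by simp
      qed auto
      also have "\<dots> = 4 / (s i)\<^sup>2 / (real n * sqrt (real n))"
      proof -
        have "real n = sqrt (real n) * sqrt (real n)" "sqrt (real n) > 0" using n by auto
        then have "sqrt (real n) * (real n * sqrt (real n)) = (real n)\<^sup>2"
            by (simp add: power2_eq_square)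
        then show ?thesis using n s[OF i] by (simp add: field_simps power2_eq_square)
      qed
      finally have "\<bar>c i\<bar> * (sqrt (real n) / (real (m i n))\<^sup>2)
          \<le> \<bar>c i\<bar> * (4 / (s i)\<^sup>2 / (real n * sqrt (real n)))"
        by (intro mult_left_mono) auto
      then show "\<bar>c i * (sqrt (real n) / (real (m i n))\<^sup>2) * of_bool (l < m i n)\<bar>
          \<le> (\<bar>c i\<bar> * 4 / (s i)\<^sup>2) / (real n * sqrt (real n))"
        by (auto simp: abs_mult of_bool_def)
    qed
    also have "\<dots> = A n" unfolding A_def A0_def by (simp add: sum_divide_distrib)
    finally show ?thesis .
  qed
  have "\<forall>\<^sub>F n in sequentially. cmod (expectation (\<lambda>\<omega>. iexp (phase (\<gamma> n) (Q n) (D \<omega>)))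
      - exp (- var n)) \<le> err n"
    using good
  proof eventually_elim
    case (elim n)
    have "1 \<le> Q n" using elim R by (simp add: Q_def)
    from char_phase[OF this order_refl, of "\<gamma> n" "A n"] gA elim
    show ?case unfolding err_def var_def by blast
  qed
  \<comment> \<open>With \<open>A\<close> of order \<open>n^(-3/2)\<close> and \<open>Q\<close> of
    order \<open>n\<close>, the three errors, multiplied by the number of steps, are of order
    \<open>n^(-1/2)\<close>, \<open>1 / n\<close> and \<open>1 / n\<close>.\<close>
  moreover have "err \<longlonglongrightarrow> 0"
  proof -
    have "\<forall>\<^sub>F n in sequentially. A0 ^ 3 * real R ^ 4 / 6 * (1 / sqrt (real n)) + A0\<^sup>2 * real R ^ 2
        / 2 * (1 / real n) + A0 ^ 4 * real R ^ 5 / 128 * (1 / real n) = err n"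
      using eventually_ge_at_top[of 1]
    proof eventually_elim
      case (elim n)
      define q where "q = sqrt (real n)"
      have q: "q > 0" "real n = q\<^sup>2" using elim by (auto simp: q_def)
      show ?case unfolding err_def A_def Q_def of_nat_mult q_def[symmetric] unfolding q(2)
          using q(1)
        by (simp add: power_mult_distrib power_divide field_simps flip: power_mult)
            (simp add: eval_nat_numeral)
    qed
    moreover have "(\<lambda>n. A0 ^ 3 * real R ^ 4 / 6 * (1 / sqrt (real n)) + A0\<^sup>2 * real R ^ 2 / 2
        * (1 / real n) + A0 ^ 4 * real R ^ 5 / 128 * (1 / real n)) \<longlonglongrightarrow>
       A0 ^ 3 * real R ^ 4 / 6 * 0 + A0\<^sup>2 * real R ^ 2 / 2 * 0 + A0 ^ 4 * real R ^ 5 / 128 * 0"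
    proof (intro tendsto_intros lim_1_over_n)
      have "(\<lambda>n. sqrt (1 / real n)) \<longlonglongrightarrow> sqrt 0" by (intro tendsto_intros lim_1_over_n)
      then show "(\<lambda>n. 1 / sqrt (real n)) \<longlonglongrightarrow> 0" by (simp add: real_sqrt_divide)
    qed
    ultimately show ?thesis by (simp add: Lim_transform_eventually)
  qed
  ultimately have diff: "(\<lambda>n. expectation (\<lambda>\<omega>. iexp (phase (\<gamma> n) (Q n) (D \<omega>))) - exp (- var n)) \<longlonglongrightarrow> 0"
    by (rule Lim_null_comparison)
  have m_lim: "(\<lambda>n. real (m i n) / real n) \<longlonglongrightarrow> s i" if "i \<in> I" for i
    unfolding m_def by (rule nat_floor_over_tendsto) (use s[OF that] in simp)
  have drift: "drift \<longlonglongrightarrow> 0"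
  proof -
    have "(\<lambda>n. \<Sum>i\<in>I. c i * (1 / sqrt (real n) * (1 / (2 * (real (m i n) / real n)))))
        \<longlonglongrightarrow> (\<Sum>i\<in>I. c i * (0 * (1 / (2 * s i))))"
    proof (intro tendsto_intros m_lim)
      have "(\<lambda>n. sqrt (1 / real n)) \<longlonglongrightarrow> sqrt 0" by (intro tendsto_intros lim_1_over_n)
      then show "(\<lambda>n. 1 / sqrt (real n)) \<longlonglongrightarrow> 0" by (simp add: real_sqrt_divide)
    qed (use s in \<open>auto simp: less_imp_neq[THEN not_sym]\<close>)
    moreover have "\<forall>\<^sub>F n in sequentially. (\<Sum>i\<in>I. c i
        * (1 / sqrt (real n) * (1 / (2 * (real (m i n) / real n))))) = drift n"
      using eventually_ge_at_top[of 1]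
    proof eventually_elim
      case (elim n)
      have "1 / sqrt (real n) * (1 / (2 * (x / real n))) = sqrt (real n) / (2 * x)" for x
      proof -
        have "sqrt (real n) > 0" "real n = sqrt (real n) * sqrt (real n)" using elim by auto
        then show ?thesis by (cases "x = 0") (auto simp: field_simps)
      qed
      then show ?case unfolding drift_def by simp
    qed
    ultimately show ?thesis by (simp add: Lim_transform_eventually)
  qed
  have var: "var \<longlonglongrightarrow> (\<Sum>i\<in>I. \<Sum>j\<in>I. c i * c j * limit_cov (s i) (s j)) / 2"
  proof -
    define p where "p i j n = nat \<lfloor>real n * min (s i) (s j)\<rfloor>" for i j n
    \<comment> \<open>Two times share the increments before the smaller of their indices; as the
      integer part is monotone, that index belongs to the smaller time.\<close>
    have p: "p i j n = min (m i n) (m j n)" for i j n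
    proof -
      have "\<lfloor>real n * min (s i) (s j)\<rfloor> = min \<lfloor>real n * s i\<rfloor> \<lfloor>real n * s j\<rfloor>"
      proof (cases "s i \<le> s j")
        case True
        then have "\<lfloor>real n * s i\<rfloor> \<le> \<lfloor>real n * s j\<rfloor>" by (intro floor_mono mult_left_mono) auto
        then show ?thesis using True by (simp add: min_def)
      next
        case False
        then have "\<lfloor>real n * s j\<rfloor> \<le> \<lfloor>real n * s i\<rfloor>" by (intro floor_mono mult_left_mono) auto
        then show ?thesis using False by (simp add: min_def)
      qed
      moreover have "nat (min x y) = min (nat x) (nat y)" for x y
        by arith
      ultimately show ?thesis unfolding p_def m_def by simp
    qed
    have p_lim: "(\<lambda>n. real (p i j n) / real n) \<longlonglongrightarrow> min (s i) (s j)" if "i \<in> I" "j \<in> I" for i j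
      unfolding p_def by (rule nat_floor_over_tendsto) (use s[OF that(1)] s[OF that(2)] in simp)
    \<comment> \<open>The entry of the quadratic form, written in \<open>p / n\<close>,
      \<open>m / n\<close> and \<open>1 / n\<close> only, so that its limit can be read off term by
      term.\<close>
    define g where "g i j n
        = c i * c j * (((real (p i j n) / real n) * (real (p i j n) / real n + 1 / real n)
        * (2 * (real (p i j n) / real n) + 1 / real n) / 6 - (1 / real n) ^ 3) / 8
        / ((real (m i n) / real n)\<^sup>2 * (real (m j n) / real n)\<^sup>2))" for i j n
    have ev: "\<forall>\<^sub>F n in sequentially. (\<Sum>i\<in>I. \<Sum>j\<in>I. g i j n) = var n"
      using good
    proof eventually_elim
      case (elim n)
      let ?k = "\<lambda>i. sqrt (real n) / (real (m i n))\<^sup>2"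
      have "var n = (\<Sum>l = 1..<Q n. \<Sum>i\<in>I. \<Sum>j\<in>I. c i * c j * (?k i * ?k j)
          * (of_bool (l < p i j n) * (real (Suc l))\<^sup>2 / 8))"
        unfolding var_def
      proof (rule sum.cong[OF refl])
        fix l
        have "(\<gamma> n l)\<^sup>2 = (\<Sum>i\<in>I. \<Sum>j\<in>I. c i * c j * (?k i * ?k j) * of_bool (l < p i j n))"
          unfolding \<gamma>_def power2_eq_square sum_product p
          by (intro sum.cong refl) (auto simp: of_bool_def)
        then show "(\<gamma> n l)\<^sup>2 * (real (Suc l))\<^sup>2 / 8
            = (\<Sum>i\<in>I. \<Sum>j\<in>I. c i * c j * (?k i * ?k j)
            * (of_bool (l < p i j n) * (real (Suc l))\<^sup>2 / 8))"
          by (simp only: sum_distrib_right sum_divide_distrib mult.assoc times_divide_eq_right)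
      qed
      also have "\<dots> = (\<Sum>i\<in>I. \<Sum>j\<in>I. \<Sum>l
          = 1..<Q n. c i * c j * (?k i * ?k j) * (of_bool (l < p i j n) * (real (Suc l))\<^sup>2 / 8))"
        by (subst sum.swap, intro sum.cong refl) (rule sum.swap)
      also have "\<dots> = (\<Sum>i\<in>I. \<Sum>j\<in>I. g i j n)"
      proof (intro sum.cong refl)
        fix i j assume ij: "i \<in> I" "j \<in> I"
        let ?p = "real (p i j n)"
        have p1: "p i j n \<ge> 1" "p i j n \<le> Q n" using elim ij unfolding p by auto
        have "(\<Sum>l = 1..<Q n. of_bool (l < p i j n) * (real (Suc l))\<^sup>2)
            = (\<Sum>l = 1..<p i j n. (real (Suc l))\<^sup>2)"
          using p1 by (intro sum.mono_neutral_cong_right) auto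
        also have "\<dots> = ?p * (?p + 1) * (2 * ?p + 1) / 6 - 1"
          by (rule sum_squares_closed[OF p1(1)])
        finally have "(\<Sum>l = 1..<Q n. c i * c j * (?k i * ?k j)
            * (of_bool (l < p i j n) * (real (Suc l))\<^sup>2 / 8))
          = c i * c j * (?k i * ?k j) * ((?p * (?p + 1) * (2 * ?p + 1) / 6 - 1) / 8)"
          by (simp only: sum_distrib_left[symmetric] sum_divide_distrib[symmetric])
        also have "\<dots> = g i j n"
        proof -
          have n0: "real n > 0" using elim by simp
          have k: "?k i * ?k j = real n / ((real (m i n))\<^sup>2 * (real (m j n))\<^sup>2)"
            using n0 by simp
          have "?p * (?p + 1) * (2 * ?p + 1) / 6 - 1
              = real n ^ 3 * ((?p / real n) * (?p / real n + 1 / real n)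
              * (2 * (?p / real n) + 1 / real n) / 6 - (1 / real n) ^ 3)"
          proof -
            define x where "x = ?p / real n"
            define y where "y = 1 / real n"
            have "?p = real n * x" "1 = real n * y" using n0 by (auto simp: x_def y_def)
            then have "?p * (?p + 1) * (2 * ?p + 1) / 6 - 1
                = (real n * x) * (real n * x + real n * y) * (2 * (real n * x) + real n * y) / 6
                - (real n * y) ^ 3"
              by simp
            also have "\<dots> = real n ^ 3 * (x * (x + y) * (2 * x + y) / 6 - y ^ 3)"
              by (simp add: power3_eq_cube field_simps)
            finally show ?thesis unfolding x_def y_def .
          qed
          moreover have "(real (m i n) / real n)\<^sup>2 * (real (m j n) / real n)\<^sup>2
              = (real (m i n))\<^sup>2 * (real (m j n))\<^sup>2 / real n ^ 4"
            by (simp add: power_divide flip: power_add)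
          moreover have "C * (real n / (a * b)) * (real n ^ 3 * z / 8)
              = C * (z / 8 / (a * b / real n ^ 4))" for C a b z
            using n0 by (simp add: eval_nat_numeral mult_ac)
          ultimately show ?thesis unfolding g_def k by (simp only:)
        qed
        finally show "(\<Sum>l = 1..<Q n. c i * c j * (?k i * ?k j)
            * (of_bool (l < p i j n) * (real (Suc l))\<^sup>2 / 8)) = g i j n" .
      qed
      finally show ?case ..
    qed
    have "(\<lambda>n. \<Sum>i\<in>I. \<Sum>j\<in>I. g i j n)
        \<longlonglongrightarrow> (\<Sum>i\<in>I. \<Sum>j\<in>I. c i * c j
        * ((min (s i) (s j) * (min (s i) (s j) + 0) * (2 * min (s i) (s j) + 0) / 6 - 0 ^ 3) / 8
        / ((s i)\<^sup>2 * (s j)\<^sup>2)))"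
      unfolding g_def
      by (intro tendsto_sum tendsto_mult tendsto_const tendsto_divide tendsto_diff tendsto_add
          tendsto_power p_lim m_lim lim_1_over_n)
         (use s in \<open>auto simp: less_imp_neq[THEN not_sym]\<close>)
    also have "(\<Sum>i\<in>I. \<Sum>j\<in>I. c i * c j
        * ((min (s i) (s j) * (min (s i) (s j) + 0) * (2 * min (s i) (s j) + 0) / 6 - 0 ^ 3) / 8
        / ((s i)\<^sup>2 * (s j)\<^sup>2)))
       = (\<Sum>i\<in>I. \<Sum>j\<in>I. c i * c j * limit_cov (s i) (s j)) / 2"
      unfolding sum_divide_distrib
    proof (intro sum.cong refl)
      fix i j assume ij: "i \<in> I" "j \<in> I"
      have "(min x y * (min x y + 0) * (2 * min x y + 0) / 6 - 0 ^ 3) / 8 / (x\<^sup>2 * y\<^sup>2)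
          = limit_cov x y / 2" if "x > 0" "y > 0" for x y :: real
        using that by (cases "x \<le> y") (auto simp: limit_cov_def min_def max_def power2_eq_square)
      from this[OF s[OF ij(1)] s[OF ij(2)]]
      show "c i * c j * ((min (s i) (s j) * (min (s i) (s j) + 0) * (2 * min (s i) (s j) + 0) / 6
          - 0 ^ 3) / 8 / ((s i)\<^sup>2 * (s j)\<^sup>2)) = c i * c j * limit_cov (s i) (s j) / 2"
        by (simp only: times_divide_eq_right)
    qed
    finally show ?thesis using ev by (rule Lim_transform_eventually)
  qed
  let ?v = "(\<Sum>i\<in>I. \<Sum>j\<in>I. c i * c j * limit_cov (s i) (s j)) / 2"
  have "(\<lambda>n. iexp (- drift n)
      * ((expectation (\<lambda>\<omega>. iexp (phase (\<gamma> n) (Q n) (D \<omega>))) - exp (- var n))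
      + complex_of_real (exp (- var n))))
     \<longlonglongrightarrow> iexp (- 0) * (0 + complex_of_real (exp (- ?v)))"
    by (intro tendsto_intros drift diff var)
  then have "(\<lambda>n. iexp (- drift n) * expectation (\<lambda>\<omega>. iexp (phase (\<gamma> n) (Q n) (D \<omega>))))
      \<longlonglongrightarrow> complex_of_real (exp (- ?v))"
    by simp
  then show ?thesis
    by (rule Lim_transform_eventually) (use split in eventually_elim, simp)
qed

end

section \<open>Oscillation of the scaled paths\<close>

text \<open>Three sources of change between the indices \<open>a\<close> and \<open>j\<close>: the
  martingale moves while the weight \<open>1 / a^2\<close> is kept, the weight moves while the
  martingale is kept, and the drift moves. The lower bound \<open>\<alpha> n\<close> on
  \<open>a\<close> keeps the weights under control; it is available because time starts at
  \<open>e > 0\<close>.\<close>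

lemma abs_scaled_diff_le:
  fixes x :: "nat \<Rightarrow> nat"
  assumes a: "a = nat \<lfloor>real n * s\<rfloor>" "1 \<le> a" "\<alpha> * real n \<le> real a"
      and j: "j = nat \<lfloor>real n * t\<rfloor>" "a \<le> j"
    and pos: "\<alpha> > 0" "n > 0" "h \<ge> 0" "\<Lambda> \<ge> 0" "\<kappa> \<ge> 0"
    and ja: "real j - real a \<le> h * real n"
    and S: "\<bar>mart x j - mart x a\<bar> \<le> \<kappa> * (real n * sqrt (real n))"
        and Mj: "\<bar>mart x j\<bar> \<le> \<Lambda> * (real n * sqrt (real n))"
  shows "\<bar>scaled x n t - scaled x n s\<bar> \<le> \<kappa> / \<alpha>\<^sup>2 + 2 * \<Lambda> * h / \<alpha> ^ 3 + 1 / (2 * \<alpha> * sqrt (real n))"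
proof -
  define N where "N = real n"
  define q where "q = sqrt N"
  define u where "u = real a"
  define w where "w = real j"
  have N: "N > 0" "N = q * q" "q > 0" using pos by (auto simp: N_def q_def)
  have u: "u \<ge> 1" "\<alpha> * N \<le> u" "u \<le> w" "w - u \<le> h * N" using a j ja by (auto simp: u_def w_def N_def)
  have u0: "u > 0" "w > 0" using u by auto
  have aN: "\<alpha> * N > 0" using pos N by simp
  have tri: "\<bar>u - v + w\<bar> \<le> \<bar>u\<bar> + \<bar>v\<bar> + \<bar>w\<bar>" for u v w :: real
    by linarith
  have eq: "scaled x n t - scaled x n s
      = q * ((mart x j - mart x a) / u\<^sup>2) - q * (mart x j * (1 / u\<^sup>2 - 1 / w\<^sup>2)) + q
      * (1 / (2 * u) - 1 / (2 * w))"
    unfolding scaled_eq_mart[OF a(1,2)] scaled_eq_mart[OF j(1) order_trans[OF a(2) j(2)]]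
    by (simp add: N_def[symmetric] q_def[symmetric] u_def[symmetric] w_def[symmetric]
        diff_divide_distrib algebra_simps)
  have "\<bar>scaled x n t - scaled x n s\<bar> \<le> \<bar>q * ((mart x j - mart x a) / u\<^sup>2)\<bar> + \<bar>q
      * (mart x j * (1 / u\<^sup>2 - 1 / w\<^sup>2))\<bar> + \<bar>q * (1 / (2 * u) - 1 / (2 * w))\<bar>"
    unfolding eq by (rule tri)
  also have "\<bar>q * ((mart x j - mart x a) / u\<^sup>2)\<bar> \<le> \<kappa> / \<alpha>\<^sup>2"
  proof -
    have "\<bar>q * ((mart x j - mart x a) / u\<^sup>2)\<bar> = q * (\<bar>mart x j - mart x a\<bar> / u\<^sup>2)"
      using N by (simp add: abs_mult)
    also have "\<dots> \<le> q * (\<kappa> * (N * q) / (\<alpha> * N)\<^sup>2)"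
      using S N aN u by (intro mult_left_mono frac_le power_mono) (auto simp: N_def q_def)
    also have "\<dots> = \<kappa> / \<alpha>\<^sup>2"
      unfolding N(2) using N(3) pos by (simp add: power2_eq_square field_simps)
    finally show ?thesis .
  qed
  also have "\<bar>q * (mart x j * (1 / u\<^sup>2 - 1 / w\<^sup>2))\<bar> \<le> 2 * \<Lambda> * h / \<alpha> ^ 3"
  proof -
    have "1 / u\<^sup>2 - 1 / w\<^sup>2 = (w - u) * (w + u) / (u\<^sup>2 * w\<^sup>2)"
      using u0 by (simp add: power2_eq_square field_simps)
    also have "\<dots> \<le> (h * N) * (2 * w) / (u\<^sup>2 * w\<^sup>2)"
      using u u0 pos N by (intro divide_right_mono mult_mono) auto
    also have "\<dots> = 2 * h * N / (u\<^sup>2 * w)" using u0 by (simp add: power2_eq_square mult_ac)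
    also have "\<dots> \<le> 2 * h * N / ((\<alpha> * N)\<^sup>2 * (\<alpha> * N))"
      using u u0 pos N aN by (intro divide_left_mono mult_mono power_mono mult_pos_pos) auto
    finally have 1: "1 / u\<^sup>2 - 1 / w\<^sup>2 \<le> 2 * h * N / ((\<alpha> * N)\<^sup>2 * (\<alpha> * N))" .
    have "u\<^sup>2 \<le> w\<^sup>2" using u u0 by (intro power_mono) auto
    then have 2: "0 \<le> 1 / u\<^sup>2 - 1 / w\<^sup>2" using u0 by (simp add: frac_le)
    have "\<bar>q * (mart x j * (1 / u\<^sup>2 - 1 / w\<^sup>2))\<bar> = q * (\<bar>mart x j\<bar> * (1 / u\<^sup>2 - 1 / w\<^sup>2))"
      using N 2 by (simp add: abs_mult)
    also have "\<dots> \<le> q * (\<Lambda> * (N * q) * (2 * h * N / ((\<alpha> * N)\<^sup>2 * (\<alpha> * N))))"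
      using Mj 1 2 N pos by (intro mult_left_mono mult_mono) (auto simp: N_def q_def)
    also have "\<dots> = 2 * \<Lambda> * h / \<alpha> ^ 3"
      unfolding N(2) using N(3) pos by (simp add: power2_eq_square power3_eq_cube mult_ac)
    finally show ?thesis .
  qed
  also have "\<bar>q * (1 / (2 * u) - 1 / (2 * w))\<bar> \<le> 1 / (2 * \<alpha> * sqrt (real n))"
  proof -
    have "1 / (2 * w) \<le> 1 / (2 * u)" "0 \<le> 1 / (2 * w)" using u u0 by (auto intro!: divide_left_mono)
    then have "\<bar>q\<bar> * \<bar>1 / (2 * u) - 1 / (2 * w)\<bar> \<le> q * (1 / (2 * u))"
      using N by (intro mult_mono) auto
    then have "\<bar>q * (1 / (2 * u) - 1 / (2 * w))\<bar> \<le> q * (1 / (2 * u))"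
      by (simp only: abs_mult)
    also have "\<dots> \<le> q * (1 / (2 * (\<alpha> * N)))"
      using u u0 aN N by (intro mult_left_mono divide_left_mono) auto
    also have "\<dots> = 1 / (2 * \<alpha> * sqrt (real n))"
      unfolding N_def[symmetric] q_def[symmetric] unfolding N(2) using N(3) pos by simp
    finally show ?thesis .
  qed
  finally show ?thesis by simp
qed

context random_insertions
begin

text \<open>The bad event is that the martingale moves by at least \<open>l n^(3/2)\<close> from the
  start of one of the \<open>k K\<close> blocks, or reaches \<open>L n^(3/2)\<close> up to index
  \<open>n R\<close>. By the maximal inequality a block costs \<open>16 R^4 / (k^2 l^4)\<close>, so
  all blocks together cost a multiple of \<open>1 / k\<close>.\<close>

lemma scaled_oscillation:
  assumes e: "e > 0" and T: "T > 0" and \<epsilon>: "\<epsilon> > 0" and \<eta>: "\<eta> > 0"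
  shows "\<exists>k\<ge>k0. \<exists>A. (\<forall>n. A n \<in> events) \<and> (\<forall>\<^sub>F n in sequentially. prob (A n) \<le> \<eta> \<and>
    (\<forall>\<omega>\<in>space M - A n. \<forall>t\<in>{0..<T}. \<bar>scaled (D \<omega>) n (e + t)
        - scaled (D \<omega>) n (e + real_of_int \<lfloor>real k * t\<rfloor> / real k)\<bar> \<le> \<epsilon>))"
proof -
  obtain K :: nat where K: "T \<le> real K" using real_arch_simple by blast
  obtain R :: nat where R: "e + real K \<le> real R" using real_arch_simple by blast
  have R1: "R \<ge> 1" using R e by (cases R) auto
  define \<alpha> where "\<alpha> = e / 2"
  have \<alpha>: "\<alpha> > 0" using e by (simp add: \<alpha>_def)
  \<comment> \<open>Makes the martingale part \<open>l / \<alpha>^2\<close> equal to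
    \<open>\<epsilon> / 3\<close>.\<close>
  define l where "l = \<epsilon> * \<alpha>\<^sup>2 / 3"
  have l: "l > 0" using \<epsilon> \<alpha> by (simp add: l_def)
  \<comment> \<open>The maximal inequality up to \<open>n R\<close> gives
    \<open>4 R^6 / L^4\<close>; as \<open>L \<ge> 1\<close>, a bound on \<open>L\<close> itself
    suffices. It is fixed before \<open>k\<close>, which has to be large in terms of
    \<open>L\<close>.\<close>
  define L where "L = max 1 (8 * real R ^ 6 / \<eta>)"
  have L: "L \<ge> 1" "4 * real R ^ 6 / L ^ 4 \<le> \<eta> / 2"
  proof -
    show L1: "L \<ge> 1" by (simp add: L_def)
    have "8 * real R ^ 6 / \<eta> \<le> L" by (simp add: L_def)
    also have "L \<le> L ^ 4" using L1 by (intro self_le_power) auto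
    finally show "4 * real R ^ 6 / L ^ 4 \<le> \<eta> / 2" using \<eta> L1 by (simp add: field_simps)
  qed
  \<comment> \<open>\<open>k1\<close> makes the blocks cost at most \<open>\<eta> / 2\<close>, and
    \<open>k2\<close> keeps the effect of the moving weight below
    \<open>\<epsilon> / 3\<close>.\<close>
  obtain k1 :: nat where k1: "16 * real K * real R ^ 4 / l ^ 4 * (2 / \<eta>) \<le> real k1"
      using real_arch_simple by blast
  obtain k2 :: nat where k2: "12 * L / (\<alpha> ^ 3 * \<epsilon>) \<le> real k2" using real_arch_simple by blast
  define k where "k = max k0 (max 1 (max k1 k2))"
  have k: "k \<ge> k0" "k \<ge> 1" "real k1 \<le> real k" "real k2 \<le> real k" by (auto simp: k_def)
  have kb1: "16 * real K * real R ^ 4 / (real k * l ^ 4) \<le> \<eta> / 2"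
  proof -
    have "16 * real K * real R ^ 4 / l ^ 4 * (2 / \<eta>) \<le> real k" using k1 k by linarith
    then show ?thesis using k l \<eta> by (simp add: field_simps)
  qed
  have kb2: "2 * L * (2 / real k) / \<alpha> ^ 3 \<le> \<epsilon> / 3"
  proof -
    have "12 * L / (\<alpha> ^ 3 * \<epsilon>) \<le> real k" using k2 k by linarith
    then show ?thesis using k \<alpha> \<epsilon> by (simp add: field_simps)
  qed
  define a where "a i n = nat \<lfloor>real n * (e + real i / real k)\<rfloor>" for i n
  define r where "r n = real n * sqrt (real n)" for n
  define A where "A n = (\<Union>i<k * K. {\<omega> \<in> space M. exceeds (a i n) (a (Suc i) n) (l * r n) (D \<omega>)}) \<union>
      {\<omega> \<in> space M. exceeds 1 (n * R) (L * r n) (D \<omega>)}" for n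
  have A: "A n \<in> events" for n
    unfolding A_def by (intro sets.Un sets.finite_UN exceeds_measurable) auto
  obtain n1 :: nat where n1: "1 / e \<le> real n1" using real_arch_simple by blast
  have "(\<lambda>n. sqrt (1 / real n)) \<longlonglongrightarrow> sqrt 0" by (intro tendsto_intros lim_1_over_n)
  then have "(\<lambda>n. 1 / (2 * \<alpha>) * (1 / sqrt (real n))) \<longlonglongrightarrow> 1 / (2 * \<alpha>) * 0"
    by (intro tendsto_intros) (simp add: real_sqrt_divide)
  then have "\<forall>\<^sub>F n in sequentially. 1 / (2 * \<alpha>) * (1 / sqrt (real n)) < \<epsilon> / 3"
    by (rule order_tendstoD) (use \<epsilon> in simp)
  then have main: "\<forall>\<^sub>F n in sequentially. prob (A n) \<le> \<eta> \<and>
    (\<forall>\<omega>\<in>space M - A n. \<forall>t\<in>{0..<T}. \<bar>scaled (D \<omega>) n (e + t)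
        - scaled (D \<omega>) n (e + real_of_int \<lfloor>real k * t\<rfloor> / real k)\<bar> \<le> \<epsilon>)"
    using eventually_ge_at_top[of n1] eventually_ge_at_top[of k]
  proof eventually_elim
    case (elim n)
    have n: "n \<ge> 1" "real n \<ge> real k" using elim k by auto
    have "real n1 \<le> real n" using elim by simp
    then have "1 / e \<le> real n" using n1 by linarith
    then have ne: "1 \<le> real n * e" using e by (simp add: divide_le_eq)
    have r: "r n > 0" "r n ^ 4 = real n ^ 6"
    proof -
      show "r n > 0" using n by (simp add: r_def)
      have "r n ^ 2 = real n ^ 3"
          by (simp add: r_def power_mult_distrib power3_eq_cube power2_eq_square)
      then have "(r n ^ 2) ^ 2 = (real n ^ 3) ^ 2" by simp
      then show "r n ^ 4 = real n ^ 6" by (simp flip: power_mult)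
    qed
    have mono: "nat \<lfloor>real n * u\<rfloor> \<le> nat \<lfloor>real n * v\<rfloor>" if "u \<le> v" for u v
      using that by (intro nat_mono floor_mono mult_left_mono) auto
    have ge: "1 \<le> nat \<lfloor>real n * (e + u)\<rfloor>" "\<alpha> * real n \<le> real (nat \<lfloor>real n * (e + u)\<rfloor>)" if "u \<ge> 0"
        for u
    proof -
      have "real n * e \<le> real n * (e + u)" using that by (intro mult_left_mono) auto
      then have h: "1 \<le> real n * (e + u)" "\<alpha> * real n \<le> real n * (e + u) / 2" using ne
          by (auto simp: \<alpha>_def mult.commute)
      from half_le_floor[OF h(1)] h(2) show "1 \<le> nat \<lfloor>real n * (e + u)\<rfloor>"
          "\<alpha> * real n \<le> real (nat \<lfloor>real n * (e + u)\<rfloor>)"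
        by linarith+
    qed
    \<comment> \<open>A block has length \<open>n / k\<close> up to a rounding error of 1, which
      \<open>n \<ge> k\<close> absorbs into a second \<open>n / k\<close>.\<close>
    have a_Suc: "real (a (Suc i) n) - real (a i n) \<le> 2 / real k * real n" for i
    proof -
      have p: "0 \<le> real n * (e + real i / real k)" "0 \<le> real n * (e + real (Suc i) / real k)"
          using e by auto
      have gen: "x' - x \<le> z" if "y' = y + d" "x' \<le> y'" "y < x + 1" "1 \<le> d" "z = d + d"
          for x x' y y' d z :: real
        using that by linarith
      have "real n * (e + real (Suc i) / real k) = real n * (e + real i / real k) + real n / real k"
        using k by (simp add: field_simps)
      moreover have "real (a (Suc i) n) \<le> real n * (e + real (Suc i) / real k)"
        unfolding a_def using p(2) by linarith
      moreover have "real n * (e + real i / real k) < real (a i n) + 1"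
        unfolding a_def by linarith
      moreover have "1 \<le> real n / real k" using n k by (simp add: le_divide_eq)
      moreover have "2 / real k * real n = real n / real k + real n / real k" by simp
      ultimately show ?thesis by (rule gen)
    qed
    have le_R: "nat \<lfloor>real n * (e + u)\<rfloor> \<le> n * R" if "u \<le> real K" for u
    proof -
      have "real n * (e + u) \<le> real n * real R" using that R by (intro mult_left_mono) auto
      then have "\<lfloor>real n * (e + u)\<rfloor> \<le> int (n * R)" by (simp add: floor_le_iff)
      then show ?thesis by (simp only: nat_le_iff)
    qed
    have "prob (A n) \<le> \<eta>"
    proof -
      have "prob (A n) \<le> prob
          (\<Union>i<k * K. {\<omega> \<in> space M. exceeds (a i n) (a (Suc i) n) (l * r n) (D \<omega>)})
          + prob {\<omega> \<in> space M. exceeds 1 (n * R) (L * r n) (D \<omega>)}"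
        unfolding A_def by (intro measure_Un_le sets.finite_UN exceeds_measurable) auto
      also have "prob (\<Union>i<k * K. {\<omega> \<in> space M. exceeds (a i n) (a (Suc i) n) (l * r n) (D \<omega>)})
          \<le> (\<Sum>i<k * K. prob {\<omega> \<in> space M. exceeds (a i n) (a (Suc i) n) (l * r n) (D \<omega>)})"
        by (intro measure_UNION_le exceeds_measurable) auto
      also have "\<dots> \<le> (\<Sum>i<k * K. 16 * real R ^ 4 / ((real k)\<^sup>2 * l ^ 4))"
      proof (rule sum_mono)
        fix i assume "i \<in> {..<k * K}"
        then have i: "Suc i \<le> k * K" by simp
        have b: "a (Suc i) n \<le> n * R"
        proof -
          have "real (Suc i) \<le> real k * real K" using i
              by (simp only: of_nat_le_iff flip: of_nat_mult)
          then have "real (Suc i) / real k \<le> real K" using k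
              by (simp add: divide_le_eq mult.commute)
          then show ?thesis unfolding a_def by (rule le_R)
        qed
        have ab: "a i n \<le> a (Suc i) n" unfolding a_def by (rule mono) (simp add: divide_right_mono)
        have a1: "1 \<le> a i n" unfolding a_def by (rule ge) simp
        have "prob {\<omega> \<in> space M. exceeds (a i n) (a (Suc i) n) (l * r n) (D \<omega>)}
            \<le> 4 * (real (a (Suc i) n) - real (a i n))\<^sup>2 * real (a (Suc i) n) ^ 4 / (l * r n) ^ 4"
          by (rule maximal_inequality[OF a1 ab]) (use l r in simp)
        also have "\<dots> \<le> 4 * (2 / real k * real n)\<^sup>2 * real (n * R) ^ 4 / (l * r n) ^ 4"
        proof (intro divide_right_mono mult_mono power_mono a_Suc)
          show "real (a (Suc i) n) \<le> real (n * R)" using b by (simp only: of_nat_le_iff)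
        qed (use ab l r in auto)
        also have "\<dots> = 16 * real R ^ 4 / ((real k)\<^sup>2 * l ^ 4)"
          unfolding power_mult_distrib[of l] r(2) using n l k
          by (simp add: power_mult_distrib power_divide eval_nat_numeral)
        finally show "prob {\<omega> \<in> space M. exceeds (a i n) (a (Suc i) n) (l * r n) (D \<omega>)}
            \<le> 16 * real R ^ 4 / ((real k)\<^sup>2 * l ^ 4)" .
      qed
      also have "\<dots> = 16 * real K * real R ^ 4 / (real k * l ^ 4)"
        using k by (simp add: power2_eq_square)
      also have "\<dots> \<le> \<eta> / 2" by (rule kb1)
      also have "prob {\<omega> \<in> space M. exceeds 1 (n * R) (L * r n) (D \<omega>)}
          \<le> 4 * (real (n * R) - real 1)\<^sup>2 * real (n * R) ^ 4 / (L * r n) ^ 4"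
        by (rule maximal_inequality) (use n R1 L r in \<open>auto simp: Suc_le_eq\<close>)
      also have "\<dots> \<le> 4 * (real (n * R))\<^sup>2 * real (n * R) ^ 4 / (L * r n) ^ 4"
        using n R1 by (intro divide_right_mono mult_right_mono mult_left_mono power_mono)
            (auto simp: Suc_le_eq simp flip: of_nat_mult)
      also have "\<dots> = 4 * real R ^ 6 / L ^ 4"
        unfolding power_mult_distrib[of L] r(2) using n L
            by (simp add: power_mult_distrib eval_nat_numeral)
      also have "\<dots> \<le> \<eta> / 2" by (rule L(2))
      finally show ?thesis by simp
    qed
    moreover have "\<bar>scaled (D \<omega>) n (e + t) - scaled (D \<omega>) n (e + real_of_int \<lfloor>real k * t\<rfloor> / real k)\<bar>
        \<le> \<epsilon>"
      if w: "\<omega> \<in> space M - A n" and t: "t \<in> {0..<T}" for \<omega> t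
    proof -
      define i where "i = nat \<lfloor>real k * t\<rfloor>"
      have t0: "0 \<le> t" "t < real K" using t K by auto
      have i: "real_of_int \<lfloor>real k * t\<rfloor> = real i" using t0 by (simp add: i_def)
      have "real i \<le> real k * t" "real k * t < real (Suc i)" using i by linarith+
      then have it: "real i / real k \<le> t" "t \<le> real (Suc i) / real k" using k
          by (auto simp: field_simps)
      have iK: "i < k * K"
      proof -
        have "real k * t < real k * real K" using t0 k by (intro mult_strict_left_mono) auto
        with \<open>real i \<le> real k * t\<close> have "real i < real (k * K)" by simp
        then show ?thesis by (simp only: of_nat_less_iff)
      qed
      define j where "j = nat \<lfloor>real n * (e + t)\<rfloor>"
      have j: "a i n \<le> j" "j \<le> a (Suc i) n" unfolding a_def j_def by (intro mono; use it in simp)+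
      have j1: "1 \<le> j" unfolding j_def by (rule ge) (use t0 in simp)
      have jR: "j \<le> n * R" unfolding j_def by (rule le_R) (use t0 in simp)
      have "\<not> exceeds (a i n) (a (Suc i) n) (l * r n) (D \<omega>)" using w iK unfolding A_def by auto
      then have S: "\<bar>mart (D \<omega>) j - mart (D \<omega>) (a i n)\<bar> \<le> l * r n"
        using j unfolding exceeds_def by (meson atLeastAtMost_iff linear)
      have "\<not> exceeds 1 (n * R) (L * r n) (D \<omega>)" using w unfolding A_def by auto
      then have "\<bar>mart (D \<omega>) j - mart (D \<omega>) 1\<bar> \<le> L * r n"
        using j1 jR unfolding exceeds_def by (meson atLeastAtMost_iff linear)
      then have Mj: "\<bar>mart (D \<omega>) j\<bar> \<le> L * r n" unfolding mart_D_1 by simp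
      have "\<bar>scaled (D \<omega>) n (e + t) - scaled (D \<omega>) n (e + real i / real k)\<bar>
          \<le> l / \<alpha>\<^sup>2 + 2 * L * (2 / real k) / \<alpha> ^ 3 + 1 / (2 * \<alpha> * sqrt (real n))"
      proof (rule abs_scaled_diff_le[OF a_def[of i n] _ _ j_def j(1)])
        show "1 \<le> a i n" "\<alpha> * real n \<le> real (a i n)" unfolding a_def by (rule ge; simp)+
        have "real j \<le> real (a (Suc i) n)" using j by simp
        then show "real j - real (a i n) \<le> 2 / real k * real n" using a_Suc[of i] by linarith
      qed (use S Mj \<alpha> n L l in \<open>auto simp: r_def\<close>)
      also have "l / \<alpha>\<^sup>2 = \<epsilon> / 3" using \<alpha> by (simp add: l_def)
      also have "2 * L * (2 / real k) / \<alpha> ^ 3 \<le> \<epsilon> / 3" by (rule kb2)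
      also have "1 / (2 * \<alpha> * sqrt (real n)) \<le> \<epsilon> / 3" using elim(1) by simp
      finally show ?thesis unfolding i by simp
    qed
    ultimately show ?case by blast
  qed
  show ?thesis using k(1) A main by blast
qed

end

section \<open>Convergence of the scaled descent process\<close>

context random_insertions
begin

text \<open>Shifting time by \<open>e\<close> keeps all evaluation times positive, where the
  variances \<open>1 / (12 (e + t))\<close> of the limit are bounded by
  \<open>1 / (12 e)\<close>.\<close>

lemma descent_process_converges:
  assumes e: "e > 0"
  shows "converges_in_distribution skorokhod
     M (\<lambda>n \<omega>. path_from e (descent_process (\<lambda>m. V m \<omega>) n))
     gauss_space (\<lambda>\<omega>. path_from e (\<lambda>t. limit_process t \<omega>))"
proof -
  interpret gs: prob_space gauss_space by (rule prob_space_gauss_space)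
  have at: "path_from e x t = x (e + t)" if "t \<ge> 0" for x t
    using that by (simp add: path_from_def)
  have cont: "continuous_on {0..} (\<lambda>t. limit_process (e + t) \<omega>)" for \<omega>
    by (rule continuous_on_compose2[OF limit_process_continuous])
        (use e in \<open>auto intro!: continuous_intros\<close>)
  have second: "integrable gauss_space (\<lambda>\<omega>. (limit_process t \<omega>)\<^sup>2)"
    "(\<integral>\<omega>. (limit_process t \<omega>)\<^sup>2 \<partial>gauss_space) = limit_cov t t" for t
    using limit_process_gaussian(4,5)[of "{()}" "\<lambda>_. 1" "\<lambda>_. t"] by auto
  interpret skorokhod_convergence M gauss_space "\<lambda>n \<omega>. path_from e (scaled (D \<omega>) n)"
    "\<lambda>\<omega>. path_from e (\<lambda>t. limit_process t \<omega>)"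
  proof unfold_locales
    show "(\<lambda>\<omega>. path_from e (scaled (D \<omega>) n)) \<in> measurable M (borel_of_topology skorokhod)" for n
      by (rule path_measurable[OF e])
    show "(\<lambda>\<omega>. path_from e (scaled (D \<omega>) n) t) \<in> borel_measurable M" if "t \<ge> 0" for n t
      using scaled_measurable at[OF that] by simp
    show "path_from e (\<lambda>t. limit_process t \<omega>) \<in> skorokhod_space" for \<omega>
      unfolding path_from_def by (rule continuous_in_skorokhod_space[OF cont])
    show "continuous_on {0..} (path_from e (\<lambda>t. limit_process t \<omega>))" for \<omega>
      by (rule continuous_on_eq[OF cont]) (auto simp: path_from_def)
    show "(\<lambda>\<omega>. path_from e (\<lambda>t. limit_process t \<omega>) t) \<in> borel_measurable gauss_space" if "t \<ge> 0"
        for t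
      using at[OF that] by simp
    show "(\<lambda>n. \<integral>\<omega>. iexp (\<Sum>i<m. c i * path_from e (scaled (D \<omega>) n) (real i / real k)) \<partial>M)
        \<longlonglongrightarrow> (\<integral>\<omega>. iexp (\<Sum>i<m. c i * path_from e (\<lambda>t. limit_process t \<omega>) (real i / real k))
            \<partial>gauss_space)"
      if "k > 0" for k m :: nat and c
    proof -
      have "(\<lambda>n. \<integral>\<omega>. iexp (\<Sum>i<m. c i * scaled (D \<omega>) n (e + real i / real k)) \<partial>M)
        \<longlonglongrightarrow> (\<integral>\<omega>. iexp (\<Sum>i<m. c i * limit_process (e + real i / real k) \<omega>) \<partial>gauss_space)"
        unfolding limit_process_char[OF finite_lessThan]
        by (rule scaled_char) (use e in \<open>auto intro: add_pos_nonneg\<close>)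
      then show ?thesis by (simp add: at)
    qed
    show "integrable M (\<lambda>\<omega>. (path_from e (scaled (D \<omega>) n) t)\<^sup>2)" if "t \<ge> 0" for n t
      using scaled_square_integrable at[OF that] by simp
    show "\<exists>C. \<forall>n. \<forall>t\<in>{0..T}. (\<integral>\<omega>. (path_from e (scaled (D \<omega>) n) t)\<^sup>2 \<partial>M) \<le> C" for T
      by (rule exI[of _ "8 / e"]) (use scaled_second_moment[OF e] in \<open>auto simp: at\<close>)
    show "integrable gauss_space (\<lambda>\<omega>. (path_from e (\<lambda>t. limit_process t \<omega>) t)\<^sup>2)" if "t \<ge> 0" for t
      using second(1) at[OF that] by simp
    show "\<exists>C. \<forall>t\<in>{0..T}. (\<integral>\<omega>. (path_from e (\<lambda>t. limit_process t \<omega>) t)\<^sup>2 \<partial>gauss_space) \<le> C" for T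
    proof (rule exI[of _ "1 / (12 * e)"], rule ballI)
      fix t assume t: "t \<in> {0..T}"
      have "limit_cov (e + t) (e + t) = 1 / (12 * (e + t))"
        using t e by (simp add: limit_cov_def power2_eq_square)
      also have "\<dots> \<le> 1 / (12 * e)" using t e by (intro divide_left_mono) auto
      finally show "(\<integral>\<omega>. (path_from e (\<lambda>t. limit_process t \<omega>) t)\<^sup>2 \<partial>gauss_space) \<le> 1 / (12 * e)"
        using t by (simp add: at second(2))
    qed
    show "\<exists>k\<ge>k0. \<exists>A. (\<forall>n. A n \<in> events) \<and> (\<forall>\<^sub>F n in sequentially. prob (A n) \<le> \<eta> \<and>
           (\<forall>\<omega>\<in>space M - A n. \<forall>t\<in>{0..<T}. \<bar>path_from e (scaled (D \<omega>) n) t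
               - path_from e (scaled (D \<omega>) n) (real_of_int \<lfloor>real k * t\<rfloor> / real k)\<bar> \<le> \<epsilon>))"
      if pos: "T > 0" "\<epsilon> > 0" "\<eta> > 0" for T \<epsilon> \<eta> and k0 :: nat
    proof -
      obtain k A where k: "k \<ge> k0" "\<forall>n. A n \<in> events"
          and ev: "\<forall>\<^sub>F n in sequentially. prob (A n) \<le> \<eta> \<and>
         (\<forall>\<omega>\<in>space M - A n. \<forall>t\<in>{0..<T}. \<bar>scaled (D \<omega>) n (e + t)
             - scaled (D \<omega>) n (e + real_of_int \<lfloor>real k * t\<rfloor> / real k)\<bar> \<le> \<epsilon>)"
        using scaled_oscillation[OF e pos, of k0] by blast
      have "path_from e x (real_of_int \<lfloor>real k * t\<rfloor> / real k)
          = x (e + real_of_int \<lfloor>real k * t\<rfloor> / real k)"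
        "path_from e x t = x (e + t)" if "t \<in> {0..<T}" for t x
        using that by (simp_all add: at)
      with ev have "\<forall>\<^sub>F n in sequentially. prob (A n) \<le> \<eta> \<and>
         (\<forall>\<omega>\<in>space M - A n. \<forall>t\<in>{0..<T}. \<bar>path_from e (scaled (D \<omega>) n) t
             - path_from e (scaled (D \<omega>) n) (real_of_int \<lfloor>real k * t\<rfloor> / real k)\<bar> \<le> \<epsilon>)"
        by (simp only: cong: ball_cong)
      then show ?thesis using k by blast
    qed
  qed
  show ?thesis
    unfolding descent_process_eq by (rule converges_in_distribution)
qed

text \<open>At the single time 1, \<open>scaled (D \<omega>) n 1\<close> is the normalised number of
  descents and the limit has variance \<open>limit_cov 1 1 = 1 / 12\<close>. Levy's continuity
  theorem turns convergence of the characteristic functions into convergence in law.\<close>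

lemma descents_asymptotically_normal:
  "weak_conv_m
     (\<lambda>n. distr M borel (\<lambda>\<omega>. sqrt (real n) * (real (descents (\<lambda>m. V m \<omega>) n) / real n - 1 / 2)))
     (density lborel (normal_density 0 (sqrt (1 / 12))))"
proof -
  interpret gs: prob_space gauss_space by (rule prob_space_gauss_space)
  let ?W = "limit_process 1"
  have eq: "sqrt (real n) * (real (descents (\<lambda>m. V m \<omega>) n) / real n - 1 / 2) = scaled (D \<omega>) n 1"
      for n \<omega>
    by (simp add: scaled_def D_def)
  have "distributed gauss_space lborel ?W (normal_density 0 (sqrt (1 / 12)))"
    using limit_process_gaussian(6)[of "{()}" "\<lambda>_. 1" "\<lambda>_. 1"] by (simp add: limit_cov_def)
  then have "distr gauss_space lborel ?W = density lborel (normal_density 0 (sqrt (1 / 12)))"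
    by (rule distributed_distr_eq_density)
  moreover have "distr gauss_space lborel ?W = distr gauss_space borel ?W"
    by (rule distr_cong) auto
  ultimately have dW: "density lborel (normal_density 0 (sqrt (1 / 12)))
      = distr gauss_space borel ?W" by simp
  show ?thesis
    unfolding eq dW
  proof (rule levy_continuity)
    show "real_distribution (distr M borel (\<lambda>\<omega>. scaled (D \<omega>) n 1))" for n
      by (rule real_distribution_distr) (rule scaled_measurable)
    show "real_distribution (distr gauss_space borel ?W)"
      by (rule gs.real_distribution_distr) measurable
    fix u :: real
    have "(\<lambda>n. \<integral>\<omega>. iexp (\<Sum>i\<in>{()}. u * scaled (D \<omega>) n 1) \<partial>M)
        \<longlonglongrightarrow> (\<integral>\<omega>. iexp (\<Sum>i\<in>{()}. u * limit_process 1 \<omega>) \<partial>gauss_space)"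
      unfolding limit_process_char[of "{()}" "\<lambda>_. u" "\<lambda>_. 1", simplified finite.emptyI
          finite_insert, OF TrueI] by (rule scaled_char) auto
    then show "(\<lambda>n. char (distr M borel (\<lambda>\<omega>. scaled (D \<omega>) n 1)) u)
        \<longlonglongrightarrow> char (distr gauss_space borel ?W) u"
      unfolding char_def using scaled_measurable by (simp add: integral_distr)
  qed
qed

end

text \<open>Polarisation, as the Gaussian lemma gives second moments of linear combinations.
  Indexing the two times by booleans admits \<open>s = t\<close>.\<close>

lemma limit_process_covariance:
  assumes "0 < s" "s \<le> t"
  shows "integrable gauss_space (\<lambda>\<omega>. limit_process s \<omega> * limit_process t \<omega>)"
    and "(\<integral>\<omega>. limit_process s \<omega> * limit_process t \<omega> \<partial>gauss_space) = s / (12 * t\<^sup>2)"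
proof -
  let ?S = "limit_process s" and ?T = "limit_process t"
  have one: "integrable gauss_space (\<lambda>\<omega>. (limit_process r \<omega>)\<^sup>2)"
    "(\<integral>\<omega>. (limit_process r \<omega>)\<^sup>2 \<partial>gauss_space) = limit_cov r r" for r
    using limit_process_gaussian(4,5)[of "{()}" "\<lambda>_. 1" "\<lambda>_. r"] by auto
  have two: "integrable gauss_space (\<lambda>\<omega>. (?S \<omega> + ?T \<omega>)\<^sup>2)"
    "(\<integral>\<omega>. (?S \<omega> + ?T \<omega>)\<^sup>2 \<partial>gauss_space) = limit_cov s s + 2 * limit_cov s t + limit_cov t t"
    using limit_process_gaussian(4,5)[of UNIV "\<lambda>_. 1" "\<lambda>b. if b then s else t"]
    by (simp_all add: UNIV_bool limit_cov_commute add_ac)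
  have eq: "?S \<omega> * ?T \<omega> = ((?S \<omega> + ?T \<omega>)\<^sup>2 - (?S \<omega>)\<^sup>2 - (?T \<omega>)\<^sup>2) / 2" for \<omega>
    by (simp add: power2_eq_square algebra_simps)
  show "integrable gauss_space (\<lambda>\<omega>. ?S \<omega> * ?T \<omega>)"
    unfolding eq using one two by simp
  have "(\<integral>\<omega>. ?S \<omega> * ?T \<omega> \<partial>gauss_space) = limit_cov s t"
    unfolding eq using one two by simp
  then show "(\<integral>\<omega>. ?S \<omega> * ?T \<omega> \<partial>gauss_space) = s / (12 * t\<^sup>2)"
    using assms by (simp add: limit_cov_def)
qed

theorem proposition2p2:
  fixes M :: "'a measure" and V :: "nat \<Rightarrow> 'a \<Rightarrow> nat"
  assumes "prob_space M"
    and "prob_space.indep_vars M (\<lambda>_. count_space UNIV) V {1..}"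
    and "\<And>n. n \<ge> 1 \<Longrightarrow> distr M (count_space UNIV) (V n) = measure_pmf (pmf_of_set {1..n})"
  shows "(\<exists>(N :: (real \<Rightarrow> real) measure) W.
            prob_space N
          \<and> gaussian_process N {0..} W
          \<and> centered_process N {0..} W
          \<and> (\<forall>\<omega>\<in>space N. W 0 \<omega> = 0)
          \<and> (\<forall>s t. 0 < s \<and> s \<le> t \<longrightarrow>
               integrable N (\<lambda>\<omega>. W s \<omega> * W t \<omega>) \<and> (\<integral>\<omega>. W s \<omega> * W t \<omega> \<partial>N) = s / (12 * t\<^sup>2))
          \<and> (\<forall>e>0. converges_in_distribution skorokhod
               M (\<lambda>n \<omega>. path_from e (descent_process (\<lambda>m. V m \<omega>) n))
               N (\<lambda>\<omega>. path_from e (\<lambda>t. W t \<omega>))))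
       \<and> weak_conv_m
           (\<lambda>n. distr M borel (\<lambda>\<omega>. sqrt (real n) * (real (descents (\<lambda>m. V m \<omega>) n) / real n - 1 / 2)))
           (density lborel (normal_density 0 (sqrt (1 / 12))))"
proof -
  interpret random_insertions M V
    using assms by (simp add: random_insertions_def random_insertions_axioms_def)
  show ?thesis
  proof (intro conjI exI[of _ gauss_space] exI[of _ limit_process] allI impI ballI)
    show "prob_space gauss_space" by (rule prob_space_gauss_space)
    show "gaussian_process gauss_space {0..} limit_process"
      unfolding gaussian_process_def using limit_process_gaussian(1)[where \<tau>="\<lambda>t. t"] by auto
    show "centered_process gauss_space {0..} limit_process"
      unfolding centered_process_def
      using limit_process_gaussian(2,3)[of "{()}" "\<lambda>_. 1"] by auto
    show "limit_process 0 \<omega> = 0" for \<omega> by (simp add: limit_process_def)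
  qed (auto intro: limit_process_covariance descent_process_converges descents_asymptotically_normal)
qed

end
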